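(* Let $\mathfrak m=\mathfrak m(V,W,\beta)=V+W$ be an extended translation algebra over $\mathbb K=\mathbb R$ or $\mathbb C$ with $\dim V\ge3$, and let $\mathfrak g=\sum_p\mathfrak g_p$ be its maximal transitive prolongation. If $W$ is an irreducible $C\!\ell(V)$-module, then exactly one of the following two cases occurs: 1. $\mathfrak g_p=0$ for all $p\ge1$; 2. $\mathfrak g$ is simple.
   Context: Let $\mathbb K=\mathbb R$ or $\mathbb C$ and let $V\neq0$ be a finite-dimensional $\mathbb K$-vector space with a nondegenerate (possibly indefinite in the real case) symmetric bilinear form $(\cdot,\cdot)$. The Clifford algebra $C\!\ell(V)$ has product satisfying $vu+uv=-2(v,u)\mathbf 1$ for $v,u\in V$. Let $W\ne0$ be a finite-dimensional $C\!\ell(V)$-module, with action written $c\cdot s$. The Lie algebra $\mathfrak{so}(V)$ acts on $V$ in the defining way and on $W$ by the spin representation, i.e. the endomorphism $w\mapsto (v,w)u-(u,w)v$ acts on $W$ as $\frac14(vu-uv)\in C\!\ell(V)$. Let $\beta$ be a nondegenerate bilinear form on $W$ such that: (B1) $\beta$ is $\mathfrak{so}(V)$-invariant; (B2) $\beta$ is symmetric (put $\epsilon=-1$) or skew-symmetric (put $\epsilon=1$); (B3) $\beta(v\cdot s,t)=\epsilon\beta(s,v\cdot t)$ for all $v\in V$, $s,t\in W$. The extended translation algebra $\mathfrak m=\mathfrak m(V,W,\beta)$ is the graded Lie algebra $\mathfrak m=\mathfrak m_{-2}+\mathfrak m_{-1}$, $\mathfrak m_{-2}=V$, $\mathfrak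 m_{-1}=W$, whose only nonzero bracket $W\times W\to V$ is given by $([s,t],v)=\beta(v\cdot s,t)$. The maximal transitive prolongation of $\mathfrak m$ is the (unique) graded Lie algebra $\mathfrak g=\sum_{p\in\mathbb Z}\mathfrak g_p$ such that (1) each $\mathfrak g_p$ is finite-dimensional; (2) the negatively graded part of $\mathfrak g$ is $\mathfrak m$ ($\mathfrak g_p=\mathfrak m_p$ for $p=-1,-2$ and $\mathfrak g_p=0$ for $p<-2$); (3) for all $p\ge0$, $X\in\mathfrak g_p$ with $[X,\mathfrak g_{-1}]=0$ implies $X=0$; (4) $\mathfrak g$ is maximal: any graded Lie algebra $\mathfrak g'$ satisfying (1)-(3) admits an injective graded Lie algebra homomorphism $\mathfrak g'\to\mathfrak g$. *)

theory Defs
  imports Complex_Main "HOL-Library.Poly_Mapping" "HOL-Library.Product_Plus"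
    "HOL-Library.Countable_Set" "HOL-Algebra.QuotRing" "HOL-Algebra.Algebraic_Closure_Type"
begin

section \<open>The ground field\<close>

text \<open>The field of scalars is a type \<open>'k\<close> that is isomorphic, as a field, to the real or to the
  complex numbers.\<close>

definition real_or_complex :: "'k::field itself \<Rightarrow> bool" where
  "real_or_complex _ \<longleftrightarrow>
     (ring_of_type_algebra :: 'k ring) \<simeq> (ring_of_type_algebra :: real ring) \<or>
     (ring_of_type_algebra :: 'k ring) \<simeq> (ring_of_type_algebra :: complex ring)"

lemma real_or_complex_real: "real_or_complex TYPE(real)"
  and real_or_complex_complex: "real_or_complex TYPE(complex)"
  unfolding real_or_complex_def is_ring_iso_def using ring_iso_set_refl by blast+


section \<open>Linear algebra\<close>

definition finite_dim :: "('k::field \<Rightarrow> 'a::ab_group_add \<Rightarrow> 'a) \<Rightarrow> 'a set \<Rightarrow> bool" where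
  "finite_dim scale S \<longleftrightarrow> (\<exists>B. finite B \<and> S \<subseteq> Modules.module.span scale B)"

definition bilinear_form :: "('k::field \<Rightarrow> 'a::ab_group_add \<Rightarrow> 'a) \<Rightarrow> ('a \<Rightarrow> 'a \<Rightarrow> 'k) \<Rightarrow> bool" where
  "bilinear_form scale b \<longleftrightarrow>
     (\<forall>x. Vector_Spaces.linear scale (*) (b x)) \<and> (\<forall>y. Vector_Spaces.linear scale (*) (\<lambda>x. b x y))"

definition nondegenerate :: "('a::zero \<Rightarrow> 'a \<Rightarrow> 'k::zero) \<Rightarrow> bool" where
  "nondegenerate b \<longleftrightarrow> (\<forall>x. (\<forall>y. b x y = 0) \<longrightarrow> x = 0) \<and> (\<forall>y. (\<forall>x. b x y = 0) \<longrightarrow> y = 0)"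

locale quadratic_space = vector_space scaleV
  for scaleV :: "'k::field \<Rightarrow> 'v::ab_group_add \<Rightarrow> 'v" +
  fixes form :: "'v \<Rightarrow> 'v \<Rightarrow> 'k"
  assumes nonzero_V: "\<exists>v::'v. v \<noteq> 0"
    and finite_dim_V: "finite_dim scaleV UNIV"
    and bilinear_form: "bilinear_form scaleV form"
    and symmetric_form: "form v u = form u v"
    and nondegenerate_form: "nondegenerate form"


section \<open>The Clifford algebra\<close>

text \<open>The free unital associative algebra on a set of letters is the monoid algebra of the free
  monoid. The wrapper around lists is needed only to make lists a \<open>monoid_add\<close>, so that
  \<open>Poly_Mapping\<close> supplies the ring structure (convolution product).\<close>

datatype 'v free_word = Word "'v list"

instantiation free_word :: (type) monoid_add
begin

definition "0 = Word []"

fun plus_free_word where "Word a + Word b = Word (a @ b)"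

instance
proof
  fix a b c :: "'a free_word"
  show "a + b + c = a + (b + c)" by (cases a; cases b; cases c) simp
  show "0 + a = a" "a + 0 = a" by (cases a; simp add: zero_free_word_def)+
qed

end

type_synonym ('v, 'k) free_algebra = "'v free_word \<Rightarrow>\<^sub>0 'k"

definition letter :: "'v \<Rightarrow> ('v, 'k::field) free_algebra" where
  "letter v = Poly_Mapping.single (Word [v]) 1"

definition const :: "'k \<Rightarrow> ('v, 'k::field) free_algebra" where
  "const c = Poly_Mapping.single 0 c"

text \<open>The first two families of relations make \<open>letter\<close> linear, so the quotient by them alone is
  the tensor algebra of \<open>V\<close>; the third one is \<open>v u + u v = -2 (v, u) 1\<close>.\<close>

definition clifford_ideal ::
  "('k::field \<Rightarrow> 'v::ab_group_add \<Rightarrow> 'v) \<Rightarrow> ('v \<Rightarrow> 'v \<Rightarrow> 'k) \<Rightarrow> ('v, 'k) free_algebra set" where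
  "clifford_ideal scaleV form = genideal ring_of_type_algebra
     ({letter (v + u) - letter v - letter u | v u. True} \<union>
      {letter (scaleV c v) - const c * letter v | c v. True} \<union>
      {letter v * letter u + letter u * letter v - const (- 2 * form v u) | v u. True})"

definition clifford_algebra ::
  "('k::field \<Rightarrow> 'v::ab_group_add \<Rightarrow> 'v) \<Rightarrow> ('v \<Rightarrow> 'v \<Rightarrow> 'k) \<Rightarrow> ('v, 'k) free_algebra set ring" where
  "clifford_algebra scaleV form = ring_of_type_algebra Quot clifford_ideal scaleV form"

definition clifford_class ::
  "('k::field \<Rightarrow> 'v::ab_group_add \<Rightarrow> 'v) \<Rightarrow> ('v \<Rightarrow> 'v \<Rightarrow> 'k) \<Rightarrow>
    ('v, 'k) free_algebra \<Rightarrow> ('v, 'k) free_algebra set" where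
  "clifford_class scaleV form x = clifford_ideal scaleV form +>\<^bsub>ring_of_type_algebra\<^esub> x"

definition clifford_vector ::
  "('k::field \<Rightarrow> 'v::ab_group_add \<Rightarrow> 'v) \<Rightarrow> ('v \<Rightarrow> 'v \<Rightarrow> 'k) \<Rightarrow> 'v \<Rightarrow> ('v, 'k) free_algebra set" where
  "clifford_vector scaleV form v = clifford_class scaleV form (letter v)"

definition clifford_scalar ::
  "('k::field \<Rightarrow> 'v::ab_group_add \<Rightarrow> 'v) \<Rightarrow> ('v \<Rightarrow> 'v \<Rightarrow> 'k) \<Rightarrow> 'k \<Rightarrow> ('v, 'k) free_algebra set" where
  "clifford_scalar scaleV form c = clifford_class scaleV form (const c)"


lemma ring_of_type_algebra_ring: "ring (ring_of_type_algebra :: 'a::ring_1 ring)"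
proof -
  have "\<exists>y. x + y = 0 \<and> y + x = 0" for x :: 'a
    by (rule exI[of _ "- x"]) simp
  moreover have "\<exists>y. x + y = 0" for x :: 'a
    by (rule exI[of _ "- x"]) simp
  ultimately show ?thesis
    unfolding ring_of_type_algebra_def by unfold_locales (auto simp: algebra_simps Units_def)
qed

lemma clifford_ideal_ideal: "ideal (clifford_ideal scaleV form) ring_of_type_algebra"
  unfolding clifford_ideal_def
  by (rule ring.genideal_ideal[OF ring_of_type_algebra_ring]) (simp add: ring_of_type_algebra_def)

lemma clifford_algebra_ring: "ring (clifford_algebra scaleV form)"
  unfolding clifford_algebra_def by (rule ideal.quotient_is_ring[OF clifford_ideal_ideal])

lemma clifford_class_hom:
  "clifford_class scaleV form \<in> ring_hom ring_of_type_algebra (clifford_algebra scaleV form)"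
  using ideal.rcos_ring_hom[OF clifford_ideal_ideal, of scaleV form]
  unfolding clifford_algebra_def clifford_class_def[abs_def] .

lemma clifford_class_eq:
  assumes "x - y \<in> clifford_ideal scaleV form"
  shows "clifford_class scaleV form x = clifford_class scaleV form y"
proof -
  interpret ideal "clifford_ideal scaleV form" ring_of_type_algebra by (rule clifford_ideal_ideal)
  have "x - y + y \<in> clifford_ideal scaleV form +>\<^bsub>ring_of_type_algebra\<^esub> y"
    using a_rcosI[OF assms a_subset, of y] by (simp add: ring_of_type_algebra_def)
  then show ?thesis
    unfolding clifford_class_def
    by (metis a_repr_independence diff_add_cancel is_additive_subgroup additive_subgroup.a_subgroup
        ring_of_type_algebra_def UNIV_I partial_object.select_convs(1))
qed

lemma clifford_relation:
  "clifford_vector scaleV form v \<otimes>\<^bsub>clifford_algebra scaleV form\<^esub> clifford_vector scaleV form u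
     \<oplus>\<^bsub>clifford_algebra scaleV form\<^esub>
   clifford_vector scaleV form u \<otimes>\<^bsub>clifford_algebra scaleV form\<^esub> clifford_vector scaleV form v
   = clifford_scalar scaleV form (- 2 * form v u)"
proof -
  let ?c = "clifford_class scaleV form"
  have mem: "letter v * letter u + letter u * letter v - const (- 2 * form v u)
      \<in> clifford_ideal scaleV form"
    unfolding clifford_ideal_def
    by (rule subsetD[OF ring.genideal_self[OF ring_of_type_algebra_ring]])
      (auto simp: ring_of_type_algebra_def)
  have "?c (letter v * letter u + letter u * letter v) = ?c (const (- 2 * form v u))"
    by (rule clifford_class_eq[OF mem])
  moreover have "?c (letter v * letter u + letter u * letter v)
    = (?c (letter v) \<otimes>\<^bsub>clifford_algebra scaleV form\<^esub> ?c (letter u))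
      \<oplus>\<^bsub>clifford_algebra scaleV form\<^esub> (?c (letter u) \<otimes>\<^bsub>clifford_algebra scaleV form\<^esub> ?c (letter v))"
    using ring_hom_add[OF clifford_class_hom[of scaleV form]]
      ring_hom_mult[OF clifford_class_hom[of scaleV form]]
    by (simp add: ring_of_type_algebra_def)
  ultimately show ?thesis unfolding clifford_vector_def clifford_scalar_def by simp
qed


section \<open>Clifford modules and the spin representation\<close>

text \<open>The Clifford algebra is a \<open>'k\<close>-algebra by way of \<open>clifford_scalar\<close>; \<open>act_scalar\<close> says that the
  scalars of the algebra act on the module as the scalars of its vector space structure.\<close>

locale clifford_module = quadratic_space scaleV form + W: vector_space scaleW
  for scaleV :: "'k::field \<Rightarrow> 'v::ab_group_add \<Rightarrow> 'v"
    and form :: "'v \<Rightarrow> 'v \<Rightarrow> 'k"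
    and scaleW :: "'k \<Rightarrow> 'w::ab_group_add \<Rightarrow> 'w" +
  fixes act :: "('v, 'k) free_algebra set \<Rightarrow> 'w \<Rightarrow> 'w"
  assumes nonzero_W: "\<exists>s::'w. s \<noteq> 0"
    and finite_dim_W: "finite_dim scaleW UNIV"
    and act_add_right: "a \<in> carrier (clifford_algebra scaleV form) \<Longrightarrow> act a (s + t) = act a s + act a t"
    and act_add: "\<lbrakk>a \<in> carrier (clifford_algebra scaleV form); b \<in> carrier (clifford_algebra scaleV form)\<rbrakk>
      \<Longrightarrow> act (a \<oplus>\<^bsub>clifford_algebra scaleV form\<^esub> b) s = act a s + act b s"
    and act_mult: "\<lbrakk>a \<in> carrier (clifford_algebra scaleV form); b \<in> carrier (clifford_algebra scaleV form)\<rbrakk>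
      \<Longrightarrow> act (a \<otimes>\<^bsub>clifford_algebra scaleV form\<^esub> b) s = act a (act b s)"
    and act_one: "act \<one>\<^bsub>clifford_algebra scaleV form\<^esub> s = s"
    and act_scalar: "act (clifford_scalar scaleV form c) s = scaleW c s"

text \<open>Nonvanishing of the module is part of \<open>clifford_module\<close>.\<close>

definition irreducible_clifford_module ::
  "('k::field \<Rightarrow> 'v::ab_group_add \<Rightarrow> 'v) \<Rightarrow> ('v \<Rightarrow> 'v \<Rightarrow> 'k) \<Rightarrow> ('k \<Rightarrow> 'w::ab_group_add \<Rightarrow> 'w) \<Rightarrow>
    (('v, 'k) free_algebra set \<Rightarrow> 'w \<Rightarrow> 'w) \<Rightarrow> bool" where
  "irreducible_clifford_module scaleV form scaleW act \<longleftrightarrow>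
     clifford_module scaleV form scaleW act \<and>
     (\<forall>U. Modules.module.subspace scaleW U \<and>
          (\<forall>a\<in>carrier (clifford_algebra scaleV form). \<forall>s\<in>U. act a s \<in> U) \<longrightarrow> U = {0} \<or> U = UNIV)"

definition so :: "('k::field \<Rightarrow> 'v::ab_group_add \<Rightarrow> 'v) \<Rightarrow> ('v \<Rightarrow> 'v \<Rightarrow> 'k) \<Rightarrow> ('v \<Rightarrow> 'v) set" where
  "so scaleV form =
     {A. Vector_Spaces.linear scaleV scaleV A \<and> (\<forall>x y. form (A x) y + form x (A y) = 0)}"

definition so_generator ::
  "('k::field \<Rightarrow> 'v::ab_group_add \<Rightarrow> 'v) \<Rightarrow> ('v \<Rightarrow> 'v \<Rightarrow> 'k) \<Rightarrow> 'v \<Rightarrow> 'v \<Rightarrow> 'v \<Rightarrow> 'v" where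
  "so_generator scaleV form v u = (\<lambda>w. scaleV (form v w) u - scaleV (form u w) v)"

text \<open>The endomorphisms \<open>so_generator scaleV form v u\<close> span \<open>so scaleV form\<close>, so on \<open>so scaleV form\<close>
  the following predicate determines \<open>spin\<close>.\<close>

definition spin_representation ::
  "('k::field \<Rightarrow> 'v::ab_group_add \<Rightarrow> 'v) \<Rightarrow> ('v \<Rightarrow> 'v \<Rightarrow> 'k) \<Rightarrow> ('k \<Rightarrow> 'w::ab_group_add \<Rightarrow> 'w) \<Rightarrow>
    (('v, 'k) free_algebra set \<Rightarrow> 'w \<Rightarrow> 'w) \<Rightarrow> (('v \<Rightarrow> 'v) \<Rightarrow> 'w \<Rightarrow> 'w) \<Rightarrow> bool" where
  "spin_representation scaleV form scaleW act spin \<longleftrightarrow>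
     (\<forall>A\<in>so scaleV form. Vector_Spaces.linear scaleW scaleW (spin A)) \<and>
     (\<forall>A\<in>so scaleV form. \<forall>B\<in>so scaleV form. \<forall>s. spin (\<lambda>x. A x + B x) s = spin A s + spin B s) \<and>
     (\<forall>A\<in>so scaleV form. \<forall>c s. spin (\<lambda>x. scaleV c (A x)) s = scaleW c (spin A s)) \<and>
     (\<forall>A\<in>so scaleV form. \<forall>B\<in>so scaleV form. \<forall>s.
        spin (\<lambda>x. A (B x) - B (A x)) s = spin A (spin B s) - spin B (spin A s)) \<and>
     (\<forall>v u s. spin (so_generator scaleV form v u) s = scaleW (1 / 4)
        (act (clifford_vector scaleV form v \<otimes>\<^bsub>clifford_algebra scaleV form\<^esub> clifford_vector scaleV form u
              \<ominus>\<^bsub>clifford_algebra scaleV form\<^esub>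
              clifford_vector scaleV form u \<otimes>\<^bsub>clifford_algebra scaleV form\<^esub> clifford_vector scaleV form v) s))"


section \<open>Graded Lie algebras\<close>

locale lie_algebra = vector_space scale
  for scale :: "'k::field \<Rightarrow> 'g::ab_group_add \<Rightarrow> 'g" +
  fixes L :: "'g set" and bracket :: "'g \<Rightarrow> 'g \<Rightarrow> 'g"
  assumes subspace_L: "subspace L"
    and bracket_closed: "\<lbrakk>x \<in> L; y \<in> L\<rbrakk> \<Longrightarrow> bracket x y \<in> L"
    and bracket_add_left: "\<lbrakk>x \<in> L; y \<in> L; z \<in> L\<rbrakk> \<Longrightarrow> bracket (x + y) z = bracket x z + bracket y z"
    and bracket_add_right: "\<lbrakk>x \<in> L; y \<in> L; z \<in> L\<rbrakk> \<Longrightarrow> bracket x (y + z) = bracket x y + bracket x z"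
    and bracket_scale_left: "\<lbrakk>x \<in> L; y \<in> L\<rbrakk> \<Longrightarrow> bracket (scale c x) y = scale c (bracket x y)"
    and bracket_scale_right: "\<lbrakk>x \<in> L; y \<in> L\<rbrakk> \<Longrightarrow> bracket x (scale c y) = scale c (bracket x y)"
    and bracket_self: "x \<in> L \<Longrightarrow> bracket x x = 0"
    and jacobi: "\<lbrakk>x \<in> L; y \<in> L; z \<in> L\<rbrakk> \<Longrightarrow>
      bracket x (bracket y z) + bracket y (bracket z x) + bracket z (bracket x y) = 0"

definition lie_ideal ::
  "('k::field \<Rightarrow> 'g::ab_group_add \<Rightarrow> 'g) \<Rightarrow> 'g set \<Rightarrow> ('g \<Rightarrow> 'g \<Rightarrow> 'g) \<Rightarrow> 'g set \<Rightarrow> bool" where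
  "lie_ideal scale L bracket I \<longleftrightarrow>
     Modules.module.subspace scale I \<and> I \<subseteq> L \<and> (\<forall>x\<in>L. \<forall>y\<in>I. bracket x y \<in> I)"

definition simple_lie_algebra ::
  "('k::field \<Rightarrow> 'g::ab_group_add \<Rightarrow> 'g) \<Rightarrow> 'g set \<Rightarrow> ('g \<Rightarrow> 'g \<Rightarrow> 'g) \<Rightarrow> bool" where
  "simple_lie_algebra scale L bracket \<longleftrightarrow>
     lie_algebra scale L bracket \<and> (\<exists>x\<in>L. \<exists>y\<in>L. bracket x y \<noteq> 0) \<and>
     (\<forall>I. lie_ideal scale L bracket I \<longrightarrow> I = {0} \<or> I = L)"

text \<open>A graded Lie algebra is given inside an ambient vector space by its homogeneous components
  \<open>gr p\<close>; its underlying space is their sum, which is required to be direct.\<close>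

definition graded_carrier ::
  "('k::field \<Rightarrow> 'g::ab_group_add \<Rightarrow> 'g) \<Rightarrow> (int \<Rightarrow> 'g set) \<Rightarrow> 'g set" where
  "graded_carrier scale gr = Modules.module.span scale (\<Union>p. gr p)"

locale graded_lie_algebra = lie_algebra scale "graded_carrier scale gr" bracket
  for scale :: "'k::field \<Rightarrow> 'g::ab_group_add \<Rightarrow> 'g"
    and gr :: "int \<Rightarrow> 'g set" and bracket :: "'g \<Rightarrow> 'g \<Rightarrow> 'g" +
  assumes subspace_gr: "subspace (gr p)"
    and direct_sum: "\<lbrakk>finite P; \<And>p. p \<in> P \<Longrightarrow> f p \<in> gr p; (\<Sum>p\<in>P. f p) = 0; p \<in> P\<rbrakk> \<Longrightarrow> f p = 0"
    and bracket_gr: "\<lbrakk>x \<in> gr p; y \<in> gr q\<rbrakk> \<Longrightarrow> bracket x y \<in> gr (p + q)"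

definition graded_lie_hom ::
  "('k::field \<Rightarrow> 'g::ab_group_add \<Rightarrow> 'g) \<Rightarrow> (int \<Rightarrow> 'g set) \<Rightarrow> ('g \<Rightarrow> 'g \<Rightarrow> 'g) \<Rightarrow>
   ('k \<Rightarrow> 'h::ab_group_add \<Rightarrow> 'h) \<Rightarrow> (int \<Rightarrow> 'h set) \<Rightarrow> ('h \<Rightarrow> 'h \<Rightarrow> 'h) \<Rightarrow> ('g \<Rightarrow> 'h) \<Rightarrow> bool" where
  "graded_lie_hom scale gr bracket scale' gr' bracket' f \<longleftrightarrow>
     (\<forall>x\<in>graded_carrier scale gr. \<forall>y\<in>graded_carrier scale gr. f (x + y) = f x + f y) \<and>
     (\<forall>c. \<forall>x\<in>graded_carrier scale gr. f (scale c x) = scale' c (f x)) \<and>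
     (\<forall>x\<in>graded_carrier scale gr. \<forall>y\<in>graded_carrier scale gr. f (bracket x y) = bracket' (f x) (f y)) \<and>
     (\<forall>p. f ` gr p \<subseteq> gr' p)"


section \<open>Maximal transitive prolongations\<close>

text \<open>\<open>(scale0, gr0, bracket0)\<close> is the negatively graded Lie algebra that is prolonged. Its
  identification with the negatively graded part of \<open>(scale, gr, bracket)\<close> is an embedding \<open>j\<close>,
  since the two live on different types.\<close>

definition transitive_prolongation ::
  "('k::field \<Rightarrow> 'm::ab_group_add \<Rightarrow> 'm) \<Rightarrow> (int \<Rightarrow> 'm set) \<Rightarrow> ('m \<Rightarrow> 'm \<Rightarrow> 'm) \<Rightarrow>
   ('k \<Rightarrow> 'g::ab_group_add \<Rightarrow> 'g) \<Rightarrow> (int \<Rightarrow> 'g set) \<Rightarrow> ('g \<Rightarrow> 'g \<Rightarrow> 'g) \<Rightarrow> bool" where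
  "transitive_prolongation scale0 gr0 bracket0 scale gr bracket \<longleftrightarrow>
     graded_lie_algebra scale gr bracket \<and>
     (\<forall>p. finite_dim scale (gr p)) \<and>
     (\<exists>j. graded_lie_hom scale0 gr0 bracket0 scale gr bracket j \<and>
          inj_on j (graded_carrier scale0 gr0) \<and> (\<forall>p<0. j ` gr0 p = gr p)) \<and>
     (\<forall>p\<ge>0. \<forall>x\<in>gr p. (\<forall>y\<in>gr (- 1). bracket x y = 0) \<longrightarrow> x = 0)"

text \<open>Maximality ranges over graded Lie algebras realized in the type \<open>nat \<Rightarrow>\<^sub>0 'k\<close>. As the components
  are finite-dimensional, a transitive prolongation on any type is isomorphic to one on this type,
  so this is no restriction; see \<open>maximal_transitive_prolongation_any_type\<close> below.\<close>

definition maximal_transitive_prolongation ::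
  "('k::field \<Rightarrow> 'm::ab_group_add \<Rightarrow> 'm) \<Rightarrow> (int \<Rightarrow> 'm set) \<Rightarrow> ('m \<Rightarrow> 'm \<Rightarrow> 'm) \<Rightarrow>
   ('k \<Rightarrow> 'g::ab_group_add \<Rightarrow> 'g) \<Rightarrow> (int \<Rightarrow> 'g set) \<Rightarrow> ('g \<Rightarrow> 'g \<Rightarrow> 'g) \<Rightarrow> bool" where
  "maximal_transitive_prolongation scale0 gr0 bracket0 scale gr bracket \<longleftrightarrow>
     transitive_prolongation scale0 gr0 bracket0 scale gr bracket \<and>
     (\<forall>(scale' :: 'k \<Rightarrow> (nat \<Rightarrow>\<^sub>0 'k) \<Rightarrow> (nat \<Rightarrow>\<^sub>0 'k)) gr' bracket'.
        transitive_prolongation scale0 gr0 bracket0 scale' gr' bracket' \<longrightarrow>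
        (\<exists>f. graded_lie_hom scale' gr' bracket' scale gr bracket f \<and>
             inj_on f (graded_carrier scale' gr')))"


definition poly_mapping_scale :: "'k::field \<Rightarrow> (nat \<Rightarrow>\<^sub>0 'k) \<Rightarrow> (nat \<Rightarrow>\<^sub>0 'k)" where
  "poly_mapping_scale c x = Poly_Mapping.map ((*) c) x"

lemma lookup_poly_mapping_scale [simp]:
  "Poly_Mapping.lookup (poly_mapping_scale c x) n = c * Poly_Mapping.lookup x n"
  by (simp add: poly_mapping_scale_def Poly_Mapping.map.rep_eq when_def)

lemma vector_space_poly_mapping_scale: "vector_space poly_mapping_scale"
  by unfold_locales (simp_all add: poly_mapping_eq_iff fun_eq_iff lookup_add algebra_simps)

lemma independent_unit_vectors:
  "\<not> Modules.module.dependent poly_mapping_scale (range (\<lambda>n. Poly_Mapping.single n 1))"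
proof -
  interpret P: vector_space poly_mapping_scale by (rule vector_space_poly_mapping_scale)
  have "u v = 0" if fin: "finite t" and t: "t \<subseteq> range (\<lambda>n. Poly_Mapping.single n 1)"
    and s: "(\<Sum>v\<in>t. poly_mapping_scale (u v) v) = 0" and v: "v \<in> t"
    for t and u :: "(nat \<Rightarrow>\<^sub>0 'a) \<Rightarrow> 'a" and v
  proof -
    obtain n where n: "v = Poly_Mapping.single n 1" using t v by blast
    have "0 = Poly_Mapping.lookup (\<Sum>v\<in>t. poly_mapping_scale (u v) v) n" by (simp add: s)
    also have "\<dots> = (\<Sum>w\<in>t. u w * Poly_Mapping.lookup w n)" by (simp add: lookup_sum)
    also have "\<dots> = (\<Sum>w\<in>t. if w = v then u v else 0)"
    proof (rule sum.cong)
      fix w assume "w \<in> t"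
      then obtain m where m: "w = Poly_Mapping.single m 1" using t by blast
      show "u w * Poly_Mapping.lookup w n = (if w = v then u v else 0)"
      proof (cases "m = n")
        case True
        then show ?thesis using m n by simp
      next
        case False
        then have "Poly_Mapping.lookup w n = 0" "Poly_Mapping.lookup v n = 1"
          by (simp_all add: m n lookup_single)
        then show ?thesis by auto
      qed
    qed simp
    also have "\<dots> = u v" using fin v by simp
    finally show ?thesis by simp
  qed
  then show ?thesis unfolding P.dependent_explicit by blast
qed

lemma countable_dim_embedding:
  fixes scale :: "'k::field \<Rightarrow> 'h::ab_group_add \<Rightarrow> 'h"
  assumes "vector_space scale" and fd: "\<And>p::int. finite_dim scale (gr p)"
  shows "\<exists>T. Vector_Spaces.linear scale poly_mapping_scale T \<and> inj_on T (graded_carrier scale gr)"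
proof -
  interpret vector_space scale by fact
  interpret P: vector_space poly_mapping_scale by (rule vector_space_poly_mapping_scale)
  interpret vector_space_pair scale poly_mapping_scale ..
  obtain C where C: "\<And>p. finite (C p)" "\<And>p. gr p \<subseteq> span (C p)"
    using fd unfolding finite_dim_def by metis
  obtain B where B: "B \<subseteq> (\<Union>p. C p)" "independent B" "(\<Union>p. C p) \<subseteq> span B"
    by (rule maximal_independent_subset)
  have "countable (\<Union>p. C p)" using C(1) by (auto intro: countable_finite)
  then have cB: "countable B" using B(1) countable_subset by blast
  have "gr p \<subseteq> span B" for p
  proof -
    have "C p \<subseteq> span B" using B(3) by blast
    then have "span (C p) \<subseteq> span B" by (simp add: span_minimal)
    then show ?thesis using C(2) by blast
  qed
  then have sub: "graded_carrier scale gr \<subseteq> span B"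
    unfolding graded_carrier_def by (simp add: span_minimal UN_least)
  define e where "e b = (Poly_Mapping.single (to_nat_on B b) (1::'k))" for b
  define T where "T = construct B e"
  have lin: "Vector_Spaces.linear scale poly_mapping_scale T"
    unfolding T_def by (rule linear_construct[OF B(2)])
  have Te: "T b = e b" if "b \<in> B" for b
    unfolding T_def by (rule construct_basis[OF B(2) that])
  have "T ` B \<subseteq> range (\<lambda>n. Poly_Mapping.single n 1)"
    using Te by (auto simp: e_def)
  then have ind: "P.independent (T ` B)"
    using independent_unit_vectors P.independent_mono by blast
  have inj: "inj_on T B"
  proof (rule inj_onI)
    fix b c assume bc: "b \<in> B" "c \<in> B" "T b = T c"
    then have "Poly_Mapping.lookup (e b) (to_nat_on B c) = Poly_Mapping.lookup (e c) (to_nat_on B c)"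
      by (simp add: Te)
    then have "to_nat_on B b = to_nat_on B c"
      by (auto simp: e_def lookup_single when_def split: if_splits)
    then show "b = c" using cB bc by simp
  qed
  have "inj_on T (span B)"
    using linear_inj_on_span_iff_independent_image[OF lin ind] inj by blast
  then show ?thesis using lin sub inj_on_subset by blast
qed

lemma transport_graded_lie_algebra:
  fixes scale :: "'k::field \<Rightarrow> 'h::ab_group_add \<Rightarrow> 'h"
    and scale' :: "'k \<Rightarrow> 'u::ab_group_add \<Rightarrow> 'u"
  assumes G: "graded_lie_algebra scale gr bracket"
    and T: "Vector_Spaces.linear scale scale' T" and inj: "inj_on T (graded_carrier scale gr)"
  defines "U \<equiv> inv_into (graded_carrier scale gr) T"
  defines "gr' \<equiv> \<lambda>p. T ` gr p"
  defines "bracket' \<equiv> \<lambda>x y. T (bracket (U x) (U y))"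
  shows "graded_lie_algebra scale' gr' bracket'"
    and "graded_carrier scale' gr' = T ` graded_carrier scale gr"
    and "graded_lie_hom scale gr bracket scale' gr' bracket' T"
proof -
  interpret graded_lie_algebra scale gr bracket by fact
  interpret T: Vector_Spaces.linear scale scale' T by fact
  let ?L = "graded_carrier scale gr"
  show L': "graded_carrier scale' gr' = T ` ?L"
    unfolding graded_carrier_def gr'_def by (simp add: T.span_image[symmetric] image_UN)
  have UT: "U (T x) = x" if "x \<in> ?L" for x
    unfolding U_def using inj that by simp
  have grL: "gr p \<subseteq> ?L" for p
    using span_superset[of "\<Union>p. gr p"] by (simp add: graded_carrier_def UN_subset_iff)
  have add: "x + y \<in> ?L" if "x \<in> ?L" "y \<in> ?L" for x y
    using subspace_L that by (rule subspace_add)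
  have sc: "scale c x \<in> ?L" if "x \<in> ?L" for c x
    using subspace_L that by (rule subspace_scale)
  have br: "bracket' (T x) (T y) = T (bracket x y)" if "x \<in> ?L" "y \<in> ?L" for x y
    by (simp add: bracket'_def UT that)
  have zero: "x = 0" if "x \<in> ?L" "T x = 0" for x
    using inj_onD[OF inj, of x 0] that subspace_0[OF subspace_L] T.zero by auto
  show "graded_lie_algebra scale' gr' bracket'"
    unfolding graded_lie_algebra_def lie_algebra_def lie_algebra_axioms_def
      graded_lie_algebra_axioms_def L'
  proof (intro conjI allI impI)
    show "vector_space scale'" by (rule T.vs2.vector_space_axioms)
    show "T.vs2.subspace (T ` ?L)" by (rule T.subspace_image[OF subspace_L])
    show "T.vs2.subspace (gr' p)" for p unfolding gr'_def by (rule T.subspace_image[OF subspace_gr])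
    fix x y assume "x \<in> T ` ?L" "y \<in> T ` ?L"
    then obtain a b where ab: "x = T a" "y = T b" "a \<in> ?L" "b \<in> ?L" by blast
    show "bracket' x y \<in> T ` ?L" using ab br bracket_closed by simp
    show "bracket' (scale' c x) y = scale' c (bracket' x y)" for c
      using ab by (simp add: T.scale[symmetric] br sc bracket_scale_left)
    show "bracket' x (scale' c y) = scale' c (bracket' x y)" for c
      using ab by (simp add: T.scale[symmetric] br sc bracket_scale_right)
    fix z assume "z \<in> T ` ?L"
    then obtain d where d: "z = T d" "d \<in> ?L" by blast
    show "bracket' (x + y) z = bracket' x z + bracket' y z"
      using ab d by (simp add: T.add[symmetric] br add bracket_add_left)
    show "bracket' x (y + z) = bracket' x y + bracket' x z"
      using ab d by (simp add: T.add[symmetric] br add bracket_add_right)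
    show "bracket' x (bracket' y z) + bracket' y (bracket' z x) + bracket' z (bracket' x y) = 0"
      using ab d by (simp add: T.add[symmetric] br bracket_closed jacobi T.zero)
  next
    fix x assume "x \<in> T ` ?L"
    then show "bracket' x x = 0" using br bracket_self by (auto simp: T.zero)
  next
    fix P f p
    assume P: "finite P" "\<forall>p. p \<in> P \<longrightarrow> f p \<in> gr' p" "(\<Sum>p\<in>P. f p) = 0" and p: "p \<in> P"
    then have "\<forall>q\<in>P. \<exists>a. a \<in> gr q \<and> f q = T a" unfolding gr'_def by blast
    then obtain h where h: "\<And>q. q \<in> P \<Longrightarrow> h q \<in> gr q" "\<And>q. q \<in> P \<Longrightarrow> f q = T (h q)" by metis
    have "T (\<Sum>q\<in>P. h q) = 0" using P(3) h(2) by (simp add: T.sum)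
    moreover have "(\<Sum>q\<in>P. h q) \<in> ?L"
      using h(1) grL by (intro subspace_sum[OF subspace_L]) blast
    ultimately have "(\<Sum>q\<in>P. h q) = 0" using zero by blast
    then have "h p = 0" using direct_sum[where f = h, OF P(1) h(1) _ p] by simp
    then show "f p = 0" using h(2)[OF p] by (simp add: T.zero)
  next
    fix x p y q assume "x \<in> gr' p" "y \<in> gr' q"
    then obtain a b where ab: "x = T a" "y = T b" "a \<in> gr p" "b \<in> gr q" unfolding gr'_def by blast
    have "bracket' x y = T (bracket a b)"
      unfolding ab(1,2) by (rule br[OF subsetD[OF grL ab(3)] subsetD[OF grL ab(4)]])
    then show "bracket' x y \<in> gr' (p + q)" using bracket_gr[OF ab(3,4)] by (simp add: gr'_def)
  qed
  show "graded_lie_hom scale gr bracket scale' gr' bracket' T"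
    unfolding graded_lie_hom_def by (auto simp: T.add T.scale br gr'_def)
qed

lemma graded_lie_hom_carrier:
  assumes "vector_space scale" "vector_space scale'"
    and f: "graded_lie_hom scale gr bracket scale' gr' bracket' f"
    and x: "x \<in> graded_carrier scale gr"
  shows "f x \<in> graded_carrier scale' gr'"
proof -
  interpret vector_space scale by fact
  interpret V': vector_space scale' by fact
  have L: "subspace (graded_carrier scale gr)" by (simp add: graded_carrier_def)
  have zero: "f 0 = 0"
    using f subspace_0[OF L] unfolding graded_lie_hom_def by (metis add_cancel_left_left add_0)
  have gr: "f ` gr p \<subseteq> V'.span (\<Union>p. gr' p)" for p
    using f V'.span_superset[of "\<Union>p. gr' p"] unfolding graded_lie_hom_def by blast
  have "x \<in> span (\<Union>p. gr p)" using x by (simp add: graded_carrier_def)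
  then have "x \<in> graded_carrier scale gr \<and> f x \<in> V'.span (\<Union>p. gr' p)"
  proof (induction rule: span_induct_alt)
    case base
    then show ?case using zero L subspace_0 V'.span_zero by auto
  next
    case (step c x y)
    have xL: "x \<in> graded_carrier scale gr"
      using step(1) by (simp add: graded_carrier_def span_base)
    then have "f (scale c x + y) = scale' c (f x) + f y"
      using f step(2) subspace_scale[OF L] unfolding graded_lie_hom_def by simp
    moreover have "f x \<in> V'.span (\<Union>p. gr' p)" using gr step(1) by blast
    ultimately show ?case using step(2) xL L
      by (simp add: V'.span_add V'.span_scale subspace_add subspace_scale)
  qed
  then show ?thesis by (simp add: graded_carrier_def)
qed

lemma graded_lie_hom_comp:
  assumes "vector_space scale1" "vector_space scale2"
    and f: "graded_lie_hom scale1 gr1 bracket1 scale2 gr2 bracket2 f"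
    and g: "graded_lie_hom scale2 gr2 bracket2 scale3 gr3 bracket3 g"
  shows "graded_lie_hom scale1 gr1 bracket1 scale3 gr3 bracket3 (g \<circ> f)"
proof -
  have L: "f x \<in> graded_carrier scale2 gr2" if "x \<in> graded_carrier scale1 gr1" for x
    using graded_lie_hom_carrier[OF assms(1,2) f that] .
  have "(g \<circ> f) ` gr1 p \<subseteq> gr3 p" for p
  proof -
    have "f ` gr1 p \<subseteq> gr2 p" "g ` gr2 p \<subseteq> gr3 p"
      using f g by (simp_all add: graded_lie_hom_def)
    then show ?thesis by auto
  qed
  then show ?thesis using f g L by (simp add: graded_lie_hom_def)
qed

lemma maximal_transitive_prolongation_any_type:
  fixes scale' :: "'k::field \<Rightarrow> 'h::ab_group_add \<Rightarrow> 'h"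
  assumes max: "maximal_transitive_prolongation scale0 gr0 bracket0 scale gr bracket"
    and m: "vector_space scale0"
    and tp: "transitive_prolongation scale0 gr0 bracket0 scale' gr' bracket'"
  shows "\<exists>f. graded_lie_hom scale' gr' bracket' scale gr bracket f \<and>
             inj_on f (graded_carrier scale' gr')"
proof -
  let ?L = "graded_carrier scale' gr'"
  interpret graded_lie_algebra scale' gr' bracket'
    using tp by (simp add: transitive_prolongation_def)
  have fd: "finite_dim scale' (gr' p)" for p
    using tp by (simp add: transitive_prolongation_def)
  obtain T where T: "Vector_Spaces.linear scale' poly_mapping_scale T" and inj: "inj_on T ?L"
    using countable_dim_embedding[OF vector_space_axioms, of gr', OF fd] by blast
  interpret T: Vector_Spaces.linear scale' poly_mapping_scale T by fact
  define gr1 where "gr1 = (\<lambda>p. T ` gr' p)"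
  define bracket1 where "bracket1 = (\<lambda>x y. T (bracket' (inv_into ?L T x) (inv_into ?L T y)))"
  have G1: "graded_lie_algebra poly_mapping_scale gr1 bracket1"
    and L1: "graded_carrier poly_mapping_scale gr1 = T ` ?L"
    and hT: "graded_lie_hom scale' gr' bracket' poly_mapping_scale gr1 bracket1 T"
    unfolding gr1_def bracket1_def
    by (rule transport_graded_lie_algebra[OF graded_lie_algebra_axioms T inj])+
  have grL: "gr' p \<subseteq> ?L" for p
    using span_superset[of "\<Union>p. gr' p"] by (simp add: graded_carrier_def UN_subset_iff)
  have trans: "x = 0" if "0 \<le> p" "x \<in> gr' p" "\<forall>y\<in>gr' (- 1). bracket' x y = 0" for p x
    using tp that by (simp add: transitive_prolongation_def)
  have "\<exists>j. graded_lie_hom scale0 gr0 bracket0 scale' gr' bracket' j \<and>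
      inj_on j (graded_carrier scale0 gr0) \<and> (\<forall>p<0. j ` gr0 p = gr' p)"
    using tp by (simp add: transitive_prolongation_def)
  then obtain j where j: "graded_lie_hom scale0 gr0 bracket0 scale' gr' bracket' j"
      "inj_on j (graded_carrier scale0 gr0)" "\<And>p. p < 0 \<Longrightarrow> j ` gr0 p = gr' p"
    by (elim exE conjE) simp
  have jL: "j ` graded_carrier scale0 gr0 \<subseteq> ?L"
    using graded_lie_hom_carrier[OF m vector_space_axioms j(1)] by blast
  have "transitive_prolongation scale0 gr0 bracket0 poly_mapping_scale gr1 bracket1"
    unfolding transitive_prolongation_def
  proof (intro conjI allI impI ballI)
    show "graded_lie_algebra poly_mapping_scale gr1 bracket1" by fact
    show "finite_dim poly_mapping_scale (gr1 p)" for p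
    proof -
      obtain B where "finite B" "gr' p \<subseteq> span B"
        using fd[of p] unfolding finite_dim_def by blast
      then have "finite (T ` B)" "gr1 p \<subseteq> T.vs2.span (T ` B)"
        unfolding gr1_def T.span_image by (simp_all add: image_mono)
      then show ?thesis unfolding finite_dim_def by blast
    qed
    show "\<exists>j. graded_lie_hom scale0 gr0 bracket0 poly_mapping_scale gr1 bracket1 j \<and>
          inj_on j (graded_carrier scale0 gr0) \<and> (\<forall>p<0. j ` gr0 p = gr1 p)"
    proof (intro exI[of _ "T \<circ> j"] conjI allI impI)
      show "graded_lie_hom scale0 gr0 bracket0 poly_mapping_scale gr1 bracket1 (T \<circ> j)"
        by (rule graded_lie_hom_comp[OF m vector_space_axioms j(1) hT])
      show "inj_on (T \<circ> j) (graded_carrier scale0 gr0)"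
        using j(2) inj jL by (simp add: comp_inj_on inj_on_subset)
      show "(T \<circ> j) ` gr0 p = gr1 p" if "p < 0" for p
        unfolding image_comp[symmetric] j(3)[OF that] by (simp add: gr1_def)
    qed
    fix p :: int and x assume p: "0 \<le> p" and x: "x \<in> gr1 p" and z: "\<forall>y\<in>gr1 (- 1). bracket1 x y = 0"
    obtain a where a: "x = T a" "a \<in> gr' p" using x unfolding gr1_def by blast
    have "bracket' a y = 0" if y: "y \<in> gr' (- 1)" for y
    proof -
      have aL: "a \<in> ?L" "y \<in> ?L" by (rule subsetD[OF grL a(2)], rule subsetD[OF grL y])
      have "T (bracket' a y) = bracket1 (T a) (T y)"
        using hT aL unfolding graded_lie_hom_def by simp
      also have "\<dots> = T 0" using z a y by (simp add: gr1_def T.zero)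
      finally show ?thesis
        using inj_onD[OF inj] bracket_closed[OF aL] subspace_0[OF subspace_L] by blast
    qed
    then have "a = 0" using trans[OF p a(2)] by blast
    then show "x = 0" using a T.zero by simp
  qed
  then obtain f where f: "graded_lie_hom poly_mapping_scale gr1 bracket1 scale gr bracket f"
    "inj_on f (graded_carrier poly_mapping_scale gr1)"
    using max[unfolded maximal_transitive_prolongation_def, THEN conjunct2, rule_format]
    by blast
  have "graded_lie_hom scale' gr' bracket' scale gr bracket (f \<circ> T)"
    by (rule graded_lie_hom_comp[OF vector_space_axioms vector_space_poly_mapping_scale hT f(1)])
  moreover have "inj_on (f \<circ> T) ?L"
    using comp_inj_on[OF inj] f(2) unfolding L1 by blast
  ultimately show ?thesis by blast
qed


section \<open>Extended translation algebras\<close>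

locale extended_translation_algebra = clifford_module scaleV form scaleW act
  for scaleV :: "'k::field \<Rightarrow> 'v::ab_group_add \<Rightarrow> 'v"
    and form :: "'v \<Rightarrow> 'v \<Rightarrow> 'k"
    and scaleW :: "'k \<Rightarrow> 'w::ab_group_add \<Rightarrow> 'w"
    and act :: "('v, 'k) free_algebra set \<Rightarrow> 'w \<Rightarrow> 'w" +
  fixes spin :: "('v \<Rightarrow> 'v) \<Rightarrow> 'w \<Rightarrow> 'w"
    and \<beta> :: "'w \<Rightarrow> 'w \<Rightarrow> 'k"
    and \<epsilon> :: 'k
  assumes spin: "spin_representation scaleV form scaleW act spin"
    and bilinear_beta: "bilinear_form scaleW \<beta>"
    and nondegenerate_beta: "nondegenerate \<beta>"
    and beta_invariant: "A \<in> so scaleV form \<Longrightarrow> \<beta> (spin A s) t + \<beta> s (spin A t) = 0"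
    and beta_symmetry: "(\<forall>s t. \<beta> s t = \<beta> t s) \<and> \<epsilon> = - 1 \<or> (\<forall>s t. \<beta> s t = - \<beta> t s) \<and> \<epsilon> = 1"
    and beta_clifford: "\<beta> (act (clifford_vector scaleV form v) s) t
      = \<epsilon> * \<beta> s (act (clifford_vector scaleV form v) t)"

definition translation_scale ::
  "('k \<Rightarrow> 'v \<Rightarrow> 'v) \<Rightarrow> ('k \<Rightarrow> 'w \<Rightarrow> 'w) \<Rightarrow> 'k \<Rightarrow> 'v \<times> 'w \<Rightarrow> 'v \<times> 'w" where
  "translation_scale scaleV scaleW c x = (scaleV c (fst x), scaleW c (snd x))"

definition translation_gr :: "int \<Rightarrow> ('v::zero \<times> 'w::zero) set" where
  "translation_gr p = (if p = - 2 then UNIV \<times> {0} else if p = - 1 then {0} \<times> UNIV else {0})"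

text \<open>Existence and uniqueness of the vector \<open>b\<close> come from nondegeneracy of \<open>form\<close>.\<close>

definition translation_bracket ::
  "('k::field \<Rightarrow> 'v::ab_group_add \<Rightarrow> 'v) \<Rightarrow> ('v \<Rightarrow> 'v \<Rightarrow> 'k) \<Rightarrow>
    (('v, 'k) free_algebra set \<Rightarrow> 'w::ab_group_add \<Rightarrow> 'w) \<Rightarrow> ('w \<Rightarrow> 'w \<Rightarrow> 'k) \<Rightarrow>
    'v \<times> 'w \<Rightarrow> 'v \<times> 'w \<Rightarrow> 'v \<times> 'w" where
  "translation_bracket scaleV form act \<beta> x y =
     ((THE b. \<forall>v. form b v = \<beta> (act (clifford_vector scaleV form v) (snd x)) (snd y)), 0)"

lemma (in quadratic_space) represent_functional:
  assumes "Vector_Spaces.linear scaleV (*) \<phi>"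
  shows "\<exists>!b. \<forall>v. form b v = \<phi> v"
proof -
  interpret \<phi>: Vector_Spaces.linear scaleV "(*)" \<phi> by fact
  have lin: "Vector_Spaces.linear scaleV (*) (form x)" "Vector_Spaces.linear scaleV (*) (\<lambda>x. form x y)" for x y
    using bilinear_form by (auto simp: bilinear_form_def)
  obtain C where C: "finite C" "UNIV \<subseteq> span C"
    using finite_dim_V by (auto simp: finite_dim_def)
  obtain B where B: "B \<subseteq> C" "independent B" "C \<subseteq> span B"
    by (rule maximal_independent_subset)
  have fB: "finite B" using B(1) C(1) by (rule finite_subset)
  have "span C \<subseteq> span B" using B(3) by (simp add: span_minimal)
  then have spB: "span B = UNIV" using C(2) by blast
  interpret finite_dimensional_vector_space scaleV B
    by unfold_locales (use fB B(2) spB in auto)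
  interpret VV: vector_space_pair scaleV "(*) :: 'k \<Rightarrow> 'k \<Rightarrow> 'k"
    by (rule vector_space_pair.intro[OF vector_space_axioms Vector_Spaces.linear.axioms(2)[OF assms]])
  have ext: "f = g" if "Vector_Spaces.linear scaleV (*) f" "Vector_Spaces.linear scaleV (*) g"
    "\<And>b. b \<in> B \<Longrightarrow> f b = g b" for f g :: "'v \<Rightarrow> 'k"
    using VV.linear_eq_on_span[OF that(1,2), of B] that(3) spB by (auto simp: fun_eq_iff)
  define F where "F x = (\<Sum>b\<in>B. scaleV (form x b) b)" for x
  have linF: "Vector_Spaces.linear scaleV scaleV F"
  proof (rule Vector_Spaces.linear.intro[OF vector_space_axioms vector_space_axioms], unfold_locales)
    show "F (x + y) = F x + F y" for x y
      using lin(2) by (simp add: F_def Vector_Spaces.linear_iff scale_left_distrib sum.distrib)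
    show "F (scaleV c x) = scaleV c (F x)" for c x
      using lin(2) by (simp add: F_def Vector_Spaces.linear_iff scale_sum_right)
  qed
  have coeff: "f b = g b" if "(\<Sum>b\<in>B. scaleV (f b) b) = (\<Sum>b\<in>B. scaleV (g b) b)" "b \<in> B" for f g b
  proof -
    have "(\<Sum>b\<in>B. scaleV (f b - g b) b) = 0"
      using that(1) by (simp add: scale_left_diff_distrib sum_subtractf)
    then have "f b - g b = 0" by (rule independentD[OF B(2) fB subset_refl _ that(2)])
    then show ?thesis by simp
  qed
  have inj: "form x = form y" if "F x = F y" for x y
    using coeff[OF that[unfolded F_def]] by (intro ext lin) blast
  have eqI: "x = y" if "form x = form y" for x y
  proof -
    have "form (x - y) v = 0" for v
      using that Vector_Spaces.linear.axioms(3)[OF lin(2)[of v]] module_hom.diff[of scaleV "(*)" "\<lambda>x. form x v" x y]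
      by simp
    then show ?thesis using nondegenerate_form unfolding nondegenerate_def by (metis right_minus_eq)
  qed
  have "inj F" by (rule injI) (rule eqI, rule inj)
  then have "surj F" using linear_inj_imp_surj[OF linF] by blast
  then obtain b where b: "F b = (\<Sum>b\<in>B. scaleV (\<phi> b) b)" by (metis surjD)
  have "form b = \<phi>"
    by (intro ext lin assms) (rule coeff[OF b[unfolded F_def]])
  then show ?thesis by (intro ex1I[of _ b] eqI) (simp_all add: fun_eq_iff)
qed

context extended_translation_algebra
begin

lemma translation_bracket_form:
  "form (fst (translation_bracket scaleV form act \<beta> x y)) v
     = \<beta> (act (clifford_vector scaleV form v) (snd x)) (snd y)"
proof -
  have hom: "clifford_class scaleV form a \<in> carrier (clifford_algebra scaleV form)" for a
    using ring_hom_closed[OF clifford_class_hom[of scaleV form], of a]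
    by (simp add: ring_of_type_algebra_def)
  have bl: "\<beta> (s + s') t = \<beta> s t + \<beta> s' t" "\<beta> (scaleW c s) t = c * \<beta> s t" for s s' t c
    using bilinear_beta by (simp_all add: bilinear_form_def Vector_Spaces.linear_iff)
  have cadd: "clifford_vector scaleV form (v + u) = clifford_vector scaleV form v
      \<oplus>\<^bsub>clifford_algebra scaleV form\<^esub> clifford_vector scaleV form u" for v u
  proof -
    have "letter (v + u) - (letter v + letter u) \<in> clifford_ideal scaleV form"
      unfolding clifford_ideal_def diff_diff_eq[symmetric]
      by (rule subsetD[OF ring.genideal_self[OF ring_of_type_algebra_ring]])
        (auto simp: ring_of_type_algebra_def)
    from clifford_class_eq[OF this] show ?thesis
      using ring_hom_add[OF clifford_class_hom[of scaleV form], of "letter v" "letter u"]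
      by (simp add: clifford_vector_def ring_of_type_algebra_def)
  qed
  have cscale: "clifford_vector scaleV form (scaleV c v) = clifford_scalar scaleV form c
      \<otimes>\<^bsub>clifford_algebra scaleV form\<^esub> clifford_vector scaleV form v" for c v
  proof -
    have "letter (scaleV c v) - const c * letter v \<in> clifford_ideal scaleV form"
      unfolding clifford_ideal_def
      by (rule subsetD[OF ring.genideal_self[OF ring_of_type_algebra_ring]])
        (auto simp: ring_of_type_algebra_def)
    from clifford_class_eq[OF this] show ?thesis
      using ring_hom_mult[OF clifford_class_hom[of scaleV form], of "const c" "letter v"]
      by (simp add: clifford_vector_def clifford_scalar_def ring_of_type_algebra_def)
  qed
  have "Vector_Spaces.linear scaleV (*)
      (\<lambda>v. \<beta> (act (clifford_vector scaleV form v) (snd x)) (snd y))"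
    unfolding Vector_Spaces.linear_iff
  proof (intro conjI allI)
    show "vector_space scaleV" by (rule vector_space_axioms)
    show "vector_space ((*) :: 'k \<Rightarrow> 'k \<Rightarrow> 'k)"
      by unfold_locales (simp_all add: algebra_simps)
    show "\<beta> (act (clifford_vector scaleV form (v + u)) (snd x)) (snd y)
      = \<beta> (act (clifford_vector scaleV form v) (snd x)) (snd y)
        + \<beta> (act (clifford_vector scaleV form u) (snd x)) (snd y)" for v u
      by (simp add: cadd act_add hom[of "letter v" for v, folded clifford_vector_def] bl)
    show "\<beta> (act (clifford_vector scaleV form (scaleV c v)) (snd x)) (snd y)
      = c * \<beta> (act (clifford_vector scaleV form v) (snd x)) (snd y)" for c v
    proof -
      have "act (clifford_vector scaleV form (scaleV c v)) (snd x)
        = scaleW c (act (clifford_vector scaleV form v) (snd x))"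
        using act_mult[of "clifford_scalar scaleV form c" "clifford_vector scaleV form v"]
        by (simp add: cscale act_scalar hom[of "letter v", folded clifford_vector_def]
            hom[of "const c", folded clifford_scalar_def])
      then show ?thesis by (simp add: bl)
    qed
  qed
  from theI'[OF represent_functional[OF this]] show ?thesis
    by (simp add: translation_bracket_def)
qed

lemma translation_carrier:
  "graded_carrier (translation_scale scaleV scaleW) translation_gr = UNIV"
  and vector_space_translation_scale: "vector_space (translation_scale scaleV scaleW)"
proof -
  show "vector_space (translation_scale scaleV scaleW)"
    by unfold_locales (auto simp: translation_scale_def prod_eq_iff algebra_simps
        W.scale_right_distrib W.scale_left_distrib)
  then interpret M: vector_space "translation_scale scaleV scaleW" .
  have "x \<in> M.span (\<Union>p. translation_gr p)" for x
  proof -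
    have "(fst x, 0) \<in> translation_gr (- 2)" "(0, snd x) \<in> translation_gr (- 1)"
      by (simp_all add: translation_gr_def)
    then have "(fst x, 0) + (0, snd x) \<in> M.span (\<Union>p. translation_gr p)"
      by (intro M.span_add M.span_base) blast+
    then show ?thesis by simp
  qed
  then show "graded_carrier (translation_scale scaleV scaleW) translation_gr = UNIV"
    by (auto simp: graded_carrier_def)
qed

lemma translation_graded_lie_algebra:
  assumes two: "(2::'k) \<noteq> 0"
  shows "graded_lie_algebra (translation_scale scaleV scaleW) translation_gr
     (translation_bracket scaleV form act \<beta>)"
proof -
  let ?s = "translation_scale scaleV scaleW" and ?b = "translation_bracket scaleV form act \<beta>"
  interpret M: vector_space ?s by (rule vector_space_translation_scale)
  have bl: "\<beta> (s + s') t = \<beta> s t + \<beta> s' t" "\<beta> (scaleW c s) t = c * \<beta> s t"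
    "\<beta> t (s + s') = \<beta> t s + \<beta> t s'" "\<beta> t (scaleW c s) = c * \<beta> t s" for s s' t c
    using bilinear_beta by (simp_all add: bilinear_form_def Vector_Spaces.linear_iff)
  have fl: "form (s + s') t = form s t + form s' t" "form (scaleV c s) t = c * form s t" for s s' t c
    using bilinear_form by (simp_all add: bilinear_form_def Vector_Spaces.linear_iff)
  have eqI: "x = y" if "\<And>v. form x v = form y v" for x y
  proof -
    have "form (x - y) v = 0" for v
      using fl(1)[of "x - y" y v] that[of v] by simp
    then show ?thesis using nondegenerate_form unfolding nondegenerate_def by (metis right_minus_eq)
  qed
  have snd0: "snd (?b x y) = 0" for x y by (simp add: translation_bracket_def)
  have cc: "clifford_vector scaleV form v \<in> carrier (clifford_algebra scaleV form)" for v
    using ring_hom_closed[OF clifford_class_hom[of scaleV form], of "letter v"]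
    by (simp add: ring_of_type_algebra_def clifford_vector_def)
  have cs: "clifford_scalar scaleV form c \<in> carrier (clifford_algebra scaleV form)" for c
    using ring_hom_closed[OF clifford_class_hom[of scaleV form], of "const c"]
    by (simp add: ring_of_type_algebra_def clifford_scalar_def)
  have comm: "clifford_vector scaleV form v \<otimes>\<^bsub>clifford_algebra scaleV form\<^esub> clifford_scalar scaleV form c
    = clifford_scalar scaleV form c \<otimes>\<^bsub>clifford_algebra scaleV form\<^esub> clifford_vector scaleV form v" for v c
  proof -
    have "letter v * const c = const c * letter v"
      unfolding letter_def const_def mult_single by simp
    then show ?thesis
      using ring_hom_mult[OF clifford_class_hom[of scaleV form], of "letter v" "const c"]
        ring_hom_mult[OF clifford_class_hom[of scaleV form], of "const c" "letter v"]
      by (simp add: ring_of_type_algebra_def clifford_vector_def clifford_scalar_def)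
  qed
  have act_scale: "act (clifford_vector scaleV form v) (scaleW c s)
    = scaleW c (act (clifford_vector scaleV form v) s)" for v c s
    using act_mult[OF cc cs, of v c s] act_mult[OF cs cc, of c v s] by (simp add: comm act_scalar)
  have eps: "\<beta> t s = - \<epsilon> * \<beta> s t" for s t
    using beta_symmetry by (metis minus_minus mult_1 mult_minus_left)
  have skew: "\<beta> (act (clifford_vector scaleV form v) s) t = - \<beta> (act (clifford_vector scaleV form v) t) s" for v s t
  proof -
    have "\<epsilon> * \<epsilon> = 1" using beta_symmetry by auto
    moreover have "\<beta> (act (clifford_vector scaleV form v) s) t
      = \<epsilon> * (- \<epsilon> * \<beta> (act (clifford_vector scaleV form v) t) s)"
      using beta_clifford[of v s t] eps[of s "act (clifford_vector scaleV form v) t"] by simp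
    ultimately show ?thesis by (metis mult.assoc mult_1 mult_minus_left mult_minus_right)
  qed
  have fb: "form (fst (?b x y)) v = \<beta> (act (clifford_vector scaleV form v) (snd x)) (snd y)" for x y v
    by (rule translation_bracket_form)
  have b0: "?b x y = 0" if "snd x = 0 \<or> snd y = 0" for x y
  proof -
    have "\<beta> 0 t = 0" "\<beta> t 0 = 0" for t
      using bl(2)[of 0 0 t] bl(4)[of t 0 0] by simp_all
    moreover have "act (clifford_vector scaleV form v) 0 = 0" for v
      using act_scale[of v 0 0] by simp
    moreover have "form 0 v = 0" for v using fl(2)[of 0 0 v] by simp
    ultimately have "fst (?b x y) = 0" using that by (intro eqI) (auto simp: fb)
    then show ?thesis by (simp add: prod_eq_iff snd0)
  qed
  show ?thesis
    unfolding graded_lie_algebra_def lie_algebra_def lie_algebra_axioms_def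
      graded_lie_algebra_axioms_def translation_carrier
  proof (intro conjI allI impI)
    show "vector_space ?s" by (rule vector_space_translation_scale)
    show "M.subspace UNIV" by simp
    show "M.subspace (translation_gr p)" for p
      by (auto simp: M.subspace_def translation_gr_def translation_scale_def zero_prod_def)
    fix x y z :: "'v \<times> 'w"
    show "?b x y \<in> UNIV" by simp
    have e: "u = w" if "snd u = 0" "snd w = 0" "\<And>v. form (fst u) v = form (fst w) v" for u w :: "'v \<times> 'w"
      using that eqI by (simp add: prod_eq_iff)
    show "?b (x + y) z = ?b x z + ?b y z"
      by (rule e) (simp_all add: snd0 fl fb act_add_right[OF cc] bl)
    show "?b x (y + z) = ?b x y + ?b x z"
      by (rule e) (simp_all add: snd0 fl fb bl)
    show "?b (?s c x) y = ?s c (?b x y)" for c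
      by (rule e) (simp_all add: snd0 translation_scale_def fl fb act_scale bl)
    show "?b x (?s c y) = ?s c (?b x y)" for c
      by (rule e) (simp_all add: snd0 translation_scale_def fl fb bl)
    show "?b x x = 0"
    proof (rule e)
      fix v
      have "2 * \<beta> (act (clifford_vector scaleV form v) (snd x)) (snd x) = 0"
        unfolding mult_2 by (subst skew, rule left_minus)
      then have "\<beta> (act (clifford_vector scaleV form v) (snd x)) (snd x) = 0" using two by simp
      then show "form (fst (?b x x)) v = form (fst (0 :: 'v \<times> 'w)) v"
        using fl(2)[of 0 0 v] by (simp add: fb)
    qed (simp_all add: snd0)
    show "?b x (?b y z) + ?b y (?b z x) + ?b z (?b x y) = 0" by (simp add: b0 snd0)
  next
    fix P :: "int set" and f :: "int \<Rightarrow> 'v \<times> 'w" and p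
    assume P: "finite P" "\<forall>p. p \<in> P \<longrightarrow> f p \<in> translation_gr p" "(\<Sum>p\<in>P. f p) = 0" "p \<in> P"
    have f: "fst (f q) = 0 \<or> q = - 2" "snd (f q) = 0 \<or> q = - 1" if "q \<in> P" for q
      using P(2)[rule_format, OF that] by (auto simp: translation_gr_def mem_Times_iff split: if_splits)
    have "(\<Sum>q\<in>P. fst (f q)) = (\<Sum>q\<in>P. if q = - 2 then fst (f q) else 0)"
      by (rule sum.cong[OF refl]) (use f in auto)
    moreover have "(\<Sum>q\<in>P. snd (f q)) = (\<Sum>q\<in>P. if q = - 1 then snd (f q) else 0)"
      by (rule sum.cong[OF refl]) (use f in auto)
    moreover have "(\<Sum>q\<in>P. fst (f q)) = 0" "(\<Sum>q\<in>P. snd (f q)) = 0"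
      using P(3) by (simp_all add: fst_sum[symmetric] snd_sum[symmetric])
    ultimately have "- 2 \<in> P \<longrightarrow> fst (f (- 2)) = 0" "- 1 \<in> P \<longrightarrow> snd (f (- 1)) = 0"
      using P(1) by (auto split: if_splits)
    then show "f p = 0"
      using f[OF P(4)] P(4) by (auto simp: prod_eq_iff)
  next
    fix x y :: "'v \<times> 'w" and p q
    assume xy: "x \<in> translation_gr p" "y \<in> translation_gr q"
    show "?b x y \<in> translation_gr (p + q)"
    proof (cases "snd x = 0 \<or> snd y = 0")
      case True
      then show ?thesis by (simp add: b0 translation_gr_def mem_Times_iff)
    next
      case False
      then have "p = - 1" "q = - 1" using xy by (auto simp: translation_gr_def split: if_splits)
      then show ?thesis using snd0[of x y] by (simp add: translation_gr_def mem_Times_iff)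
    qed
  qed
qed

end

end

theory Submission
  imports Defs "HOL-Library.Function_Algebras"
begin

text \<open>
  Write \<open>m = V + W\<close> and \<open>g\<close> for the maximal transitive prolongation. If \<open>g\<close> has no positive degrees, then
  \<open>m\<close> is an ideal and \<open>g\<close> is not simple (\<open>not_simple_if_nonpositive\<close>). The substance is that
  \<open>g\<close> is simple as soon as some \<open>g\<^sub>p\<close> with \<open>p \<ge> 1\<close> is nonzero; transitivity then gives \<open>g\<^sub>1 \<noteq> 0\<close>.

  The first step is a description of transitive prolongations. Derivations of \<open>m\<close> of degree 0 act conformally
  on \<open>V\<close> (\<open>degree_zero_derivation_conformal\<close>). It follows that each \<open>x\<close> in \<open>g\<^sub>1\<close> acts on \<open>V\<close> by
  \<open>[x, v] = v s\<close> for a spinor \<open>s\<close> (\<open>degree_one_spinor\<close>), and \<open>x\<close> is determined by \<open>s\<close>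
  (\<open>V_transitive\<close>), so that \<open>g\<^sub>1\<close> becomes a subspace \<open>S\<close> of \<open>W\<close>. The same kind of argument shows that
  \<open>g\<^sub>3 = 0\<close> (\<open>gr_three_and_higher\<close>), and \<open>g\<close> is finite-dimensional.

  The second step is \<open>S = W\<close>. By irreducibility of \<open>W\<close> it is enough that \<open>S\<close> is stable under each non-null
  vector \<open>e\<close>. Such a vector defines an automorphism of \<open>m\<close>, namely \<open>s \<mapsto> e s\<close> on \<open>W\<close> and a multiple of the
  reflection in \<open>e\<close> on \<open>V\<close>. It extends to the full prolongation of \<open>m\<close>, and by maximality \<open>g\<close> is the full
  prolongation. To make this precise, the full prolongation is constructed from functions that record
  iterated brackets with elements of \<open>m\<close> (\<open>jets_transitive_prolongation\<close>), and a comparison of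
  dimensions shows that each such function comes from an element of \<open>g\<close> (\<open>jet_of_surjective\<close>). The
  conclusion for \<open>S\<close> is \<open>spinors_closed\<close>. This step cannot be replaced by an argument inside a given transitive
  prolongation: when \<open>W\<close> is reducible over the even Clifford algebra, a non-maximal prolongation may have
  \<open>S \<noteq> 0\<close> a proper even submodule, and then it is not simple.

  In the third step, \<open>S = W\<close> gives by taking brackets all special conformal transformations of \<open>V\<close> in
  \<open>g\<^sub>2\<close>, and their brackets with \<open>V\<close> contain the grading element \<open>E\<close> (\<open>grading_element\<close>) and act
  irreducibly on \<open>V\<close>. So each nonzero ideal contains \<open>V\<close> (\<open>ideal_contains_V\<close>), hence \<open>E\<close>. Since the Killing
  form has \<open>\<kappa>(E, E) \<noteq> 0\<close>, the orthogonal of a nonzero ideal does not contain \<open>E\<close> and is zero, and the ideal is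
  all of \<open>g\<close> (\<open>simple_if_ideals_contain_grading_element\<close>).
\<close>

section \<open>Trace forms and simplicity of graded Lie algebras\<close>

text \<open>Linearity is only required on \<open>S\<close>: the bracket of a Lie algebra is specified on its carrier, which
  may be a proper subspace of the ambient type.\<close>

definition endo_on :: "('k::field \<Rightarrow> 'a::ab_group_add \<Rightarrow> 'a) \<Rightarrow> 'a set \<Rightarrow> ('a \<Rightarrow> 'a) \<Rightarrow> bool" where
  "endo_on scale S f \<longleftrightarrow> (\<forall>x\<in>S. \<forall>y\<in>S. f (x + y) = f x + f y) \<and>
     (\<forall>c. \<forall>x\<in>S. f (scale c x) = scale c (f x)) \<and> f ` S \<subseteq> S"

definition trace_on :: "('k::field \<Rightarrow> 'a::ab_group_add \<Rightarrow> 'a) \<Rightarrow> 'a set \<Rightarrow> ('a \<Rightarrow> 'a) \<Rightarrow> 'k" where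
  "trace_on scale B f = (\<Sum>b\<in>B. Modules.module.representation scale B (f b) b)"

context vector_space
begin

lemma endo_on_sum:
  assumes "endo_on scale (span B) f" "finite A" "A \<subseteq> span B"
  shows "f (\<Sum>b\<in>A. scale (u b) b) = (\<Sum>b\<in>A. scale (u b) (f b))"
  using assms(2,3)
proof (induction A rule: finite_induct)
  case empty
  have "f (scale 0 0) = scale 0 (f 0)" using assms(1) span_zero unfolding endo_on_def by blast
  then show ?case by simp
next
  case (insert a A)
  have "(\<Sum>b\<in>A. scale (u b) b) \<in> span B" "scale (u a) a \<in> span B"
    using insert.prems by (auto intro: span_sum span_scale)
  then show ?case
    using insert assms(1) unfolding endo_on_def by simp
qed

text \<open>The image of a finite basis is independent and has as many elements as the basis, so by the
  exchange lemma it already spans.\<close>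

lemma endo_on_injective_surjective:
  assumes B: "independent B" "finite B" and h: "endo_on scale (span B) h"
    and inj: "\<And>x. x \<in> span B \<Longrightarrow> h x = 0 \<Longrightarrow> x = 0"
  shows "h ` span B = span B"
proof -
  have hB: "h ` B \<subseteq> span B" using h span_superset unfolding endo_on_def by blast
  have diff: "h (x - y) = h x - h y" if "x \<in> span B" "y \<in> span B" for x y
  proof -
    have "h (x - y + y) = h (x - y) + h y"
      using h span_diff[OF that] that unfolding endo_on_def by blast
    then show ?thesis by simp
  qed
  have injB: "inj_on h B"
  proof (rule inj_onI)
    fix a b assume ab: "a \<in> B" "b \<in> B" "h a = h b"
    then have sp: "a \<in> span B" "b \<in> span B" by (simp_all add: span_base)
    then have "a - b = 0" using inj[OF span_diff[OF sp]] diff[OF sp] ab(3) by simp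
    then show "a = b" by simp
  qed
  have ind: "independent (h ` B)"
  proof (rule independent_if_scalars_zero)
    show "finite (h ` B)" using B(2) by simp
    fix u w assume s: "(\<Sum>x\<in>h ` B. scale (u x) x) = 0" and w: "w \<in> h ` B"
    have "h (\<Sum>b\<in>B. scale (u (h b)) b) = (\<Sum>b\<in>B. scale (u (h b)) (h b))"
      using endo_on_sum[OF h B(2) span_superset] by simp
    also have "\<dots> = 0" using s by (simp add: sum.reindex[OF injB])
    finally have h0: "h (\<Sum>b\<in>B. scale (u (h b)) b) = 0" .
    have "(\<Sum>b\<in>B. scale (u (h b)) b) \<in> span B" by (intro span_sum span_scale span_base)
    then have "(\<Sum>b\<in>B. scale (u (h b)) b) = 0" using h0 by (rule inj)
    then show "u w = 0" using independentD[OF B, of "\<lambda>b. u (h b)"] w by auto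
  qed
  have "span B \<subseteq> span (h ` B)"
  proof (rule ccontr)
    assume "\<not> ?thesis"
    then obtain y where y: "y \<in> span B" "y \<notin> span (h ` B)" by blast
    then have "independent (insert y (h ` B))" by (simp add: independent_insertI ind)
    then have "card (insert y (h ` B)) \<le> card B"
      using independent_span_bound[OF B(2)] hB y(1) by blast
    moreover have "y \<notin> h ` B" using y(2) span_base by blast
    ultimately show False using B(2) card_image[OF injB] by simp
  qed
  moreover have "span (h ` B) \<subseteq> h ` span B"
  proof (rule span_minimal)
    show "h ` B \<subseteq> h ` span B" using span_superset by blast
    show "subspace (h ` span B)"
      unfolding subspace_def
    proof (intro conjI ballI allI)
      have "h 0 = 0" using endo_on_sum[OF h, of "{}"] by simp
      then show "0 \<in> h ` span B" using span_zero by force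
    next
      fix x y assume "x \<in> h ` span B" "y \<in> h ` span B"
      then obtain a b where ab: "a \<in> span B" "b \<in> span B" "x = h a" "y = h b" by blast
      then have "x + y = h (a + b)" using h unfolding endo_on_def by simp
      then show "x + y \<in> h ` span B" using span_add[OF ab(1,2)] by blast
    next
      fix c x assume "x \<in> h ` span B"
      then obtain a where a: "a \<in> span B" "x = h a" by blast
      then have "scale c x = h (scale c a)" using h unfolding endo_on_def by simp
      then show "scale c x \<in> h ` span B" using span_scale[OF a(1)] by blast
    qed
  qed
  ultimately show ?thesis using h unfolding endo_on_def by blast
qed

text \<open>In coordinates both traces are the double sum of \<open>g\<^bsub>cb\<^esub> f\<^bsub>bc\<^esub>\<close>.\<close>

lemma trace_on_commute:
  assumes B: "independent B" "finite B" and f: "endo_on scale (span B) f" and g: "endo_on scale (span B) g"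
  shows "trace_on scale B (\<lambda>x. f (g x)) = trace_on scale B (\<lambda>x. g (f x))"
proof -
  have exp: "trace_on scale B (\<lambda>x. f (g x)) =
      (\<Sum>b\<in>B. \<Sum>c\<in>B. representation B (g b) c * representation B (f c) b)"
    if f: "endo_on scale (span B) f" and g: "endo_on scale (span B) g" for f g
    unfolding trace_on_def
  proof (rule sum.cong[OF refl])
    fix b assume b: "b \<in> B"
    have cl: "f c \<in> span B" "g c \<in> span B" if "c \<in> B" for c
      using f g span_base[OF that] unfolding endo_on_def by (simp_all add: image_subset_iff)
    have "g b = (\<Sum>c\<in>B. scale (representation B (g b) c) c)"
      using sum_representation_eq[OF B(1) cl(2)[OF b] B(2) subset_refl] by simp
    then have "f (g b) = (\<Sum>c\<in>B. scale (representation B (g b) c) (f c))"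
      using endo_on_sum[OF f B(2) span_superset, of "representation B (g b)"] by simp
    then show "representation B (f (g b)) b =
        (\<Sum>c\<in>B. representation B (g b) c * representation B (f c) b)"
      using B cl by (simp add: representation_sum representation_scale span_scale)
  qed
  show ?thesis
    unfolding exp[OF f g] exp[OF g f] by (subst sum.swap) (simp add: mult.commute)
qed

end

lemma (in lie_algebra) bracket_skew:
  assumes "x \<in> L" "y \<in> L"
  shows "bracket x y = - bracket y x"
proof -
  have "bracket (x + y) (x + y) = 0"
    using assms bracket_self subspace_L subspace_add by blast
  then have "bracket x x + bracket x y + (bracket y x + bracket y y) = 0"
    using assms by (simp add: bracket_add_left bracket_add_right subspace_add subspace_L add_ac)
  then show ?thesis using assms by (simp add: bracket_self eq_neg_iff_add_eq_0)
qed

lemma (in lie_algebra) jacobi_derivation: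
  assumes "x \<in> L" "y \<in> L" "z \<in> L"
  shows "bracket x (bracket y z) = bracket (bracket x y) z + bracket y (bracket x z)"
proof -
  have "bracket y (bracket z x) = - bracket y (bracket x z)"
    using bracket_skew[of z x] bracket_scale_right[of y "bracket x z" "-1"] assms bracket_closed
    by simp
  moreover have "bracket z (bracket x y) = - bracket (bracket x y) z"
    using bracket_skew[of z "bracket x y"] assms bracket_closed by simp
  ultimately show ?thesis using jacobi[OF assms] by (simp add: diff_eq_eq add.commute)
qed

lemma (in lie_algebra) bracket_zero [simp]:
  assumes "x \<in> L"
  shows "bracket x 0 = 0" "bracket 0 x = 0"
  using assms bracket_scale_right[of x x 0] bracket_scale_left[of x x 0] by simp_all

lemma (in lie_algebra) bracket_minus:
  assumes "x \<in> L" "y \<in> L"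
  shows "bracket x (- y) = - bracket x y" "bracket (- x) y = - bracket x y"
  using assms bracket_scale_right[of x y "-1"] bracket_scale_left[of x y "-1"] by simp_all

lemma (in lie_algebra) bracket_diff:
  assumes "x \<in> L" "y \<in> L" "z \<in> L"
  shows "bracket x (y - z) = bracket x y - bracket x z" "bracket (x - y) z = bracket x z - bracket y z"
  using assms bracket_add_right[of x y "- z"] bracket_add_left[of x "- y" z]
  by (simp_all add: bracket_minus subspace_neg subspace_L)

context lie_algebra
begin

definition killing :: "'g set \<Rightarrow> 'g \<Rightarrow> 'g \<Rightarrow> 'k" where
  "killing B x y = trace_on scale B (\<lambda>z. bracket x (bracket y z))"

context
  fixes B assumes B: "independent B" "finite B" "span B = L"
begin

lemma endo_on_ad: "x \<in> L \<Longrightarrow> endo_on scale (span B) (bracket x)"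
  unfolding endo_on_def B(3) using bracket_add_right bracket_scale_right bracket_closed by auto

lemma endo_on_ad_ad: "x \<in> L \<Longrightarrow> y \<in> L \<Longrightarrow> endo_on scale (span B) (\<lambda>z. bracket x (bracket y z))"
  unfolding endo_on_def B(3) using bracket_add_right bracket_scale_right bracket_closed by auto

lemma B_in_L: "b \<in> B \<Longrightarrow> b \<in> L"
  using B(3) span_base by blast

lemma killing_bilinear:
  assumes "x \<in> L" "y \<in> L" "z \<in> L"
  shows "killing B (x + y) z = killing B x z + killing B y z"
    and "killing B (scale c x) z = c * killing B x z"
    and "killing B z (x + y) = killing B z x + killing B z y"
    and "killing B z (scale c x) = c * killing B z x"
  using assms B
  by (auto simp: killing_def trace_on_def B_in_L bracket_add_left bracket_add_right bracket_scale_left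
      bracket_scale_right bracket_closed representation_add representation_scale sum.distrib sum_distrib_left)

text \<open>Expanding \<open>ad [x, y]\<close> and \<open>ad [y, z]\<close> with the Jacobi identity, the two sides differ by a cyclic
  permutation of three operators under the trace.\<close>

lemma killing_invariant:
  assumes "x \<in> L" "y \<in> L" "z \<in> L"
  shows "killing B (bracket x y) z = killing B x (bracket y z)"
proof -
  have tr_diff: "trace_on scale B (\<lambda>w. f w - g w) = trace_on scale B f - trace_on scale B g"
    if "\<And>w. w \<in> L \<Longrightarrow> f w \<in> L" "\<And>w. w \<in> L \<Longrightarrow> g w \<in> L" for f g
    using that B by (simp add: trace_on_def representation_diff B_in_L sum_subtractf)
  have tr_cong: "trace_on scale B f = trace_on scale B g" if "\<And>w. w \<in> L \<Longrightarrow> f w = g w" for f g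
    using that by (simp add: trace_on_def B_in_L)
  have "killing B (bracket x y) z
      = trace_on scale B (\<lambda>w. bracket x (bracket y (bracket z w)) - bracket y (bracket x (bracket z w)))"
    unfolding killing_def using assms
    by (intro tr_cong) (simp add: jacobi_derivation[of x y] bracket_closed)
  also have "\<dots> = trace_on scale B (\<lambda>w. bracket x (bracket y (bracket z w)))
      - trace_on scale B (\<lambda>w. bracket y (bracket x (bracket z w)))"
    using assms by (intro tr_diff) (simp_all add: bracket_closed)
  also have "trace_on scale B (\<lambda>w. bracket y (bracket x (bracket z w)))
      = trace_on scale B (\<lambda>w. bracket x (bracket z (bracket y w)))"
    using assms by (intro trace_on_commute[OF B(1,2)] endo_on_ad endo_on_ad_ad)
  also have "trace_on scale B (\<lambda>w. bracket x (bracket y (bracket z w)))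
      - trace_on scale B (\<lambda>w. bracket x (bracket z (bracket y w)))
      = trace_on scale B (\<lambda>w. bracket x (bracket y (bracket z w)) - bracket x (bracket z (bracket y w)))"
    using assms by (intro tr_diff[symmetric]) (simp_all add: bracket_closed)
  also have "\<dots> = killing B x (bracket y z)"
    unfolding killing_def using assms
    by (intro tr_cong) (simp add: jacobi_derivation[of y z] bracket_add_right bracket_closed)
  finally show ?thesis .
qed

lemma killing_orthogonal_ideal:
  assumes I: "lie_ideal scale L bracket I"
  shows "lie_ideal scale L bracket {x\<in>L. \<forall>y\<in>I. killing B x y = 0}"
proof -
  have IL: "I \<subseteq> L" and cl: "\<And>x y. x \<in> L \<Longrightarrow> y \<in> I \<Longrightarrow> bracket x y \<in> I"
    using I unfolding lie_ideal_def by blast+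
  have z: "killing B 0 y = 0" if "y \<in> L" for y
    using killing_bilinear(2)[OF that that that, of 0] by simp
  have br: "killing B (bracket x w) y = 0"
    if h: "x \<in> L" "w \<in> L" "\<forall>y\<in>I. killing B w y = 0" "y \<in> I" for x w y
  proof -
    have yL: "y \<in> L" using h(4) IL by blast
    have "killing B (bracket x w) y = killing B (- bracket w x) y"
      using bracket_skew[OF h(1,2)] by simp
    also have "\<dots> = - killing B (bracket w x) y"
      using killing_bilinear(2)[of "bracket w x" "bracket w x" y "-1"] h yL by (simp add: bracket_closed)
    also have "\<dots> = 0" using h cl yL by (simp add: killing_invariant)
    finally show ?thesis .
  qed
  show ?thesis
    unfolding lie_ideal_def subspace_def
    using subspace_L IL br
    by (auto simp: subspace_0 subspace_add subspace_scale z killing_bilinear(1,2) bracket_closed subset_iff)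
qed

end

end

lemma (in graded_lie_algebra) gr_in_carrier: "x \<in> gr p \<Longrightarrow> x \<in> graded_carrier scale gr"
  unfolding graded_carrier_def by (rule span_base) blast

lemma (in graded_lie_algebra) gr_disjoint:
  assumes "y \<in> gr q" "y \<in> gr r" "q \<noteq> r"
  shows "y = 0"
proof -
  have "(if q = q then y else - y) = 0"
    by (rule direct_sum[where P = "{q, r}" and f = "\<lambda>s. if s = q then y else - y"])
      (use assms in \<open>auto simp: subspace_neg[OF subspace_gr]\<close>)
  then show ?thesis by simp
qed

text \<open>The trace form of the adjoint representation has \<open>\<kappa>(E, E) = \<Sum>\<^sub>p p\<^sup>2 dim g\<^sub>p \<noteq> 0\<close>. For a nonzero ideal \<open>I\<close>,
  which contains \<open>E\<close>, the orthogonal ideal therefore does not contain \<open>E\<close> and must be zero. Then \<open>\<kappa>\<close>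
  embeds the whole algebra into the dual of \<open>I\<close>, and \<open>I\<close> is everything by dimension.\<close>

lemma (in graded_lie_algebra) simple_if_ideals_contain_grading_element:
  assumes char0: "\<And>n::nat. n > 0 \<Longrightarrow> of_nat n \<noteq> (0::'k)"
    and fin: "finite_dim scale (graded_carrier scale gr)"
    and E: "E \<in> gr 0" "\<And>p x. x \<in> gr p \<Longrightarrow> bracket E x = scale (of_int p) x"
    and nontriv: "p \<noteq> 0" "x \<in> gr p" "x \<noteq> 0"
    and ideals: "\<And>I. lie_ideal scale (graded_carrier scale gr) bracket I \<Longrightarrow> I \<noteq> {0} \<Longrightarrow> E \<in> I"
  shows "simple_lie_algebra scale (graded_carrier scale gr) bracket"
proof -
  let ?L = "graded_carrier scale gr"
  have char0_int: "of_int m \<noteq> (0::'k)" if "m \<noteq> 0" for m :: int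
    using char0[of "nat \<bar>m\<bar>"] that by (cases "m \<ge> 0") (auto simp: of_nat_nat)
  obtain B where B: "B \<subseteq> (\<Union>p. gr p)" "independent B" "(\<Union>p. gr p) \<subseteq> span B"
    by (rule maximal_independent_subset)
  have spB: "span B = ?L"
  proof
    show "span B \<subseteq> ?L" unfolding graded_carrier_def by (rule span_mono[OF B(1)])
    show "?L \<subseteq> span B" unfolding graded_carrier_def using B(3) by (simp add: span_minimal)
  qed
  obtain C where C: "finite C" "?L \<subseteq> span C" using fin unfolding finite_dim_def by blast
  have "B \<subseteq> span C" using C(2) spB span_superset[of B] by simp
  then have finB: "finite B" using independent_span_bound[OF C(1) B(2)] by simp
  have EL: "E \<in> ?L" using E(1) by (rule gr_in_carrier)
  have "\<forall>b\<in>B. \<exists>q. b \<in> gr q" using B(1) by blast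
  then obtain d where d: "\<And>b. b \<in> B \<Longrightarrow> b \<in> gr (d b)" by metis
  have "\<exists>b\<in>B. d b \<noteq> 0"
  proof (rule ccontr)
    assume "\<not> ?thesis"
    then have "B \<subseteq> gr 0" using d by force
    then have "span B \<subseteq> gr 0" using subspace_gr by (rule span_minimal)
    then have "x \<in> gr 0" using B(3) nontriv(2) by blast
    then show False using gr_disjoint[OF nontriv(2)] nontriv by blast
  qed
  then have pos: "(\<Sum>b\<in>B. d b * d b) > 0"
    using finB by (auto intro!: sum_pos2 simp: zero_less_mult_iff)
  have "representation B (bracket E (bracket E b)) b = of_int (d b * d b)" if b: "b \<in> B" for b
  proof -
    have "bracket E (bracket E b) = scale (of_int (d b * d b)) b"
      using d[OF b] by (simp add: E(2)[of b "d b"] E(2)[of "scale c b" "d b" for c] subspace_scale[OF subspace_gr])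
    then show ?thesis
      using b B(2) by (simp add: representation_scale span_base representation_basis)
  qed
  then have "killing B E E = of_int (\<Sum>b\<in>B. d b * d b)"
    unfolding killing_def trace_on_def of_int_sum by (rule sum.cong[OF refl])
  then have KE: "killing B E E \<noteq> 0" using char0_int[of "\<Sum>b\<in>B. d b * d b"] pos by simp
  have "I = ?L" if I: "lie_ideal scale ?L bracket I" "I \<noteq> {0}" for I
  proof -
    have IL: "I \<subseteq> ?L" and subI: "subspace I" using I(1) unfolding lie_ideal_def by blast+
    have "E \<notin> {x\<in>?L. \<forall>y\<in>I. killing B x y = 0}" using ideals[OF I] KE by blast
    then have perp: "{x\<in>?L. \<forall>y\<in>I. killing B x y = 0} = {0}"
      using ideals[OF killing_orthogonal_ideal[OF B(2) finB spB I(1)]] by argo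
    obtain A where A: "A \<subseteq> I" "independent A" "I \<subseteq> span A"
      by (rule maximal_independent_subset)
    have spA: "span A = I" using A subI by (simp add: span_subspace)
    have finA: "finite A"
      using independent_span_bound[OF finB A(2)] spB IL A(1) by auto
    \<comment> \<open>In the basis \<open>A\<close> of \<open>I\<close>, this is the map that sends \<open>x\<close> to the functional \<open>\<kappa>(x, _)\<close> on \<open>I\<close>.\<close>
    define h where "h x = (\<Sum>a\<in>A. scale (killing B x a) a)" for x
    have hI: "h x \<in> I" for x unfolding h_def using A(1) subI by (auto intro: subspace_sum subspace_scale)
    have AL: "a \<in> ?L" if "a \<in> A" for a using that A(1) IL by blast
    note kb = killing_bilinear[OF B(2) finB spB]
    have lin: "endo_on scale (span B) h"
      unfolding endo_on_def spB
    proof (intro conjI ballI allI)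
      show "h (x + y) = h x + h y" if "x \<in> ?L" "y \<in> ?L" for x y
        using that AL by (simp add: h_def kb(1) scale_left_distrib sum.distrib)
      show "h (scale c x) = scale c (h x)" if "x \<in> ?L" for x c
        using that AL by (simp add: h_def kb(2) scale_sum_right)
      show "h ` ?L \<subseteq> ?L" using hI IL by blast
    qed
    have inj: "x = 0" if x: "x \<in> span B" "h x = 0" for x
    proof -
      have xL: "x \<in> ?L" using x(1) spB by simp
      have k0: "killing B x a = 0" if "a \<in> A" for a
        using independentD[OF A(2) finA subset_refl, of "killing B x"] x(2) that unfolding h_def by simp
      have z: "killing B x 0 = 0" using kb(4)[OF xL xL xL, of 0] by simp
      have "I \<subseteq> {y\<in>?L. killing B x y = 0}"
        unfolding spA[symmetric]
      proof (rule span_minimal)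
        show "A \<subseteq> {y\<in>?L. killing B x y = 0}" using k0 AL by blast
        show "subspace {y\<in>?L. killing B x y = 0}"
          unfolding subspace_def using xL z subspace_L
          by (auto simp: subspace_0 subspace_add subspace_scale kb(3,4))
      qed
      then have "x \<in> {x\<in>?L. \<forall>y\<in>I. killing B x y = 0}" using xL by blast
      then show ?thesis using perp by simp
    qed
    have "?L \<subseteq> I"
      using endo_on_injective_surjective[OF B(2) finB lin inj] hI spB by force
    then show ?thesis using IL by blast
  qed
  moreover have "bracket E x \<noteq> 0"
    using nontriv E(2)[OF nontriv(2)] char0_int by simp
  ultimately show ?thesis
    unfolding simple_lie_algebra_def using lie_algebra_axioms EL gr_in_carrier[OF nontriv(2)] by blast
qed

text \<open>Applying \<open>ad E - q\<close> to an element removes its component of degree \<open>q\<close> and multiplies the component of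
  degree \<open>p\<close> by the nonzero scalar \<open>p - q\<close>; so induction on the number of components applies.\<close>

lemma (in graded_lie_algebra) ideal_graded:
  assumes char0: "\<And>n::nat. n > 0 \<Longrightarrow> of_nat n \<noteq> (0::'k)"
    and E: "E \<in> gr 0" "\<And>p x. x \<in> gr p \<Longrightarrow> bracket E x = scale (of_int p) x"
    and I: "lie_ideal scale (graded_carrier scale gr) bracket I"
    and fin: "finite P" and f: "\<And>p. p \<in> P \<Longrightarrow> f p \<in> gr p" and sum: "(\<Sum>p\<in>P. f p) \<in> I" and p: "p \<in> P"
  shows "f p \<in> I"
  using fin f sum p
proof (induction P arbitrary: f p rule: finite_induct)
  case empty
  then show ?case by simp
next
  case (insert q P)
  let ?L = "graded_carrier scale gr"
  have IL: "I \<subseteq> ?L" and subI: "subspace I" and cl: "\<And>x y. x \<in> ?L \<Longrightarrow> y \<in> I \<Longrightarrow> bracket x y \<in> I"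
    using I unfolding lie_ideal_def by blast+
  have EL: "E \<in> ?L" using E(1) by (rule gr_in_carrier)
  have brsum: "bracket E (\<Sum>p\<in>Q. f p) = (\<Sum>p\<in>Q. scale (of_int p) (f p))"
    if "finite Q" "Q \<subseteq> insert q P" for Q
    using that
  proof (induction Q rule: finite_induct)
    case (insert r Q)
    have "(\<Sum>p\<in>Q. f p) \<in> ?L"
      using insert.prems \<open>\<And>p. p \<in> insert q P \<Longrightarrow> f p \<in> gr p\<close> gr_in_carrier
      by (intro subspace_sum[OF subspace_L]) blast
    moreover have "f r \<in> gr r" using insert.prems \<open>\<And>p. p \<in> insert q P \<Longrightarrow> f p \<in> gr p\<close> by blast
    ultimately show ?case using insert EL by (simp add: bracket_add_right gr_in_carrier E(2))
  qed (simp add: EL)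
  have "bracket E (\<Sum>p\<in>insert q P. f p) - scale (of_int q) (\<Sum>p\<in>insert q P. f p) \<in> I"
    using insert.prems(2) subI EL by (intro subspace_diff cl subspace_scale)
  also have "bracket E (\<Sum>p\<in>insert q P. f p) - scale (of_int q) (\<Sum>p\<in>insert q P. f p)
      = (\<Sum>p\<in>P. scale (of_int (p - q)) (f p))"
    using insert.hyps brsum[of "insert q P"]
    by (simp add: scale_right_distrib scale_sum_right scale_left_diff_distrib sum_subtractf)
  finally have *: "(\<Sum>p\<in>P. scale (of_int (p - q)) (f p)) \<in> I" .
  have inP: "f r \<in> I" if r: "r \<in> P" for r
  proof -
    have "scale (of_int (r - q)) (f r) \<in> I"
      by (rule insert.IH[OF _ * r]) (simp add: insert.prems(1) subspace_scale[OF subspace_gr])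
    then have "scale (inverse (of_int (r - q))) (scale (of_int (r - q)) (f r)) \<in> I"
      by (rule subspace_scale[OF subI])
    moreover have "of_int (r - q) \<noteq> (0::'k)"
    proof -
      have "r \<noteq> q" using r insert.hyps(2) by blast
      then show ?thesis using char0[of "nat \<bar>r - q\<bar>"] by (cases "r \<ge> q") (auto simp: of_nat_nat)
    qed
    ultimately show ?thesis by simp
  qed
  have "(\<Sum>p\<in>P. f p) \<in> I" using inP by (rule subspace_sum[OF subI])
  then have "(\<Sum>p\<in>insert q P. f p) - (\<Sum>p\<in>P. f p) \<in> I"
    using insert.prems(2) by (intro subspace_diff[OF subI])
  then have "f q \<in> I" using insert.hyps by simp
  then show ?case using insert.prems(3) inP by blast
qed

section \<open>Clifford multiplication and the bracket of spinors\<close>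

text \<open>This locale collects what the proof uses of an extended translation algebra. The map \<open>c\<close> is Clifford
  multiplication by vectors, \<open>\<omega>\<close> is the bracket \<open>W \<times> W \<rightarrow> V\<close>. The assumption \<open>form_represent\<close> is how finite
  dimension of \<open>V\<close> enters, and \<open>orthogonal_triple\<close> is how \<open>dim V \<ge> 3\<close> enters: almost every vanishing
  result below is obtained by letting three anticommuting invertible operators \<open>c e\<^sub>1\<close>, \<open>c e\<^sub>2\<close>, \<open>c e\<^sub>3\<close>
  act in two different orders.\<close>

locale spinor_pairing = V: vector_space scaleV + W: vector_space scaleW
  for scaleV :: "'k::field \<Rightarrow> 'v::ab_group_add \<Rightarrow> 'v"
    and scaleW :: "'k \<Rightarrow> 'w::ab_group_add \<Rightarrow> 'w" +
  fixes form :: "'v \<Rightarrow> 'v \<Rightarrow> 'k"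
    and c :: "'v \<Rightarrow> 'w \<Rightarrow> 'w"
    and \<beta> :: "'w \<Rightarrow> 'w \<Rightarrow> 'k"
    and \<epsilon> :: 'k
    and \<omega> :: "'w \<Rightarrow> 'w \<Rightarrow> 'v"
  assumes char0: "\<And>n::nat. n > 0 \<Longrightarrow> of_nat n \<noteq> (0::'k)"
    and form_add: "form (u + v) w = form u w + form v w"
    and form_scale: "form (scaleV a u) w = a * form u w"
    and form_sym: "form u v = form v u"
    and form_eq_0: "(\<And>v. form u v = 0) \<Longrightarrow> u = 0"
    and form_represent: "\<lbrakk>\<And>u v. f (u + v) = f u + f v; \<And>a u. f (scaleV a u) = a * f u\<rbrakk>
      \<Longrightarrow> \<exists>b. \<forall>v. form b v = f v"
    and c_add_left: "c (u + v) s = c u s + c v s"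
    and c_scale_left: "c (scaleV a u) s = scaleW a (c u s)"
    and c_add: "c u (s + t) = c u s + c u t"
    and c_scale: "c u (scaleW a s) = scaleW a (c u s)"
    and clifford: "c v (c u s) + c u (c v s) = scaleW (- 2 * form v u) s"
    and beta_add: "\<beta> (s + t) r = \<beta> s r + \<beta> t r"
    and beta_scale: "\<beta> (scaleW a s) r = a * \<beta> s r"
    and beta_eq_0: "(\<And>t. \<beta> s t = 0) \<Longrightarrow> s = 0"
    and beta_sym: "\<beta> t s = - \<epsilon> * \<beta> s t"
    and epsilon_sq: "\<epsilon> * \<epsilon> = 1"
    and beta_c: "\<beta> (c v s) t = \<epsilon> * \<beta> s (c v t)"
    and form_omega: "form (\<omega> s t) v = \<beta> (c v s) t"
    and nonzero_W: "\<exists>s::'w. s \<noteq> 0"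
    and orthogonal_triple: "\<exists>e1 e2 e3. form e1 e1 \<noteq> 0 \<and> form e2 e2 \<noteq> 0 \<and> form e3 e3 \<noteq> 0 \<and>
      form e1 e2 = 0 \<and> form e1 e3 = 0 \<and> form e2 e3 = 0"
begin

lemma two_nonzero: "(2::'k) \<noteq> 0"
  using char0[of 2] by simp

lemma form_add_right: "form w (u + v) = form w u + form w v"
  by (simp add: form_sym[of w] form_add)

lemma form_scale_right: "form w (scaleV a u) = a * form w u"
  by (simp add: form_sym[of w] form_scale)

lemma form_zero [simp]: "form 0 v = 0" "form v 0 = 0"
  using form_scale[of 0 0 v] form_scale_right[of v 0 0] by simp_all

lemma form_minus: "form (- u) v = - form u v" "form v (- u) = - form v u"
  using form_scale[of "-1" u v] form_scale_right[of v "-1" u] by simp_all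

lemma form_diff: "form (u - w) v = form u v - form w v" "form v (u - w) = form v u - form v w"
  using form_add[of u "- w" v] form_add_right[of v u "- w"] by (simp_all add: form_minus)

lemma form_eqI: "(\<And>v. form u v = form w v) \<Longrightarrow> u = w"
  using form_eq_0[of "u - w"] by (simp add: form_diff)

lemma beta_add_right: "\<beta> r (s + t) = \<beta> r s + \<beta> r t"
  by (simp add: beta_sym[of r] beta_add algebra_simps)

lemma beta_scale_right: "\<beta> r (scaleW a s) = a * \<beta> r s"
  by (simp add: beta_sym[of r] beta_scale)

lemma beta_zero [simp]: "\<beta> 0 s = 0" "\<beta> s 0 = 0"
  using beta_scale[of 0 0 s] beta_scale_right[of s 0 0] by simp_all

lemma beta_minus: "\<beta> (- s) t = - \<beta> s t" "\<beta> t (- s) = - \<beta> t s"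
  using beta_scale[of "-1" s t] beta_scale_right[of t "-1" s] by simp_all

lemma beta_diff: "\<beta> (s - r) t = \<beta> s t - \<beta> r t" "\<beta> t (s - r) = \<beta> t s - \<beta> t r"
  using beta_add[of s "- r" t] beta_add_right[of t s "- r"] by (simp_all add: beta_minus)

lemma beta_eqI: "(\<And>t. \<beta> s t = \<beta> r t) \<Longrightarrow> s = r"
  using beta_eq_0[of "s - r"] by (simp add: beta_diff)

lemma c_zero [simp]: "c 0 s = 0" "c v 0 = 0"
  using c_scale_left[of 0 0 s] c_scale[of v 0 0] by simp_all

lemma c_minus: "c (- v) s = - c v s" "c v (- s) = - c v s"
  using c_scale_left[of "-1" v s] c_scale[of v "-1" s] by simp_all

lemma c_diff: "c (v - u) s = c v s - c u s" "c v (s - t) = c v s - c v t"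
  using c_add_left[of v "- u" s] c_add[of v s "- t"] by (simp_all add: c_minus)

lemma W_double_eq_0: "s + s = 0 \<Longrightarrow> s = (0::'w)"
  using W.scale_left_distrib[of 1 1 s] W.scale_eq_0_iff[of 2 s] two_nonzero by (simp add: one_add_one)

lemma c_c: "c v (c v s) = scaleW (- form v v) s"
proof -
  have "(c v (c v s) - scaleW (- form v v) s) + (c v (c v s) - scaleW (- form v v) s)
      = scaleW (- 2 * form v v) s - scaleW (- form v v + - form v v) s"
    unfolding clifford[of v v s, symmetric] W.scale_left_distrib by simp
  also have "- 2 * form v v = - form v v + - form v v" by simp
  finally have "(c v (c v s) - scaleW (- form v v) s) + (c v (c v s) - scaleW (- form v v) s) = 0" by simp
  then show ?thesis using W_double_eq_0 by (metis right_minus_eq)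
qed

lemma c_swap: "c v (c u s) = scaleW (- 2 * form v u) s - c u (c v s)"
  using clifford[of v u s] by (simp add: eq_diff_eq)

lemma c_anticommute: "form v u = 0 \<Longrightarrow> c v (c u s) = - c u (c v s)"
  using c_swap[of v u s] by simp

lemma c_eq_0: "form e e \<noteq> 0 \<Longrightarrow> c e s = 0 \<Longrightarrow> s = 0"
  using c_c[of e s] by simp

lemma c_faithful: "(\<And>s. c v s = 0) \<Longrightarrow> v = 0"
proof (rule form_eq_0)
  fix u assume "\<And>s. c v s = 0"
  then have "scaleW (- 2 * form v u) s = 0" for s using clifford[of v u s] by simp
  then show "form v u = 0" using nonzero_W two_nonzero by auto
qed

text \<open>The symmetrization of \<open>v w u\<close> in \<open>v\<close> and \<open>u\<close> is a vector, not a genuine cubic element of the Clifford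
  algebra. This identity is behind each formula for brackets below.\<close>

lemma c_three:
  "c v (c w (c u s)) + c u (c w (c v s)) =
     c (scaleV (2 * form u v) w - scaleV (2 * form u w) v - scaleV (2 * form v w) u) s"
proof -
  have 1: "c v (c w (c u s)) = scaleW (- 2 * form w u) (c v s) - c v (c u (c w s))"
    by (simp add: c_swap[of w u s] c_diff c_minus c_scale)
  have 2: "c u (c w (c v s)) = scaleW (- 2 * form w v) (c u s) - c u (c v (c w s))"
    by (simp add: c_swap[of w v s] c_diff c_minus c_scale)
  have 3: "c v (c u (c w s)) = scaleW (- 2 * form v u) (c w s) - c u (c v (c w s))"
    by (rule c_swap)
  show ?thesis
    unfolding 1 2 3 by (simp add: c_diff c_scale_left form_sym[of w] form_sym[of v u])
qed

lemma omega_add: "\<omega> (s + t) r = \<omega> s r + \<omega> t r" "\<omega> r (s + t) = \<omega> r s + \<omega> r t"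
  by (rule form_eqI; simp add: form_omega form_add c_add beta_add beta_add_right)+

lemma omega_scale: "\<omega> (scaleW a s) r = scaleV a (\<omega> s r)" "\<omega> r (scaleW a s) = scaleV a (\<omega> r s)"
  by (rule form_eqI; simp add: form_omega form_scale c_scale beta_scale beta_scale_right)+

lemma beta_c_skew: "\<beta> (c v s) t = - \<beta> (c v t) s"
  using beta_sym[of s "c v t"] by (simp add: beta_c mult.assoc[symmetric] epsilon_sq)

lemma omega_skew: "\<omega> s t = - \<omega> t s"
  by (rule form_eqI) (simp add: form_omega form_minus beta_c_skew[of _ s t])

lemma omega_eq_0:
  assumes "\<And>t. \<omega> s t = 0"
  shows "s = 0"
proof -
  obtain e where e: "form e e \<noteq> 0" using orthogonal_triple by blast
  have "\<beta> (c e s) t = 0" for t using assms[of t] form_omega[of s t e] by simp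
  then have "c e s = 0" by (rule beta_eq_0)
  then show ?thesis using c_eq_0 e by blast
qed

text \<open>Irreducibility of \<open>V\<close> under \<open>so(V)\<close>. If \<open>x \<noteq> 0\<close> lies in \<open>Y\<close>, then so does its orthogonal complement;
  hence one non-null vector in \<open>Y\<close> is enough. If all vectors of \<open>Y\<close> were null, the vectors
  \<open>(e\<^sub>j, x) e\<^sub>i - (e\<^sub>i, x) e\<^sub>j\<close> of \<open>Y\<close> would force \<open>A\<^sub>i + A\<^sub>j = 0\<close> for the three numbers
  \<open>A\<^sub>i = (e\<^sub>i, x)\<^sup>2 / (e\<^sub>i, e\<^sub>i)\<close>, so \<open>e\<^sub>1\<close> would be orthogonal to \<open>x\<close> and would itself lie in \<open>Y\<close>.\<close>

lemma so_invariant_subspace: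
  assumes Y: "V.subspace Y" and x: "x \<in> Y" "x \<noteq> 0"
    and inv: "\<And>v u x. x \<in> Y \<Longrightarrow> scaleV (form v x) u - scaleV (form u x) v \<in> Y"
  shows "Y = UNIV"
proof -
  have perp: "u \<in> Y" if y: "y \<in> Y" "y \<noteq> 0" "form u y = 0" for u y
  proof -
    obtain v where "form y v \<noteq> 0" using form_eq_0[of y] y(2) by blast
    then have v: "form v y \<noteq> 0" by (simp add: form_sym[of v])
    have "scaleV (form v y) u \<in> Y" using inv[OF y(1), of v u] y(3) by simp
    then have "scaleV (inverse (form v y)) (scaleV (form v y) u) \<in> Y" by (rule V.subspace_scale[OF Y])
    then show ?thesis using v by simp
  qed
  have nonnull: "Y = UNIV" if y: "y \<in> Y" "form y y \<noteq> 0" for y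
  proof -
    have "z \<in> Y" for z
    proof -
      have "form (z - scaleV (form z y / form y y) y) y = 0"
        using y(2) by (simp add: form_diff form_scale)
      moreover have "y \<noteq> 0" using y(2) by auto
      ultimately have "z - scaleV (form z y / form y y) y \<in> Y" using perp y(1) by blast
      then have "z - scaleV (form z y / form y y) y + scaleV (form z y / form y y) y \<in> Y"
        using Y y(1) by (intro V.subspace_add V.subspace_scale)
      then show ?thesis by simp
    qed
    then show ?thesis by blast
  qed
  obtain e1 e2 e3 where e: "form e1 e1 \<noteq> 0" "form e2 e2 \<noteq> 0" "form e3 e3 \<noteq> 0"
      "form e1 e2 = 0" "form e1 e3 = 0" "form e2 e3 = 0"
    using orthogonal_triple by blast
  define y where "y u v = scaleV (form v x) u - scaleV (form u x) v" for u v
  have yY: "y u v \<in> Y" for u v unfolding y_def by (rule inv[OF x(1)])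
  show ?thesis
  proof (rule ccontr)
    assume "\<not> ?thesis"
    then have null: "form z z = 0" if "z \<in> Y" for z using nonnull that by blast
    have q: "form (y u v) (y u v) = form v x * form v x * form u u + form u x * form u x * form v v"
      if "form u v = 0" for u v
      using that form_sym[of v u]
      by (simp add: y_def form_diff form_scale form_scale_right algebra_simps)
    define A where "A u = form u x * form u x / form u u" for u
    have sum0: "A u + A v = 0" if "form u u \<noteq> 0" "form v v \<noteq> 0" "form u v = 0" for u v
    proof -
      have "form v x * form v x * form u u + form u x * form u x * form v v = 0"
        using q[OF that(3)] null[OF yY] by simp
      then have "(A u + A v) * (form u u * form v v) = 0"
        using that by (simp add: A_def field_simps)
      then show ?thesis using that by simp
    qed
    have "A e1 + A e1 = (A e1 + A e2) + (A e1 + A e3) - (A e2 + A e3)" by simp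
    also have "\<dots> = 0" using sum0 e by simp
    finally have "2 * A e1 = 0" by simp
    then have "form e1 x = 0" using e(1) two_nonzero by (simp add: A_def)
    then have "e1 \<in> Y" using perp[OF x] by blast
    then show False using null e(1) by blast
  qed
qed

text \<open>Every product \<open>v u\<close> acts on \<open>W\<close> as part of a derivation of \<open>V + W\<close>, whose action on \<open>V\<close> is
  infinitesimally conformal. The antisymmetric part in \<open>v\<close>, \<open>u\<close> is the spin action of \<open>so(V)\<close>, the
  symmetric part is a multiple of the grading derivation.\<close>

lemma clifford_derivation:
  "\<omega> (c v (c u s)) t + \<omega> s (c v (c u t)) =
     scaleV (2 * form v (\<omega> s t)) u - scaleV (2 * form u (\<omega> s t)) v - scaleV (2 * form u v) (\<omega> s t)"
proof (rule form_eqI)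
  fix w
  have "\<beta> (c w s) (c v (c u t)) = \<beta> (c u (c v (c w s))) t"
    using epsilon_sq by (simp add: beta_c mult.assoc[symmetric])
  then have "form (\<omega> (c v (c u s)) t + \<omega> s (c v (c u t))) w
      = \<beta> (c w (c v (c u s)) + c u (c v (c w s))) t"
    by (simp add: form_add form_omega beta_add)
  also have "\<dots> = 2 * form u w * form (\<omega> s t) v - 2 * form u v * form (\<omega> s t) w - 2 * form w v * form (\<omega> s t) u"
    by (simp add: c_three c_diff c_scale_left beta_diff beta_scale form_omega)
  also have "\<dots> = form (scaleV (2 * form v (\<omega> s t)) u - scaleV (2 * form u (\<omega> s t)) v - scaleV (2 * form u v) (\<omega> s t)) w"
    by (simp add: form_diff form_scale form_sym[of v "\<omega> s t"] form_sym[of u "\<omega> s t"] form_sym[of w v] form_add algebra_simps)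
  finally show "form (\<omega> (c v (c u s)) t + \<omega> s (c v (c u t))) w = \<dots>" .
qed

lemma span_omega: "V.span {\<omega> s t | s t. True} = UNIV"
proof -
  let ?Y = "V.span {\<omega> s t | s t. True}"
  obtain s :: 'w where "s \<noteq> 0" using nonzero_W by blast
  then obtain t where st: "\<omega> s t \<noteq> 0" using omega_eq_0 by blast
  have inv: "scaleV (form v x) u - scaleV (form u x) v \<in> ?Y" if "x \<in> ?Y" for v u x
    using that
  proof (induction rule: V.span_induct_alt)
    case base
    then show ?case by (simp add: V.span_zero)
  next
    case (step a x y)
    then obtain s t where x: "x = \<omega> s t" by blast
    have "scaleV (2 * form v x) u - scaleV (2 * form u x) v
        = \<omega> (c v (c u s)) t + \<omega> s (c v (c u t)) + scaleV (2 * form u v) (\<omega> s t)"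
      unfolding x clifford_derivation by simp
    also have "\<dots> \<in> ?Y"
      by (intro V.span_add V.span_scale V.span_base) blast+
    finally have "scaleV (a / 2) (scaleV (2 * form v x) u - scaleV (2 * form u x) v) \<in> ?Y"
      by (rule V.span_scale)
    then have "scaleV (a * form v x) u - scaleV (a * form u x) v \<in> ?Y"
      using two_nonzero by (simp add: V.scale_right_diff_distrib)
    from V.span_add[OF this step(2)] show ?case
      by (simp add: form_add_right form_scale_right V.scale_left_distrib algebra_simps)
  qed
  show ?thesis
    by (rule so_invariant_subspace[OF V.subspace_span _ st inv]) (blast intro: V.span_base)
qed

end

section \<open>Rigidity in dimension at least three\<close>

context spinor_pairing
begin

text \<open>Write \<open>M\<close> for the \<open>\<beta>\<close>-adjoint of \<open>A\<close> and \<open>B\<close> for the adjoint of \<open>D\<close>; the derivation property reads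
  \<open>w A + M w = B w\<close> in the algebra of operators on \<open>W\<close>. With \<open>P = A + M\<close> and \<open>F w = w P + P w\<close>, multiplying by
  \<open>w\<close> on both sides and adding gives \<open>w (F w) = -2 (D w, w)\<close>, a scalar. Comparing this for a non-null
  \<open>e\<close>, a vector \<open>x\<close> orthogonal to \<open>e\<close>, and \<open>e + x\<close> determines \<open>F x\<close>, and shows that
  \<open>(D e, x) + (D x, e)\<close> times \<open>x e\<close> is a scalar operator, which is impossible unless it is zero because
  \<open>x e\<close> anticommutes with \<open>e\<close>.\<close>

lemma degree_zero_derivation_conformal:
  assumes A_add: "\<And>s t. A (s + t) = A s + A t" and A_scale: "\<And>a s. A (scaleW a s) = scaleW a (A s)"
    and D_add: "\<And>u v. D (u + v) = D u + D v" and D_scale: "\<And>a u. D (scaleV a u) = scaleV a (D u)"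
    and der: "\<And>s t. D (\<omega> s t) = \<omega> (A s) t + \<omega> s (A t)"
  shows "\<exists>\<mu>. \<forall>v. form (D v) v = \<mu> * form v v"
proof -
  have "\<exists>b. \<forall>x. form b x = form w (D x)" for w
    by (rule form_represent) (simp_all add: D_add D_scale form_add_right form_scale_right)
  then obtain B where B: "\<And>w x. form (B w) x = form w (D x)" by metis
  have rel: "\<beta> (c w (A s)) t + \<beta> (c w s) (A t) = \<beta> (c (B w) s) t" for w s t
  proof -
    have "form (\<omega> s t) (B w) = form (D (\<omega> s t)) w"
      by (simp add: form_sym[of "\<omega> s t"] B form_sym[of w])
    then show ?thesis by (simp add: der form_add form_omega)
  qed
  obtain e where e: "form e e \<noteq> 0" using orthogonal_triple by blast
  define q where "q = form e e"
  have q: "q \<noteq> 0" using e by (simp add: q_def)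
  have ce: "c e (c e s) = scaleW (- q) s" for s unfolding q_def by (rule c_c)
  \<comment> \<open>Since \<open>e e = - q\<close>, the derivation property at \<open>w = e\<close> dictates the adjoint of \<open>A\<close>.\<close>
  define M where "M y = scaleW (- 1 / q) (c (B e) (c e y) - c e (A (c e y)))" for y
  have M_add: "M (s + t) = M s + M t" for s t
    by (simp add: M_def c_add A_add algebra_simps)
  have M_scale: "M (scaleW a s) = scaleW a (M s)" for a s
    by (simp add: M_def c_scale A_scale W.scale_right_diff_distrib mult.commute)
  have adj: "\<beta> y (A t) = \<beta> (M y) t" for y t
  proof -
    have "y = scaleW (- 1 / q) (c e (c e y))" using q by (simp add: ce)
    then have "\<beta> y (A t) = (- 1 / q) * \<beta> (c e (c e y)) (A t)" by (metis beta_scale)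
    also have "\<beta> (c e (c e y)) (A t) = \<beta> (c (B e) (c e y)) t - \<beta> (c e (A (c e y))) t"
      using rel[of e "c e y" t] by (simp add: eq_diff_eq add.commute)
    finally show ?thesis by (simp add: M_def beta_scale beta_diff beta_minus)
  qed
  have wA: "c w (A s) + M (c w s) = c (B w) s" for w s
    by (rule beta_eqI) (simp add: beta_add adj[symmetric] rel)
  define P where "P s = A s + M s" for s
  have P_add: "P (s + t) = P s + P t" for s t by (simp add: P_def A_add M_add algebra_simps)
  define F where "F w s = c w (P s) + P (c w s)" for w s
  have F_add: "F (u + v) s = F u s + F v s" for u v s
    by (simp add: F_def c_add_left P_add algebra_simps)
  have wF: "c w (F w s) = scaleW (- 2 * form (D w) w) s" for w s
  proof -
    have "c w (F w s) = c w (c w (A s) + M (c w s)) + (c w (A (c w s)) + M (c w (c w s)))"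
    proof -
      have "c w (c w (M s)) = M (c w (c w s))" by (simp only: c_c M_scale)
      then show ?thesis by (simp add: F_def P_def c_add)
    qed
    also have "\<dots> = c w (c (B w) s) + c (B w) (c w s)" by (simp add: wA)
    also have "\<dots> = scaleW (- 2 * form (D w) w) s"
      using clifford[of w "B w" s] by (simp add: form_sym[of w] B)
    finally show ?thesis .
  qed
  define \<mu> where "\<mu> = form (D e) e / q"
  have \<mu>: "form (D e) e = \<mu> * q" using q by (simp add: \<mu>_def)
  have Fe: "F e s = scaleW (2 * \<mu>) (c e s)" for s
  proof -
    have "c e (c e (F e s)) = c e (scaleW (- 2 * (\<mu> * q)) s)" by (simp only: wF \<mu>)
    then have "scaleW (- q) (F e s) = scaleW (- q) (scaleW (2 * \<mu>) (c e s))"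
      by (simp add: ce c_scale c_minus mult_ac)
    then show ?thesis using q by (simp only: W.scale_cancel_left) simp
  qed
  have orth: "form (D e) x + form (D x) e = 0 \<and> form (D x) x = \<mu> * form x x" if x: "form e x = 0" for x
  proof -
    define k where "k = form (D e) x + form (D x) e"
    have mixed: "c e (F x s) + c x (F e s) = scaleW (- 2 * k) s" for s
    proof -
      have "c (e + x) (F (e + x) s) = c e (F e s) + c x (F x s) + (c e (F x s) + c x (F e s))"
        unfolding F_add c_add c_add_left by (simp only: add_ac)
      then have "scaleW (- 2 * form (D (e + x)) (e + x)) s = scaleW (- 2 * form (D e) e) s
          + scaleW (- 2 * form (D x) x) s + (c e (F x s) + c x (F e s))"
        by (simp only: wF)
      moreover have "- 2 * form (D (e + x)) (e + x) = - 2 * form (D e) e + - 2 * form (D x) x + - 2 * k"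
        by (simp add: D_add form_add form_add_right k_def algebra_simps)
      ultimately show ?thesis by (simp only: W.scale_left_distrib add_left_cancel)
    qed
    have ex: "c e (c x s) = - c x (c e s)" for s by (rule c_anticommute[OF x])
    have Fx: "F x s = scaleW (2 * k / q) (c e s) + scaleW (2 * \<mu>) (c x s)" for s
    proof -
      have "c e (F x s) = scaleW (- 2 * k) s - scaleW (2 * \<mu>) (c x (c e s))"
        using mixed[of s] by (simp add: Fe c_scale eq_diff_eq)
      then have "c e (c e (F x s)) = scaleW (- 2 * k) (c e s) - scaleW (2 * \<mu>) (c e (c x (c e s)))"
        by (simp only: c_diff c_scale)
      then have "scaleW (- q) (F x s) = scaleW (- q) (scaleW (2 * k / q) (c e s) + scaleW (2 * \<mu>) (c x s))"
        using q by (simp add: ce ex c_minus c_scale W.scale_right_distrib mult_ac)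
      then show ?thesis using q by (simp only: W.scale_cancel_left) simp
    qed
    \<comment> \<open>Equating the two values of \<open>x (F x)\<close> makes \<open>(2 k / q) x e\<close> the scalar \<open>K\<close>; both turn out to vanish.\<close>
    define K where "K = 2 * \<mu> * form x x - 2 * form (D x) x"
    have xe: "scaleW (2 * k / q) (c x (c e s)) = scaleW K s" for s
    proof -
      have "c x (F x s) = scaleW (2 * k / q) (c x (c e s)) - scaleW (2 * \<mu> * form x x) s"
        by (simp add: Fx c_add c_scale c_c)
      then show ?thesis unfolding wF K_def by (simp add: W.scale_left_diff_distrib algebra_simps)
    qed
    have 1: "scaleW (2 * k) (c x s) = scaleW K (c e s)" for s
    proof -
      have "c e (scaleW (2 * k / q) (c x (c e s))) = c e (scaleW K s)" by (simp only: xe)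
      then show ?thesis using q by (simp add: ex ce c_scale c_minus)
    qed
    have 2: "scaleW (2 * k) (c x s) = - scaleW K (c e s)" for s
      using xe[of "c e s"] q by (simp add: ce c_scale c_minus) (metis minus_equation_iff)
    obtain s :: 'w where s: "s \<noteq> 0" using nonzero_W by blast
    have "scaleW K (c e s) + scaleW K (c e s) = 0" using 1[of s] 2[of s] by (simp add: neg_eq_iff_add_eq_0)
    then have "scaleW K (c e s) = 0" by (rule W_double_eq_0)
    then have K0: "K = 0" using c_eq_0[OF e, of s] s by auto
    then have "scaleW (2 * k) (c x t) = 0" for t using 1[of t] by simp
    then have "k = 0 \<or> x = 0" using c_faithful[of x] two_nonzero by auto
    moreover have "k = 0" if "x = 0" using that D_scale[of 0 0] by (simp add: k_def)
    ultimately have "k = 0" by blast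
    moreover have "2 * form (D x) x = 2 * (\<mu> * form x x)" using K0 by (auto simp: K_def)
    ultimately show ?thesis using two_nonzero unfolding k_def by simp
  qed
  have "form (D v) v = \<mu> * form v v" for v
  proof -
    define a where "a = form e v / q"
    define x where "x = v - scaleV a e"
    have x: "form e x = 0" using q by (simp add: x_def a_def form_diff form_scale_right q_def)
    then have x': "form x e = 0" by (simp add: form_sym)
    have v: "v = scaleV a e + x" by (simp add: x_def)
    have "form (D v) v = a * a * form (D e) e + a * (form (D e) x + form (D x) e) + form (D x) x"
      unfolding v by (simp add: D_add D_scale form_add form_add_right form_scale form_scale_right algebra_simps)
    also have "\<dots> = a * a * (\<mu> * q) + \<mu> * form x x" using orth[OF x] \<mu> by simp
    also have "\<dots> = \<mu> * form v v"
      unfolding v by (simp add: x x' q_def form_add form_add_right form_scale form_scale_right algebra_simps)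
    finally show ?thesis .
  qed
  then show ?thesis by blast
qed

text \<open>The hypothesis says that \<open>v (f v)\<close> is \<open>(v, v)\<close> times a fixed spinor. Hence \<open>v (f v - v s) = 0\<close> for all
  \<open>v\<close>, and polarizing at one non-null \<open>e\<close> with \<open>f e = e s\<close> removes the possible null ambiguity.\<close>

lemma vector_part_is_clifford_multiple:
  assumes f_add: "\<And>u v. f (u + v) = f u + f v" and f_scale: "\<And>a u. f (scaleV a u) = scaleW a (f u)"
    and conf: "\<And>t. \<exists>\<mu>. \<forall>v. form (\<omega> (f v) t) v = \<mu> * form v v"
  shows "\<exists>s. \<forall>v. f v = c v s"
proof -
  obtain e where e: "form e e \<noteq> 0" using orthogonal_triple by blast
  define s where "s = scaleW (- 1 / form e e) (c e (f e))"
  have fe: "f e = c e s" using e by (simp add: s_def c_scale c_c c_minus)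
  have sq: "c v (f v) = c v (c v s)" for v
  proof (rule beta_eqI)
    fix t
    obtain \<mu> where \<mu>: "\<And>v. \<beta> (c v (f v)) t = \<mu> * form v v" using conf[of t] by (auto simp: form_omega)
    have "\<mu> * form e e = - form e e * \<beta> s t" using \<mu>[of e] by (simp add: fe c_c beta_scale beta_minus)
    then have "\<mu> * form e e = (- \<beta> s t) * form e e" by simp
    then have "\<mu> = - \<beta> s t" using e by (simp only: mult_cancel_right) simp
    then show "\<beta> (c v (f v)) t = \<beta> (c v (c v s)) t" by (simp add: \<mu> c_c beta_scale beta_minus)
  qed
  have "f v = c v s" for v
  proof -
    have eq: "f (e + v) - c (e + v) s = f v - c v s" by (simp add: f_add fe c_add_left)
    have "c (e + v) (f (e + v) - c (e + v) s) = 0" by (simp only: c_diff(2) sq) simp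
    then have "c (e + v) (f v - c v s) = 0" by (simp only: eq)
    then have "c e (f v - c v s) + c v (f v - c v s) = 0" by (simp add: c_add_left)
    then have "c e (f v - c v s) = 0" by (simp add: c_diff(2)[of v] sq)
    then show ?thesis using c_eq_0[OF e, of "f v - c v s"] by simp
  qed
  then show ?thesis by blast
qed

text \<open>For non-null \<open>e\<close> the \<open>\<beta>\<close>-adjoint of \<open>A\<close> is \<open>M = e A e / (e, e)\<close>, which is thus independent of \<open>e\<close>.
  Therefore \<open>e A = - M e\<close> and \<open>A e = - e M\<close>, and \<open>A\<close> commutes with products of two vectors.\<close>

lemma vertical_derivation_commutes:
  assumes A_scale: "\<And>a s. A (scaleW a s) = scaleW a (A s)"
    and der: "\<And>s t. \<omega> (A s) t + \<omega> s (A t) = 0"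
    and u: "form u u \<noteq> 0" and v: "form v v \<noteq> 0"
  shows "A (c u (c v s)) = c u (c v (A s))"
proof -
  have rel: "\<beta> (c w (A s)) t = - \<beta> (c w s) (A t)" for w s t
    using arg_cong[OF der[of s t], of "\<lambda>x. form x w"]
    by (simp add: form_add form_omega eq_neg_iff_add_eq_0)
  define M where "M e s = scaleW (1 / form e e) (c e (A (c e s)))" for e s
  have adj: "\<beta> y (A t) = \<beta> (M e y) t" if e: "form e e \<noteq> 0" for e y t
  proof -
    have "y = scaleW (- 1 / form e e) (c e (c e y))" using e by (simp add: c_c)
    then have "\<beta> y (A t) = (- 1 / form e e) * \<beta> (c e (c e y)) (A t)" by (metis beta_scale)
    also have "\<beta> (c e (c e y)) (A t) = - \<beta> (c e (A (c e y))) t" using rel[of e "c e y" t] by simp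
    finally show ?thesis by (simp add: M_def beta_scale)
  qed
  have Mv: "M v = M u" using adj[OF u] adj[OF v] by (intro ext beta_eqI) simp
  have cA: "c w (A s) = - M u (c w s)" for w s
    by (rule beta_eqI) (simp add: rel adj[OF u] beta_minus)
  have Ac: "A (c u s) = - c u (M u s)" for s
    using u by (simp add: M_def c_scale c_c c_minus)
  show ?thesis by (simp add: Ac cA[of v] c_minus)
qed

text \<open>By symmetry a product \<open>x\<close> of two vectors can be moved out of either argument of \<open>H\<close>, so
  \<open>x y H t r = H (x t) (y r) = y x H t r\<close>. But \<open>x = e\<^sub>1 e\<^sub>2\<close> and \<open>y = e\<^sub>2 e\<^sub>3\<close> anticommute and are invertible.\<close>

lemma vertical_prolongation_trivial:
  assumes H_scale: "\<And>t a s. H t (scaleW a s) = scaleW a (H t s)"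
    and der: "\<And>t s r. \<omega> (H t s) r + \<omega> s (H t r) = 0"
    and sym: "\<And>t r. H t r = H r t"
  shows "H t r = 0"
proof -
  obtain e1 e2 e3 where e: "form e1 e1 \<noteq> 0" "form e2 e2 \<noteq> 0" "form e3 e3 \<noteq> 0"
      "form e1 e2 = 0" "form e1 e3 = 0" "form e2 e3 = 0"
    using orthogonal_triple by blast
  note comm = vertical_derivation_commutes[of "H t" for t, OF H_scale der]
  let ?z = "H t r"
  have comm': "H (c u (c v t)) r = c u (c v (H t r))" if "form u u \<noteq> 0" "form v v \<noteq> 0" for u v t r
    using that by (simp add: sym[of _ r] comm)
  have "c e1 (c e2 (c e2 (c e3 ?z))) = H (c e1 (c e2 t)) (c e2 (c e3 r))"
    by (subst comm') (use e in \<open>simp_all add: comm\<close>)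
  also have "\<dots> = c e2 (c e3 (H (c e1 (c e2 t)) r))"
    using e by (simp add: comm)
  also have "\<dots> = c e2 (c e3 (c e1 (c e2 ?z)))"
    using e by (simp add: comm')
  finally have *: "c e1 (c e2 (c e2 (c e3 ?z))) = c e2 (c e3 (c e1 (c e2 ?z)))" .
  have sw: "c e2 (c e1 s) = - c e1 (c e2 s)" "c e3 (c e1 s) = - c e1 (c e3 s)" "c e3 (c e2 s) = - c e2 (c e3 s)" for s
    using e by (simp_all add: c_anticommute[of e2 e1] c_anticommute[of e3 e1] c_anticommute[of e3 e2] form_sym)
  have "scaleW (form e2 e2) (c e1 (c e3 ?z)) + scaleW (form e2 e2) (c e1 (c e3 ?z)) = 0"
    using * by (simp add: sw c_c c_minus c_scale eq_neg_iff_add_eq_0 neg_eq_iff_add_eq_0)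
  then have "scaleW (form e2 e2) (c e1 (c e3 ?z)) = 0" by (rule W_double_eq_0)
  then show ?thesis using c_eq_0[OF e(1), of "c e3 ?z"] c_eq_0[OF e(3), of ?z] e(2) by simp
qed

text \<open>Evaluating \<open>e\<^sub>1 e\<^sub>3 (f e\<^sub>2) = e\<^sub>1 e\<^sub>2 (f e\<^sub>3)\<close> by moving \<open>f\<close> to \<open>e\<^sub>1\<close> on both sides gives
  \<open>e\<^sub>2 e\<^sub>3 (f e\<^sub>1) = 0\<close>.\<close>

lemma symmetric_clifford_family_zero:
  assumes sym: "\<And>u v. c u (f v) = c v (f u)"
  shows "f v = 0"
proof -
  obtain e1 e2 e3 where e: "form e1 e1 \<noteq> 0" "form e2 e2 \<noteq> 0" "form e3 e3 \<noteq> 0"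
      "form e1 e2 = 0" "form e1 e3 = 0" "form e2 e3 = 0"
    using orthogonal_triple by blast
  have sw: "c e2 (c e1 s) = - c e1 (c e2 s)" "c e3 (c e1 s) = - c e1 (c e3 s)" "c e3 (c e2 s) = - c e2 (c e3 s)" for s
    using e by (simp_all add: c_anticommute[of e2 e1] c_anticommute[of e3 e1] c_anticommute[of e3 e2] form_sym)
  have "c e1 (c e3 (f e2)) = c e1 (c e2 (f e3))" by (simp add: sym[of e3 e2])
  moreover have "c e1 (c e3 (f e2)) = - c e3 (c e2 (f e1))"
    by (simp add: sym[of e2 e1] sw)
  moreover have "c e1 (c e2 (f e3)) = - c e2 (c e3 (f e1))"
    by (simp add: sym[of e3 e1] sw)
  ultimately have "c e2 (c e3 (f e1)) + c e2 (c e3 (f e1)) = 0" by (simp add: sw eq_neg_iff_add_eq_0)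
  then have "c e2 (c e3 (f e1)) = 0" by (rule W_double_eq_0)
  then have "f e1 = 0" using e c_eq_0 by blast
  then have "c e1 (f v) = 0" using sym[of e1 v] by simp
  then show ?thesis using e c_eq_0 by blast
qed

text \<open>Taking \<open>v = w\<close> non-null shows that \<open>\<tau>\<close> is \<open>\<beta>\<close>-adjoint to \<open>-\<epsilon> \<tau>\<close>, and then the hypothesis becomes
  \<open>\<tau> v w = w v \<tau>\<close>. Applying this to \<open>e\<^sub>1 e\<^sub>2 e\<^sub>2 e\<^sub>3\<close> factor by factor and after cancelling \<open>e\<^sub>2 e\<^sub>2\<close> gives
  opposite signs.\<close>

lemma conformal_spin_part_unique:
  assumes rel: "\<And>s t v w. \<beta> (c w (c v (\<tau> s))) t + \<beta> (c w s) (c v (\<tau> t)) = 0"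
  shows "\<tau> s = 0"
proof -
  obtain e1 e2 e3 where e: "form e1 e1 \<noteq> 0" "form e2 e2 \<noteq> 0" "form e3 e3 \<noteq> 0"
      "form e1 e2 = 0" "form e1 e3 = 0" "form e2 e3 = 0"
    using orthogonal_triple by blast
  have move: "\<beta> x (c v y) = \<epsilon> * \<beta> (c v x) y" for x y v
    using epsilon_sq by (simp add: beta_c mult.assoc[symmetric])
  have skew: "\<beta> (\<tau> s) t = - \<epsilon> * \<beta> s (\<tau> t)" for s t
  proof -
    have "form e1 e1 * (\<beta> (\<tau> s) t + \<epsilon> * \<beta> s (\<tau> t)) = 0"
      using rel[of e1 e1 s t] by (simp add: move c_c beta_minus beta_scale algebra_simps neg_eq_iff_add_eq_0)
    then show ?thesis using e(1) by (simp add: eq_neg_iff_add_eq_0)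
  qed
  have \<tau>_scale: "\<tau> (scaleW a s) = scaleW a (\<tau> s)" for a s
    by (rule beta_eqI) (simp add: skew beta_scale)
  have comm: "\<tau> (c v (c w s)) = c w (c v (\<tau> s))" for v w s
  proof (rule beta_eqI)
    fix t
    have "\<beta> (c w (c v (\<tau> s))) t = - \<epsilon> * \<beta> (c v (c w s)) (\<tau> t)"
      using rel[of w v s t] by (simp add: move eq_neg_iff_add_eq_0)
    then show "\<beta> (\<tau> (c v (c w s))) t = \<beta> (c w (c v (\<tau> s))) t" by (simp add: skew)
  qed
  have sw: "c e2 (c e1 s) = - c e1 (c e2 s)" "c e3 (c e1 s) = - c e1 (c e3 s)" "c e3 (c e2 s) = - c e2 (c e3 s)" for s
    using e by (simp_all add: c_anticommute[of e2 e1] c_anticommute[of e3 e1] c_anticommute[of e3 e2] form_sym)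
  let ?z = "\<tau> s"
  have "\<tau> (c e1 (c e2 (c e2 (c e3 s)))) = c e2 (c e1 (c e3 (c e2 ?z)))" by (simp only: comm)
  moreover have "\<tau> (c e1 (c e2 (c e2 (c e3 s)))) = scaleW (- form e2 e2) (c e3 (c e1 ?z))"
    by (simp only: c_c c_scale \<tau>_scale comm)
  ultimately have "scaleW (form e2 e2) (c e1 (c e3 ?z)) + scaleW (form e2 e2) (c e1 (c e3 ?z)) = 0"
    by (simp add: sw c_c c_minus c_scale eq_neg_iff_add_eq_0 neg_eq_iff_add_eq_0)
  then have "scaleW (form e2 e2) (c e1 (c e3 ?z)) = 0" by (rule W_double_eq_0)
  then show ?thesis using c_eq_0[OF e(1), of "c e3 ?z"] c_eq_0[OF e(3), of ?z] e(2) by simp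
qed

end

section \<open>Transitive prolongations\<close>

lemma (in graded_lie_algebra) carrier_decompose:
  assumes "x \<in> graded_carrier scale gr"
  obtains P f where "finite P" "\<And>p. f p \<in> gr p" "x = (\<Sum>p\<in>P. f p)"
proof -
  have "x \<in> span (\<Union>p. gr p)" using assms by (simp add: graded_carrier_def)
  then have "\<exists>P f. finite P \<and> (\<forall>p. f p \<in> gr p) \<and> x = (\<Sum>p\<in>P. f p)"
  proof (induction rule: span_induct_alt)
    case base
    show ?case
      by (rule exI[of _ "{}"], rule exI[of _ "\<lambda>_. 0"]) (simp add: subspace_0[OF subspace_gr])
  next
    case (step a x y)
    from step(1) obtain q where q: "x \<in> gr q" by blast
    from step(2) obtain P f where P: "finite P" "\<And>p. f p \<in> gr p" "y = (\<Sum>p\<in>P. f p)" by blast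
    define f' where "f' p = (if p \<in> P then f p else 0) + (if p = q then scale a x else 0)" for p
    have "f' p \<in> gr p" for p
      using P(2) q by (auto simp: f'_def subspace_0 subspace_scale subspace_add subspace_gr)
    moreover have "(\<Sum>p\<in>insert q P. f' p) = scale a x + y"
    proof -
      have "(\<Sum>p\<in>insert q P. if p \<in> P then f p else 0) = (\<Sum>p\<in>P. f p)"
        using P(1) by (simp add: sum.If_cases Int_absorb1 subset_insertI)
      moreover have "(\<Sum>p\<in>insert q P. if p = q then scale a x else 0) = scale a x"
        using P(1) by simp
      ultimately show ?thesis unfolding f'_def sum.distrib by (simp add: P(3))
    qed
    ultimately show ?case using P(1)
      by (intro exI[of _ "insert q P"] exI[of _ f']) simp
  qed
  then show ?thesis using that by blast
qed

text \<open>A transitive prolongation of \<open>V + W\<close>, with its negative part given by the embeddings \<open>jV\<close> and \<open>jW\<close>.\<close>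

locale translation_prolongation =
  spinor_pairing scaleV scaleW form c \<beta> \<epsilon> \<omega> + G: graded_lie_algebra scale gr bracket
  for scaleV :: "'k::field \<Rightarrow> 'v::ab_group_add \<Rightarrow> 'v" and scaleW :: "'k \<Rightarrow> 'w::ab_group_add \<Rightarrow> 'w"
    and form c \<beta> \<epsilon> \<omega>
    and scale :: "'k \<Rightarrow> 'g::ab_group_add \<Rightarrow> 'g" and gr bracket +
  fixes jV :: "'v \<Rightarrow> 'g" and jW :: "'w \<Rightarrow> 'g"
  assumes jV_add: "jV (u + v) = jV u + jV v" and jV_scale: "jV (scaleV a u) = scale a (jV u)"
    and jW_add: "jW (s + t) = jW s + jW t" and jW_scale: "jW (scaleW a s) = scale a (jW s)"
    and jV_inj: "jV u = 0 \<Longrightarrow> u = 0" and jW_inj: "jW s = 0 \<Longrightarrow> s = 0"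
    and gr_V: "gr (- 2) = range jV" and gr_W: "gr (- 1) = range jW"
    and gr_low: "p < - 2 \<Longrightarrow> gr p = {0}"
    and bracket_jW: "bracket (jW s) (jW t) = jV (\<omega> s t)"
    and transitive: "\<lbrakk>p \<ge> 0; x \<in> gr p; \<And>s. bracket x (jW s) = 0\<rbrakk> \<Longrightarrow> x = 0"
    and finite_dim_gr: "finite_dim scale (gr p)"
begin

abbreviation "L \<equiv> graded_carrier scale gr"

lemma jV_gr: "jV v \<in> gr (- 2)" and jW_gr: "jW s \<in> gr (- 1)"
  using gr_V gr_W by auto

lemma j_in_L [simp]: "jV v \<in> L" "jW s \<in> L"
  using jV_gr jW_gr G.gr_in_carrier by blast+

lemma jV_zero [simp]: "jV 0 = 0" and jW_zero [simp]: "jW 0 = 0"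
  using jV_scale[of 0 0] jW_scale[of 0 0] by simp_all

lemma jV_minus: "jV (- u) = - jV u" and jW_minus: "jW (- s) = - jW s"
  using jV_scale[of "-1" u] jW_scale[of "-1" s] by simp_all

lemma jV_diff: "jV (u - v) = jV u - jV v" and jW_diff: "jW (s - t) = jW s - jW t"
  using jV_add[of u "- v"] jW_add[of s "- t"] by (simp_all add: jV_minus jW_minus)

lemma jV_eq_iff [simp]: "jV u = jV v \<longleftrightarrow> u = v" and jW_eq_iff [simp]: "jW s = jW t \<longleftrightarrow> s = t"
  using jV_inj[of "u - v"] jW_inj[of "s - t"] by (auto simp: jV_diff jW_diff)

lemma bracket_jV [simp]: "bracket (jV v) (jV u) = 0" "bracket (jV v) (jW s) = 0" "bracket (jW s) (jV v) = 0"
  using G.bracket_gr[OF jV_gr jV_gr, of v u] G.bracket_gr[OF jV_gr jW_gr, of v s]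
    G.bracket_gr[OF jW_gr jV_gr, of s v] by (auto simp: gr_low)

lemma bracket_bracket_jV_commute:
  assumes "x \<in> L"
  shows "bracket (bracket x (jW s)) (jV v) = bracket (bracket x (jV v)) (jW s)"
    and "bracket (bracket x (jV u)) (jV v) = bracket (bracket x (jV v)) (jV u)"
  using G.jacobi_derivation[OF assms, of "jW s" "jV v"] G.jacobi_derivation[OF assms, of "jV u" "jV v"]
    G.bracket_skew[of "bracket x (jV v)" "jW s"] G.bracket_skew[of "bracket x (jV v)" "jV u"] assms
  by (simp_all add: G.bracket_closed add_eq_0_iff2)

lemma bracket_omega:
  assumes "x \<in> L"
  shows "bracket x (jV (\<omega> s t)) = bracket (bracket x (jW s)) (jW t) - bracket (bracket x (jW t)) (jW s)"
  using G.jacobi_derivation[OF assms, of "jW s" "jW t"] G.bracket_skew[of "bracket x (jW t)" "jW s"] assms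
  by (simp add: G.bracket_closed bracket_jW)

lemma degree_zero_action:
  assumes x: "x \<in> gr 0"
  obtains A D where "\<And>s. bracket x (jW s) = jW (A s)" "\<And>v. bracket x (jV v) = jV (D v)"
    "\<And>s t. A (s + t) = A s + A t" "\<And>a s. A (scaleW a s) = scaleW a (A s)"
    "\<And>u v. D (u + v) = D u + D v" "\<And>a u. D (scaleV a u) = scaleV a (D u)"
    "\<And>s t. D (\<omega> s t) = \<omega> (A s) t + \<omega> s (A t)"
proof -
  have xL: "x \<in> L" using x by (rule G.gr_in_carrier)
  have "\<exists>t. bracket x (jW s) = jW t" for s
    using G.bracket_gr[OF x jW_gr, of s] gr_W by auto
  then obtain A where A: "\<And>s. bracket x (jW s) = jW (A s)" by metis
  have "\<exists>u. bracket x (jV v) = jV u" for v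
    using G.bracket_gr[OF x jV_gr, of v] gr_V by auto
  then obtain D where D: "\<And>v. bracket x (jV v) = jV (D v)" by metis
  have "jW (A (s + t)) = jW (A s + A t)" for s t
    by (simp add: A[symmetric] jW_add G.bracket_add_right xL)
  moreover have "jW (A (scaleW a s)) = jW (scaleW a (A s))" for a s
    by (simp add: A[symmetric] jW_scale G.bracket_scale_right xL)
  moreover have "jV (D (u + v)) = jV (D u + D v)" for u v
    by (simp add: D[symmetric] jV_add G.bracket_add_right xL)
  moreover have "jV (D (scaleV a u)) = jV (scaleV a (D u))" for a u
    by (simp add: D[symmetric] jV_scale G.bracket_scale_right xL)
  moreover have "jV (D (\<omega> s t)) = jV (\<omega> (A s) t + \<omega> s (A t))" for s t
    unfolding D[symmetric] bracket_omega[OF xL] A bracket_jW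
    by (simp add: jV_add jV_minus omega_skew[of "A t" s])
  ultimately show ?thesis using that A D by simp
qed

text \<open>For \<open>t\<close> in \<open>W\<close> the element \<open>[x, t]\<close> has degree 0, so it acts conformally on \<open>V\<close>; this action is
  \<open>v \<mapsto> [[x, v], t]\<close>, which is what \<open>vector_part_is_clifford_multiple\<close> needs about \<open>v \<mapsto> [x, v]\<close>.\<close>

lemma degree_one_spinor:
  assumes x: "x \<in> gr 1"
  obtains s where "\<And>v. bracket x (jV v) = jW (c v s)"
proof -
  have xL: "x \<in> L" using x by (rule G.gr_in_carrier)
  have "\<exists>s. bracket x (jV v) = jW s" for v
    using G.bracket_gr[OF x jV_gr, of v] gr_W by auto
  then obtain f where f: "\<And>v. bracket x (jV v) = jW (f v)" by metis
  have f_add: "f (u + v) = f u + f v" for u v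
  proof -
    have "jW (f (u + v)) = jW (f u + f v)" by (simp add: f[symmetric] jV_add jW_add G.bracket_add_right xL)
    then show ?thesis by simp
  qed
  have f_scale: "f (scaleV a u) = scaleW a (f u)" for a u
  proof -
    have "jW (f (scaleV a u)) = jW (scaleW a (f u))" by (simp add: f[symmetric] jV_scale jW_scale G.bracket_scale_right xL)
    then show ?thesis by simp
  qed
  have conf: "\<exists>\<mu>. \<forall>v. form (\<omega> (f v) t) v = \<mu> * form v v" for t
  proof -
    have "bracket x (jW t) \<in> gr 0" using G.bracket_gr[OF x jW_gr, of t] by simp
    then obtain A D where D: "\<And>v. bracket (bracket x (jW t)) (jV v) = jV (D v)"
      and AD: "\<And>s t. A (s + t) = A s + A t" "\<And>a s. A (scaleW a s) = scaleW a (A s)"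
        "\<And>u v. D (u + v) = D u + D v" "\<And>a u. D (scaleV a u) = scaleV a (D u)"
        "\<And>s t. D (\<omega> s t) = \<omega> (A s) t + \<omega> s (A t)"
      by (rule degree_zero_action) blast
    have "D v = \<omega> (f v) t" for v
      using bracket_bracket_jV_commute(1)[OF xL, of t v] by (simp add: D f bracket_jW)
    then show ?thesis using degree_zero_derivation_conformal[of A D, OF AD] by simp
  qed
  obtain s where "\<forall>v. f v = c v s"
    using vector_part_is_clifford_multiple[of f, OF f_add f_scale conf] by blast
  then show ?thesis using that[of s] f by simp
qed

text \<open>In degree 1 the elements \<open>[x, t]\<close> annihilate \<open>V\<close>, and \<open>[[x, t], s]\<close> is symmetric in \<open>s\<close> and \<open>t\<close> because
  \<open>[x, [s, t]] = 0\<close>; so \<open>vertical_prolongation_trivial\<close> applies. Higher degrees reduce to this one by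
  bracketing with \<open>W\<close>.\<close>

lemma V_transitive:
  assumes "x \<in> gr (int n + 1)" and "\<And>v. bracket x (jV v) = 0"
  shows "x = 0"
  using assms
proof (induction n arbitrary: x)
  case 0
  have x: "x \<in> gr 1" using 0 by simp
  have xL: "x \<in> L" using x by (rule G.gr_in_carrier)
  have x0: "bracket x (jW t) \<in> gr 0" for t using G.bracket_gr[OF x jW_gr, of t] by simp
  have DV: "bracket (bracket x (jW t)) (jV v) = 0" for t v
    using bracket_bracket_jV_commute(1)[OF xL, of t v] 0(2)[of v] by simp
  have "\<exists>A. (\<forall>s. bracket (bracket x (jW t)) (jW s) = jW (A s)) \<and>
      (\<forall>a s. A (scaleW a s) = scaleW a (A s)) \<and> (\<forall>s r. \<omega> (A s) r + \<omega> s (A r) = 0)" for t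
  proof -
    obtain A D where "\<And>s. bracket (bracket x (jW t)) (jW s) = jW (A s)"
      and D: "\<And>v. bracket (bracket x (jW t)) (jV v) = jV (D v)"
      and "\<And>a s. A (scaleW a s) = scaleW a (A s)" "\<And>s t. D (\<omega> s t) = \<omega> (A s) t + \<omega> s (A t)"
      by (rule degree_zero_action[OF x0[of t]]) blast
    moreover have "D v = 0" for v using D[of v] DV[of t v] jV_inj by simp
    ultimately show ?thesis by auto
  qed
  then obtain H where H: "\<And>t s. bracket (bracket x (jW t)) (jW s) = jW (H t s)"
    "\<And>t a s. H t (scaleW a s) = scaleW a (H t s)" "\<And>t s r. \<omega> (H t s) r + \<omega> s (H t r) = 0"
    by metis
  have sym: "H t r = H r t" for t r
    using bracket_omega[OF xL, of t r] 0(2)[of "\<omega> t r"] by (simp add: H(1))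
  have H0: "H t r = 0" for t r
    using vertical_prolongation_trivial[of H, OF H(2) H(3) sym] .
  have "bracket x (jW t) = 0" for t
    by (rule transitive[OF _ x0]) (simp_all add: H(1) H0)
  then show ?case using transitive[of 1 x] x by simp
next
  case (Suc n)
  have xL: "x \<in> L" using Suc.prems(1) by (rule G.gr_in_carrier)
  have "bracket x (jW t) = 0" for t
  proof (rule Suc.IH)
    show "bracket x (jW t) \<in> gr (int n + 1)"
      using G.bracket_gr[OF Suc.prems(1) jW_gr, of t] by (simp add: algebra_simps)
    show "bracket (bracket x (jW t)) (jV v) = 0" for v
      using bracket_bracket_jV_commute(1)[OF xL, of t v] Suc.prems(2)[of v] by simp
  qed
  then show ?case using transitive[OF _ Suc.prems(1)] by simp
qed

text \<open>An element of degree 3 maps \<open>V\<close> to degree 1, that is, to spinors \<open>f v\<close>; as \<open>V\<close> is abelian,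
  \<open>u (f v) = v (f u)\<close>, whence \<open>f = 0\<close>.\<close>

lemma gr_three_and_higher:
  assumes "p \<ge> 3"
  shows "gr p = {0}"
  using assms
proof (induction p rule: int_ge_induct)
  case base
  have "x = 0" if x: "x \<in> gr 3" for x
  proof -
    have xL: "x \<in> L" using x by (rule G.gr_in_carrier)
    have x1: "bracket x (jV v) \<in> gr 1" for v using G.bracket_gr[OF x jV_gr, of v] by simp
    have "\<exists>s. \<forall>u. bracket (bracket x (jV v)) (jV u) = jW (c u s)" for v
      by (rule degree_one_spinor[OF x1[of v]]) blast
    then obtain f where f: "\<And>v u. bracket (bracket x (jV v)) (jV u) = jW (c u (f v))" by metis
    have "c u (f v) = c v (f u)" for u v
      using bracket_bracket_jV_commute(2)[OF xL, of v u] by (simp add: f)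
    then have "f v = 0" for v by (rule symmetric_clifford_family_zero)
    then have "bracket x (jV v) = 0" for v
      using V_transitive[of "bracket x (jV v)" 0] x1[of v] f[of v] by simp
    then show "x = 0" using V_transitive[of x 2] x by simp
  qed
  then show ?case using G.subspace_0[OF G.subspace_gr, of 3] by blast
next
  case (step p)
  have "x = 0" if x: "x \<in> gr (p + 1)" for x
  proof -
    have "bracket x (jW s) = 0" for s
      using G.bracket_gr[OF x jW_gr, of s] step(2) by simp
    then show ?thesis using transitive[OF _ x] step(1) by simp
  qed
  then show ?case using G.subspace_0[OF G.subspace_gr, of "p + 1"] by blast
qed

lemma finite_dim_carrier: "finite_dim scale L"
proof -
  obtain B where B: "\<And>p. finite (B p)" "\<And>p. gr p \<subseteq> G.span (B p)"
    using finite_dim_gr unfolding finite_dim_def by metis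
  let ?B = "\<Union>p\<in>{-2..2}. B p"
  have "gr p \<subseteq> G.span ?B" for p
  proof (cases "p \<in> {-2..2}")
    case True
    then have "B p \<subseteq> ?B" by blast
    then show ?thesis using B(2)[of p] G.span_mono by blast
  next
    case False
    then have "gr p = {0}" using gr_low[of p] gr_three_and_higher[of p] by force
    then show ?thesis by (simp add: G.span_zero)
  qed
  then have "L \<subseteq> G.span ?B" unfolding graded_carrier_def by (intro G.span_minimal) auto
  then show ?thesis unfolding finite_dim_def using B(1) by blast
qed

text \<open>The component of degree 1, embedded into \<open>W\<close>.\<close>

definition spinors :: "'w set" where
  "spinors = {s. \<exists>x\<in>gr 1. \<forall>v. bracket x (jV v) = jW (c v s)}"

lemma subspace_spinors: "W.subspace spinors"
  unfolding W.subspace_def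
proof (intro conjI ballI allI)
  show "0 \<in> spinors"
    unfolding spinors_def by (intro CollectI bexI[of _ 0]) (simp_all add: G.subspace_0 G.subspace_gr)
next
  fix s t assume "s \<in> spinors" "t \<in> spinors"
  then obtain x y where xy: "x \<in> gr 1" "y \<in> gr 1" "\<And>v. bracket x (jV v) = jW (c v s)" "\<And>v. bracket y (jV v) = jW (c v t)"
    unfolding spinors_def by blast
  then show "s + t \<in> spinors"
    unfolding spinors_def
    by (intro CollectI bexI[of _ "x + y"])
      (simp_all add: G.bracket_add_left G.gr_in_carrier[of _ 1] c_add jW_add G.subspace_add G.subspace_gr)
next
  fix a s assume "s \<in> spinors"
  then obtain x where x: "x \<in> gr 1" "\<And>v. bracket x (jV v) = jW (c v s)"
    unfolding spinors_def by blast
  then show "scaleW a s \<in> spinors"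
    unfolding spinors_def
    by (intro CollectI bexI[of _ "scale a x"])
      (simp_all add: G.bracket_scale_left G.gr_in_carrier[of _ 1] c_scale jW_scale G.subspace_scale G.subspace_gr)
qed

lemma spinors_nonzero:
  assumes p: "p \<ge> 1" "gr p \<noteq> {0}"
  shows "spinors \<noteq> {0}"
proof -
  have "gr 1 \<noteq> {0}"
  proof
    assume 1: "gr 1 = {0}"
    have "gr p = {0}" using p(1)
    proof (induction p rule: int_ge_induct)
      case base show ?case by (rule 1)
    next
      case (step p)
      have "x = 0" if x: "x \<in> gr (p + 1)" for x
      proof -
        have "bracket x (jW s) = 0" for s
          using G.bracket_gr[OF x jW_gr, of s] step(2) by simp
        then show ?thesis using transitive[OF _ x] step(1) by simp
      qed
      then show ?case using G.subspace_0[OF G.subspace_gr, of "p + 1"] by blast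
    qed
    then show False using p(2) by blast
  qed
  then obtain x where x: "x \<in> gr 1" "x \<noteq> 0" using G.subspace_0[OF G.subspace_gr, of 1] by blast
  obtain s where s: "\<And>v. bracket x (jV v) = jW (c v s)" using degree_one_spinor[OF x(1)] by blast
  then have "s \<in> spinors" using x(1) unfolding spinors_def by blast
  moreover have "s \<noteq> 0" using V_transitive[of x 0] x s by auto
  ultimately show ?thesis by blast
qed

end

locale full_translation_prolongation =
  translation_prolongation scaleV scaleW form c \<beta> \<epsilon> \<omega> scale gr bracket jV jW
  for scaleV :: "'k::field \<Rightarrow> 'v::ab_group_add \<Rightarrow> 'v" and scaleW :: "'k \<Rightarrow> 'w::ab_group_add \<Rightarrow> 'w"
    and form c \<beta> \<epsilon> \<omega>
    and scale :: "'k \<Rightarrow> 'g::ab_group_add \<Rightarrow> 'g" and gr bracket jV jW +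
  assumes full: "spinors = UNIV"
begin

text \<open>The maps \<open>v \<mapsto> conformal n v\<close> form the first prolongation of the conformal Lie algebra of \<open>V\<close>;
  \<open>conformal n\<close> is the special conformal transformation belonging to \<open>n\<close>.\<close>

abbreviation conformal :: "'v \<Rightarrow> 'v \<Rightarrow> 'v \<Rightarrow> 'v" where
  "conformal n v u \<equiv> scaleV (2 * \<epsilon>) (scaleV (form u v) n - scaleV (form n v) u - scaleV (form n u) v)"

text \<open>The bracket of the elements of degree 1 that belong to \<open>s\<close> and \<open>t\<close> realizes \<open>n = \<omega> s t\<close>, and these
  vectors span \<open>V\<close>.\<close>

lemma degree_two_elements:
  obtains x where "x \<in> gr 2"
    "\<And>v u. bracket (bracket x (jV v)) (jV u) =
       jV (conformal n v u)"
proof -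
  let ?P = "\<lambda>n. \<exists>x\<in>gr 2. \<forall>v u. bracket (bracket x (jV v)) (jV u) =
       jV (conformal n v u)"
  have base: "?P (\<omega> s t)" for s t
  proof -
    obtain x y where xy: "x \<in> gr 1" "y \<in> gr 1" "\<And>v. bracket x (jV v) = jW (c v s)" "\<And>v. bracket y (jV v) = jW (c v t)"
      using full unfolding spinors_def by blast
    have L: "x \<in> L" "y \<in> L" using xy G.gr_in_carrier by blast+
    have xy2: "bracket x y \<in> gr 2" using G.bracket_gr[OF xy(1,2)] by simp
    have vec: "bracket (bracket z (jW r)) (jV u) = jV (\<omega> (c u s') r)"
      if "z \<in> L" "\<And>v. bracket z (jV v) = jW (c v s')" for z r u s'
      using bracket_bracket_jV_commute(1)[OF that(1)] by (simp add: that(2) bracket_jW)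
    have "bracket (bracket (bracket x y) (jV v)) (jV u) = jV (\<omega> (c u s) (c v t) - \<omega> (c u t) (c v s))" for v u
    proof -
      have "bracket (bracket x y) (jV v) = bracket x (bracket y (jV v)) - bracket y (bracket x (jV v))"
        using G.jacobi_derivation[OF L j_in_L(1), of v] by simp
      also have "\<dots> = bracket x (jW (c v t)) - bracket y (jW (c v s))" by (simp add: xy)
      finally show ?thesis
        using L by (simp add: G.bracket_diff G.bracket_closed vec xy(3,4) jV_diff)
    qed
    moreover have "\<omega> (c u s) (c v t) - \<omega> (c u t) (c v s) =
      conformal (\<omega> s t) v u" for u v
    proof (rule form_eqI)
      fix w
      have 1: "\<beta> (c w (c u s)) (c v t) = \<epsilon> * \<beta> (c v (c w (c u s))) t"
        by (simp add: beta_c[of v] mult.assoc[symmetric] epsilon_sq)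
      have "\<beta> (c w (c u t)) (c v s) = \<beta> t (c u (c w (c v s)))"
        by (simp add: beta_c mult.assoc[symmetric] epsilon_sq)
      also have "\<dots> = - \<epsilon> * \<beta> (c u (c w (c v s))) t" by (rule beta_sym)
      finally have 2: "\<beta> (c w (c u t)) (c v s) = - \<epsilon> * \<beta> (c u (c w (c v s))) t" .
      have "form (\<omega> (c u s) (c v t) - \<omega> (c u t) (c v s)) w
          = \<epsilon> * \<beta> (c v (c w (c u s)) + c u (c w (c v s))) t"
        by (simp add: form_diff form_omega 1 2 beta_add algebra_simps)
      also have "\<dots> = \<epsilon> * (2 * form u v * form (\<omega> s t) w - 2 * form u w * form (\<omega> s t) v - 2 * form v w * form (\<omega> s t) u)"
        unfolding c_three by (simp add: c_diff c_scale_left beta_diff beta_scale form_omega)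
      finally show "form (\<omega> (c u s) (c v t) - \<omega> (c u t) (c v s)) w = form (conformal (\<omega> s t) v u) w"
        by (simp add: form_diff form_add form_scale algebra_simps)
    qed
    ultimately show ?thesis using xy2 by (intro bexI[of _ "bracket x y"]) simp_all
  qed
  have span: "?P n" if "n \<in> V.span {\<omega> s t | s t. True}" for n
    using that
  proof (induction rule: V.span_induct_alt)
    case base
    show ?case by (intro bexI[of _ 0]) (simp_all add: G.subspace_0 G.subspace_gr)
  next
    case (step a n m)
    then obtain s t where "n = \<omega> s t" by blast
    then obtain x where x: "x \<in> gr 2" "\<And>v u. bracket (bracket x (jV v)) (jV u) =
       jV (conformal n v u)" using base by blast
    obtain y where y: "y \<in> gr 2" "\<And>v u. bracket (bracket y (jV v)) (jV u) =
       jV (conformal m v u)" using step(2) by blast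
    have L: "x \<in> L" "y \<in> L" using x y G.gr_in_carrier by blast+
    have L': "scale a x \<in> L" using G.subspace_scale[OF G.subspace_L L(1)] .
    show ?case
    proof (intro bexI[of _ "scale a x + y"] allI)
      show "scale a x + y \<in> gr 2" using x y by (simp add: G.subspace_add G.subspace_scale G.subspace_gr)
      show "bracket (bracket (scale a x + y) (jV v)) (jV u) = jV (conformal (scaleV a n + m) v u)" for v u
      proof -
        have "bracket (bracket (scale a x + y) (jV v)) (jV u)
            = scale a (bracket (bracket x (jV v)) (jV u)) + bracket (bracket y (jV v)) (jV u)"
          using L L' by (simp add: G.bracket_add_left G.bracket_scale_left G.bracket_closed G.subspace_scale[OF G.subspace_L])
        then show ?thesis
          unfolding x(2) y(2) jV_scale[symmetric] jV_add[symmetric]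
          by (simp add: form_add form_scale V.scale_right_distrib V.scale_left_distrib V.scale_right_diff_distrib mult_ac algebra_simps)
      qed
    qed
  qed
  have "?P n" by (rule span) (subst span_omega, simp)
  then show ?thesis using that by blast
qed

text \<open>Since \<open>[x, t]\<close> has degree 1, it is given by a spinor \<open>\<sigma> t\<close>, and \<open>[[x, v], t] = v (\<sigma> t)\<close>. The derivation
  \<open>ad [x, v]\<close> has the same action on \<open>V\<close> as the one that acts on \<open>W\<close> by \<open>\<epsilon> v n\<close>, and
  \<open>conformal_spin_part_unique\<close> shows that \<open>\<sigma>\<close> cannot differ from \<open>\<epsilon> n\<close>.\<close>

lemma degree_two_spin_action:
  assumes x: "x \<in> gr 2"
    and xn: "\<And>v u. bracket (bracket x (jV v)) (jV u) =
       jV (conformal n v u)"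
  shows "bracket (bracket x (jV v)) (jW t) = jW (scaleW \<epsilon> (c v (c n t)))"
proof -
  have xL: "x \<in> L" using x by (rule G.gr_in_carrier)
  have xW: "bracket x (jW t) \<in> gr 1" for t using G.bracket_gr[OF x jW_gr, of t] by simp
  have "\<exists>s. \<forall>v. bracket (bracket x (jW t)) (jV v) = jW (c v s)" for t
    by (rule degree_one_spinor[OF xW[of t]]) blast
  then obtain \<sigma> where \<sigma>: "\<And>t v. bracket (bracket x (jW t)) (jV v) = jW (c v (\<sigma> t))" by metis
  have act: "bracket (bracket x (jV v)) (jW t) = jW (c v (\<sigma> t))" for v t
    using bracket_bracket_jV_commute(1)[OF xL, of t v] by (simp add: \<sigma>)
  have der: "\<beta> (c w (c v (\<sigma> s))) t + \<beta> (c w s) (c v (\<sigma> t)) =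
      2 * \<epsilon> * (form (\<omega> s t) v * form n w - form n v * form (\<omega> s t) w - form n (\<omega> s t) * form v w)" for s t v w
  proof -
    have "jV (\<omega> (c v (\<sigma> s)) t + \<omega> s (c v (\<sigma> t))) = bracket (bracket x (jV v)) (jV (\<omega> s t))"
      using bracket_omega[of "bracket x (jV v)" s t] xL
      by (simp add: G.bracket_closed act bracket_jW jV_add jV_minus omega_skew[of "c v (\<sigma> t)" s])
    then have "\<omega> (c v (\<sigma> s)) t + \<omega> s (c v (\<sigma> t)) =
        scaleV (2 * \<epsilon>) (scaleV (form (\<omega> s t) v) n - scaleV (form n v) (\<omega> s t) - scaleV (form n (\<omega> s t)) v)"
      by (simp add: xn)
    from arg_cong[OF this, of "\<lambda>y. form y w"] show ?thesis
      by (simp add: form_add form_omega[symmetric] form_diff form_scale)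
  qed
  have 0: "\<beta> (c w (c v (c n s))) t + \<beta> (c w s) (c v (c n t)) =
      2 * (form (\<omega> s t) v * form n w - form n v * form (\<omega> s t) w - form n (\<omega> s t) * form v w)" for s t v w
    using arg_cong[OF clifford_derivation[of v n s t], of "\<lambda>y. form y w"]
    by (simp add: form_add form_omega[symmetric] form_diff form_scale form_sym[of v "\<omega> s t"] algebra_simps)
  have "\<sigma> t - scaleW \<epsilon> (c n t) = 0" for t
  proof (rule conformal_spin_part_unique[of "\<lambda>t. \<sigma> t - scaleW \<epsilon> (c n t)"])
    fix s t v w
    have "\<beta> (c w (c v (\<sigma> s - scaleW \<epsilon> (c n s)))) t + \<beta> (c w s) (c v (\<sigma> t - scaleW \<epsilon> (c n t)))
      = (\<beta> (c w (c v (\<sigma> s))) t + \<beta> (c w s) (c v (\<sigma> t)))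
        - \<epsilon> * (\<beta> (c w (c v (c n s))) t + \<beta> (c w s) (c v (c n t)))"
      by (simp add: c_diff c_scale beta_diff beta_scale beta_scale_right algebra_simps)
    also have "\<dots> = 0" unfolding der 0 by simp
    finally show "\<beta> (c w (c v (\<sigma> s - scaleW \<epsilon> (c n s)))) t + \<beta> (c w s) (c v (\<sigma> t - scaleW \<epsilon> (c n t))) = 0" .
  qed
  then have "\<sigma> t = scaleW \<epsilon> (c n t)" by simp
  then show ?thesis by (simp add: act c_scale)
qed

lemma epsilon_nonzero: "\<epsilon> \<noteq> 0"
  using epsilon_sq by auto

text \<open>For a non-null \<open>e\<close>, bracketing the element of degree 2 that belongs to \<open>e\<close> with \<open>e\<close> itself gives a
  multiple of the grading element. In particular, the grading element lies in each ideal that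
  contains \<open>V\<close>.\<close>

lemma grading_element:
  obtains E where "E \<in> gr 0" "\<And>p x. x \<in> gr p \<Longrightarrow> bracket E x = scale (of_int p) x"
    "\<And>I. lie_ideal scale L bracket I \<Longrightarrow> range jV \<subseteq> I \<Longrightarrow> E \<in> I"
proof -
  obtain e where e: "form e e \<noteq> 0" using orthogonal_triple by blast
  obtain y where y: "y \<in> gr 2" "\<And>v u. bracket (bracket y (jV v)) (jV u) =
       jV (conformal e v u)"
    by (rule degree_two_elements[of e]) blast
  define q where "q = form e e"
  have q: "\<epsilon> * q \<noteq> 0" using e epsilon_nonzero by (simp add: q_def)
  \<comment> \<open>\<open>[y, e]\<close> acts on \<open>W\<close> as \<open>\<epsilon> e e = - \<epsilon> q\<close> and on \<open>V\<close> as twice this scalar.\<close>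
  define E where "E = scale (1 / (\<epsilon> * q)) (bracket y (jV e))"
  have yL: "y \<in> L" using y(1) by (rule G.gr_in_carrier)
  have "bracket y (jV e) \<in> gr 0" using G.bracket_gr[OF y(1) jV_gr, of e] by simp
  then have E0: "E \<in> gr 0" unfolding E_def by (rule G.subspace_scale[OF G.subspace_gr])
  then have EL: "E \<in> L" by (rule G.gr_in_carrier)
  have EW: "bracket E (jW t) = - jW t" for t
    using q yL degree_two_spin_action[OF y, of e t]
    by (simp add: E_def G.bracket_scale_left G.bracket_closed c_c q_def[symmetric] jW_minus jW_scale)
  have EV: "bracket E (jV u) = scale (- 2) (jV u)" for u
    using q yL by (simp add: E_def G.bracket_scale_left G.bracket_closed y(2) form_sym[of u e]
        V.scale_right_diff_distrib q_def[symmetric] jV_minus jV_scale)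
  have "bracket E x = scale (of_int p) x" if "x \<in> gr p" for p x
  proof (cases "p < - 2")
    case True
    then show ?thesis using that gr_low[of p] EL by simp
  next
    case False
    then have "- 2 \<le> p" by simp
    then have "\<forall>x\<in>gr p. bracket E x = scale (of_int p) x"
    proof (induction p rule: int_ge_induct)
      case base
      show ?case using EV gr_V by auto
    next
      case (step p)
      show ?case
      proof (cases "p = - 2")
        case True
        then show ?thesis using EW gr_W by auto
      next
        case False
        then have p: "p + 1 \<ge> 0" using step(1) by simp
        show ?thesis
        proof
          fix x assume x: "x \<in> gr (p + 1)"
          have xL: "x \<in> L" using x by (rule G.gr_in_carrier)
          have m: "scale (of_int (p + 1)) x \<in> gr (p + 1)" using x by (rule G.subspace_scale[OF G.subspace_gr])
          have "bracket E x \<in> gr (p + 1)" using G.bracket_gr[OF E0 x] by simp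
          then have g: "bracket E x - scale (of_int (p + 1)) x \<in> gr (p + 1)" using m by (rule G.subspace_diff[OF G.subspace_gr])
          have "bracket (bracket E x - scale (of_int (p + 1)) x) (jW s) = 0" for s
          proof -
            have xs: "bracket x (jW s) \<in> gr p" using G.bracket_gr[OF x jW_gr, of s] by simp
            have "bracket E (bracket x (jW s)) = bracket (bracket E x) (jW s) + bracket x (bracket E (jW s))"
              by (rule G.jacobi_derivation[OF EL xL j_in_L(2)])
            then have "bracket (bracket E x) (jW s) = scale (of_int p) (bracket x (jW s)) + bracket x (jW s)"
              using step(2) xs xL by (simp add: EW G.bracket_minus)
            then show ?thesis
              using xL EL G.gr_in_carrier[OF m]
              by (simp add: G.bracket_diff G.bracket_closed G.bracket_scale_left G.scale_left_distrib
                  G.bracket_add_left G.subspace_scale[OF G.subspace_L])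
          qed
          then show "bracket E x = scale (of_int (p + 1)) x" using transitive[OF p g] by simp
        qed
      qed
    qed
    then show ?thesis using that by blast
  qed
  moreover have "E \<in> I" if "lie_ideal scale L bracket I" "range jV \<subseteq> I" for I
    using that yL unfolding lie_ideal_def E_def by (blast intro: G.subspace_scale)
  ultimately show ?thesis using that[of E] E0 by blast
qed

text \<open>Homogeneous elements of an ideal can be brought down to degree \<open>-2\<close> by transitivity, and the
  degree 0 elements \<open>[[g\<^sub>2, V], _]\<close> already act irreducibly on \<open>V\<close>.\<close>

lemma ideal_contains_V:
  assumes I: "lie_ideal scale L bracket I" "I \<noteq> {0}"
  shows "range jV \<subseteq> I"
proof -
  have IL: "I \<subseteq> L" and subI: "G.subspace I" and cl: "\<And>x y. x \<in> L \<Longrightarrow> y \<in> I \<Longrightarrow> bracket x y \<in> I"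
    using I(1) unfolding lie_ideal_def by blast+
  have cl': "bracket y x \<in> I" if "x \<in> L" "y \<in> I" for x y
    using cl[OF that] G.bracket_skew[of y x] that IL G.subspace_neg[OF subI] by auto
  obtain x where x: "x \<in> I" "x \<noteq> 0" using I(2) G.subspace_0[OF subI] by blast
  obtain P f where P: "finite P" "\<And>p. f p \<in> gr p" "x = (\<Sum>p\<in>P. f p)"
    using G.carrier_decompose[of x] x(1) IL by blast
  obtain E where E: "E \<in> gr 0" "\<And>p x. x \<in> gr p \<Longrightarrow> bracket E x = scale (of_int p) x"
    by (rule grading_element) blast
  have fI: "f p \<in> I" if "p \<in> P" for p
    by (rule G.ideal_graded[OF char0 E I(1) P(1), of f p]) (use P x(1) that in auto)
  obtain p where p: "p \<in> P" "f p \<noteq> 0" using x(2) P(3) by (metis sum.neutral)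
  have "\<exists>v. v \<noteq> 0 \<and> jV v \<in> I" if "y \<in> gr p" "y \<in> I" "y \<noteq> 0" "p = int n - 2" for y p n
    using that
  proof (induction n arbitrary: y p)
    case 0
    then have "y \<in> range jV" using gr_V by simp
    then obtain v where "y = jV v" by blast
    then show ?case using 0 by (intro exI[of _ v]) auto
  next
    case (Suc n)
    have yL: "y \<in> L" using Suc.prems(1) by (rule G.gr_in_carrier)
    have "\<exists>s. bracket y (jW s) \<noteq> 0"
    proof (cases n)
      case 0
      then have "y \<in> range jW" using Suc.prems gr_W by simp
      then obtain s where s: "y = jW s" by blast
      then have "s \<noteq> 0" using Suc.prems(3) by auto
      then obtain t where "\<omega> s t \<noteq> 0" using omega_eq_0 by blast
      then have "bracket y (jW t) \<noteq> 0" using jV_inj[of "\<omega> s t"] by (auto simp: s bracket_jW)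
      then show ?thesis by blast
    next
      case (Suc m)
      then have "p \<ge> 0" using \<open>p = int (Suc n) - 2\<close> by simp
      then show ?thesis using transitive[of p y] Suc.prems by blast
    qed
    then obtain s where s: "bracket y (jW s) \<noteq> 0" by blast
    have "bracket y (jW s) \<in> gr (int n - 2)"
      using G.bracket_gr[OF Suc.prems(1) jW_gr, of s] Suc.prems(4) by (simp add: algebra_simps)
    then show ?case using Suc.IH[OF _ cl'[OF _ Suc.prems(2)] s] by simp
  qed
  moreover have "p \<ge> - 2" using p(2) P(2)[of p] gr_low[of p] by force
  then have "p = int (nat (p + 2)) - 2" by simp
  ultimately obtain v where v: "v \<noteq> 0" "jV v \<in> I" using P(2)[of p] fI[OF p(1)] p(2) by blast
  define Y where "Y = {v. jV v \<in> I}"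
  have "V.subspace Y"
    unfolding V.subspace_def Y_def
    by (auto simp: jV_add jV_scale G.subspace_0[OF subI] G.subspace_add[OF subI] G.subspace_scale[OF subI])
  moreover have "scaleV (form w u) n - scaleV (form n u) w \<in> Y" if u: "u \<in> Y" for w n u
  proof -
    obtain z where z: "z \<in> gr 2" "\<And>v u. bracket (bracket z (jV v)) (jV u) =
       jV (conformal n v u)"
      by (rule degree_two_elements[of n]) blast
    have "bracket z (jV w) \<in> L" using z(1) G.gr_in_carrier by (blast intro: G.bracket_closed j_in_L)
    then have "bracket (bracket z (jV w)) (jV u) \<in> I" using u unfolding Y_def by (blast intro: cl)
    then have "scale (1 / (2 * \<epsilon>)) (bracket (bracket z (jV w)) (jV u)) + scale (form n w) (jV u) \<in> I"
      using u unfolding Y_def by (intro G.subspace_add[OF subI] G.subspace_scale[OF subI]) simp_all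
    moreover have "scale (1 / (2 * \<epsilon>)) (bracket (bracket z (jV w)) (jV u)) + scale (form n w) (jV u)
        = jV (scaleV (form w u) n - scaleV (form n u) w)"
      using epsilon_nonzero two_nonzero
      by (simp add: z(2) jV_scale jV_diff form_sym[of u w])
    ultimately show ?thesis unfolding Y_def by simp
  qed
  ultimately have "Y = UNIV" using v by (intro so_invariant_subspace[of Y v]) (auto simp: Y_def)
  then show ?thesis unfolding Y_def by blast
qed

lemma simple: "simple_lie_algebra scale L bracket"
proof -
  obtain E where E: "E \<in> gr 0" "\<And>p x. x \<in> gr p \<Longrightarrow> bracket E x = scale (of_int p) x"
    and EI: "\<And>I. lie_ideal scale L bracket I \<Longrightarrow> range jV \<subseteq> I \<Longrightarrow> E \<in> I"
    by (rule grading_element) blast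
  obtain s :: 'w where s: "s \<noteq> 0" using nonzero_W by blast
  show ?thesis
  proof (rule G.simple_if_ideals_contain_grading_element[OF char0 finite_dim_carrier E])
    show "(-1::int) \<noteq> 0" by simp
    show "jW s \<in> gr (- 1)" by (rule jW_gr)
    show "jW s \<noteq> 0" using s jW_inj by blast
    show "E \<in> I" if "lie_ideal scale L bracket I" "I \<noteq> {0}" for I
      using EI[OF that(1) ideal_contains_V[OF that]] .
  qed
qed

end

section \<open>Graded Lie algebras from their components\<close>

definition fun_scale :: "('k \<Rightarrow> 'a \<Rightarrow> 'a) \<Rightarrow> 'k \<Rightarrow> ('i \<Rightarrow> 'a) \<Rightarrow> 'i \<Rightarrow> 'a" where
  "fun_scale scale a f = (\<lambda>i. scale a (f i))"

lemma fun_scale_apply [simp]: "fun_scale scale a f i = scale a (f i)"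
  by (simp add: fun_scale_def)

lemma vector_space_fun_scale:
  assumes "vector_space scale"
  shows "vector_space (fun_scale scale)"
proof -
  interpret vector_space scale by fact
  show ?thesis
    by unfold_locales (simp_all add: fun_eq_iff scale_right_distrib scale_left_distrib)
qed

lemma minus_fun_apply [simp]: "(f - g) i = f i - g i" and uminus_fun_apply [simp]: "(- f) i = - f i"
  for f g :: "'i \<Rightarrow> 'a::ab_group_add"
  by (simp_all add: fun_diff_def fun_Compl_def)

lemma lambda_zero_fun [simp]: "(\<lambda>_. 0) = 0"
  by (simp add: fun_eq_iff)

lemma sum_fun_apply: "(\<Sum>j\<in>J. F j) i = (\<Sum>j\<in>J. F j i)" for F :: "'j \<Rightarrow> 'i \<Rightarrow> 'a::ab_group_add"
  by (induction J rule: infinite_finite_induct) simp_all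

text \<open>The direct sum of countably many components is realized as the finitely supported functions on the
  degrees.\<close>

definition homogeneous :: "int \<Rightarrow> 'a::zero \<Rightarrow> int \<Rightarrow> 'a" where
  "homogeneous p x = (\<lambda>q. if q = p then x else 0)"

definition total_bracket :: "(int \<Rightarrow> int \<Rightarrow> 'a \<Rightarrow> 'a \<Rightarrow> 'a) \<Rightarrow> (int \<Rightarrow> 'a) \<Rightarrow> (int \<Rightarrow> 'a) \<Rightarrow> int \<Rightarrow> 'a::ab_group_add" where
  "total_bracket br f g = (\<lambda>r. \<Sum>p\<in>{p. f p \<noteq> 0}. br p (r - p) (f p) (g (r - p)))"

text \<open>A graded Lie algebra presented degree by degree: one bracket for each pair of degrees. The same vector
  may occur in several components \<open>C p\<close>, which is why the bracket takes the degrees as arguments.\<close>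

locale lie_components = vector_space scale
  for scale :: "'k::field \<Rightarrow> 'a::ab_group_add \<Rightarrow> 'a" +
  fixes C :: "int \<Rightarrow> 'a set" and br :: "int \<Rightarrow> int \<Rightarrow> 'a \<Rightarrow> 'a \<Rightarrow> 'a"
  assumes two_nonzero: "(2::'k) \<noteq> 0"
    and subspace_C: "subspace (C p)"
    and br_closed: "\<lbrakk>x \<in> C p; y \<in> C q\<rbrakk> \<Longrightarrow> br p q x y \<in> C (p + q)"
    and br_add: "\<lbrakk>x \<in> C p; x' \<in> C p; y \<in> C q\<rbrakk> \<Longrightarrow> br p q (x + x') y = br p q x y + br p q x' y"
    and br_scale: "\<lbrakk>x \<in> C p; y \<in> C q\<rbrakk> \<Longrightarrow> br p q (scale a x) y = scale a (br p q x y)"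
    and br_skew: "\<lbrakk>x \<in> C p; y \<in> C q\<rbrakk> \<Longrightarrow> br p q x y = - br q p y x"
    and br_jacobi: "\<lbrakk>x \<in> C p; y \<in> C q; z \<in> C r\<rbrakk> \<Longrightarrow>
      br p (q + r) x (br q r y z) + br q (r + p) y (br r p z x) + br r (p + q) z (br p q x y) = 0"
begin

lemma zero_C: "0 \<in> C p"
  by (rule subspace_0[OF subspace_C])

lemma br_zero: "x \<in> C p \<Longrightarrow> br p q x 0 = 0" "y \<in> C q \<Longrightarrow> br p q 0 y = 0"
proof -
  have l: "br p q 0 y = 0" if "y \<in> C q" for p q y
    using br_scale[OF zero_C that, of p 0] by simp
  then show "y \<in> C q \<Longrightarrow> br p q 0 y = 0" .
  show "br p q x 0 = 0" if "x \<in> C p" using br_skew[OF that zero_C] l[OF that] by simp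
qed

definition total :: "(int \<Rightarrow> 'a) set" where
  "total = {f. finite {p. f p \<noteq> 0} \<and> (\<forall>p. f p \<in> C p)}"

abbreviation "total_gr p \<equiv> homogeneous p ` C p"
abbreviation "tb \<equiv> total_bracket br"

interpretation F: vector_space "fun_scale scale :: 'k \<Rightarrow> (int \<Rightarrow> 'a) \<Rightarrow> int \<Rightarrow> 'a"
  by (rule vector_space_fun_scale[OF vector_space_axioms])

lemma subspace_total: "F.subspace total"
  unfolding F.subspace_def
proof (intro conjI ballI allI)
  show "0 \<in> total" by (simp add: total_def zero_C)
next
  fix f g assume fg: "f \<in> total" "g \<in> total"
  have "{p. (f + g) p \<noteq> 0} \<subseteq> {p. f p \<noteq> 0} \<union> {p. g p \<noteq> 0}" by auto
  then have "finite {p. (f + g) p \<noteq> 0}"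
    by (rule finite_subset) (use fg in \<open>simp add: total_def\<close>)
  then show "f + g \<in> total" using fg by (simp add: total_def subspace_add[OF subspace_C])
next
  fix a f assume f: "f \<in> total"
  have "{p. fun_scale scale a f p \<noteq> 0} \<subseteq> {p. f p \<noteq> 0}" by auto
  then have "finite {p. fun_scale scale a f p \<noteq> 0}"
    by (rule finite_subset) (use f in \<open>simp add: total_def\<close>)
  then show "fun_scale scale a f \<in> total" using f by (simp add: total_def subspace_scale[OF subspace_C])
qed

lemma homogeneous_total: "x \<in> C p \<Longrightarrow> homogeneous p x \<in> total"
proof -
  assume "x \<in> C p"
  moreover have "{q. homogeneous p x q \<noteq> 0} \<subseteq> {p}" by (auto simp: homogeneous_def split: if_splits)
  then have "finite {q. homogeneous p x q \<noteq> 0}" by (rule finite_subset) simp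
  moreover have "homogeneous p x q \<in> C q" for q using \<open>x \<in> C p\<close> by (simp add: homogeneous_def zero_C)
  ultimately show ?thesis by (simp add: total_def)
qed

lemma graded_carrier_total: "graded_carrier (fun_scale scale) total_gr = total"
proof
  show "graded_carrier (fun_scale scale) total_gr \<subseteq> total"
    unfolding graded_carrier_def
    by (rule F.span_minimal) (auto simp: subspace_total homogeneous_total)
  show "total \<subseteq> graded_carrier (fun_scale scale) total_gr"
  proof
    fix f assume f: "f \<in> total"
    have "f = (\<Sum>p\<in>{p. f p \<noteq> 0}. homogeneous p (f p))"
    proof
      fix q
      have "(\<Sum>p\<in>{p. f p \<noteq> 0}. homogeneous p (f p)) q = (\<Sum>p\<in>{p. f p \<noteq> 0}. if q = p then f p else 0)"
        by (simp add: sum_fun_apply homogeneous_def)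
      also have "\<dots> = f q" using f by (simp add: total_def)
      finally show "f q = (\<Sum>p\<in>{p. f p \<noteq> 0}. homogeneous p (f p)) q" by simp
    qed
    also have "\<dots> \<in> graded_carrier (fun_scale scale) total_gr"
      unfolding graded_carrier_def
      by (intro F.span_sum F.span_base) (use f in \<open>auto simp: total_def\<close>)
    finally show "f \<in> graded_carrier (fun_scale scale) total_gr" .
  qed
qed

lemma total_bracket_sum:
  assumes "finite P" "{p. f p \<noteq> 0} \<subseteq> P" "g \<in> total"
  shows "tb f g r = (\<Sum>p\<in>P. br p (r - p) (f p) (g (r - p)))"
  unfolding total_bracket_def
  by (rule sum.mono_neutral_left) (use assms in \<open>auto simp: total_def br_zero\<close>)

lemma total_bracket_homogeneous:
  assumes x: "x \<in> C p" and y: "y \<in> C q"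
  shows "tb (homogeneous p x) (homogeneous q y) = homogeneous (p + q) (br p q x y)"
proof
  fix r
  have "tb (homogeneous p x) (homogeneous q y) r
      = (\<Sum>s\<in>{p}. br s (r - s) (homogeneous p x s) (homogeneous q y (r - s)))"
    by (rule total_bracket_sum) (auto simp: homogeneous_total y, auto simp: homogeneous_def split: if_splits)
  then show "tb (homogeneous p x) (homogeneous q y) r = homogeneous (p + q) (br p q x y) r"
    using x by (auto simp: homogeneous_def br_zero)
qed

lemma total_bracket_add_left:
  assumes "f \<in> total" "g \<in> total" "h \<in> total"
  shows "tb (f + g) h = tb f h + tb g h"
proof
  fix r
  let ?P = "{p. f p \<noteq> 0} \<union> {p. g p \<noteq> 0}"
  have fin: "finite ?P" using assms by (simp add: total_def)
  have "tb (f + g) h r = (\<Sum>p\<in>?P. br p (r - p) ((f + g) p) (h (r - p)))"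
    by (rule total_bracket_sum[OF fin _ assms(3)]) auto
  also have "\<dots> = (\<Sum>p\<in>?P. br p (r - p) (f p) (h (r - p)) + br p (r - p) (g p) (h (r - p)))"
    by (rule sum.cong) (use assms in \<open>auto simp: total_def br_add\<close>)
  also have "\<dots> = tb f h r + tb g h r"
    unfolding sum.distrib
    by (subst (1 2) total_bracket_sum[OF fin _ assms(3)]) auto
  finally show "tb (f + g) h r = (tb f h + tb g h) r" by simp
qed

lemma br_add_right: "\<lbrakk>x \<in> C p; y \<in> C q; y' \<in> C q\<rbrakk> \<Longrightarrow> br p q x (y + y') = br p q x y + br p q x y'"
  by (simp add: br_skew[of x p _ q] br_add subspace_add[OF subspace_C])

lemma br_scale_right: "\<lbrakk>x \<in> C p; y \<in> C q\<rbrakk> \<Longrightarrow> br p q x (scale a y) = scale a (br p q x y)"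
  by (simp add: br_skew[of x p _ q] br_scale subspace_scale[OF subspace_C])

lemma total_bracket_add_right:
  assumes "f \<in> total" "g \<in> total" "h \<in> total"
  shows "tb f (g + h) = tb f g + tb f h"
  unfolding total_bracket_def
  using assms by (auto simp: fun_eq_iff total_def br_add_right sum.distrib)

lemma total_bracket_scale_left:
  assumes "f \<in> total" "g \<in> total"
  shows "tb (fun_scale scale a f) g = fun_scale scale a (tb f g)"
proof
  fix r
  have "tb (fun_scale scale a f) g r = (\<Sum>p\<in>{p. f p \<noteq> 0}. br p (r - p) (fun_scale scale a f p) (g (r - p)))"
    by (rule total_bracket_sum) (use assms in \<open>auto simp: total_def\<close>)
  also have "\<dots> = (\<Sum>p\<in>{p. f p \<noteq> 0}. scale a (br p (r - p) (f p) (g (r - p))))"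
    by (rule sum.cong) (use assms in \<open>auto simp: total_def br_scale\<close>)
  finally show "tb (fun_scale scale a f) g r = fun_scale scale a (tb f g) r"
    by (simp add: total_bracket_def scale_sum_right)
qed

lemma total_bracket_scale_right:
  assumes "f \<in> total" "g \<in> total"
  shows "tb f (fun_scale scale a g) = fun_scale scale a (tb f g)"
  unfolding total_bracket_def
  using assms by (auto simp: fun_eq_iff total_def br_scale_right scale_sum_right)

lemma total_bracket_closed:
  assumes f: "f \<in> total" and g: "g \<in> total"
  shows "tb f g \<in> total"
proof -
  have "{r. tb f g r \<noteq> 0} \<subseteq> (\<lambda>(p, q). p + q) ` ({p. f p \<noteq> 0} \<times> {q. g q \<noteq> 0})"
  proof
    fix r assume "r \<in> {r. tb f g r \<noteq> 0}"
    then have "\<exists>p\<in>{p. f p \<noteq> 0}. br p (r - p) (f p) (g (r - p)) \<noteq> 0"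
      unfolding total_bracket_def by (metis (mono_tags, lifting) mem_Collect_eq sum.neutral)
    then obtain p where p: "f p \<noteq> 0" "br p (r - p) (f p) (g (r - p)) \<noteq> 0" by blast
    then have "g (r - p) \<noteq> 0" using br_zero(1)[of "f p" p "r - p"] f by (auto simp: total_def)
    then have "(p, r - p) \<in> {p. f p \<noteq> 0} \<times> {q. g q \<noteq> 0}" using p by simp
    then have "(case (p, r - p) of (p, q) \<Rightarrow> p + q) \<in> (\<lambda>(p, q). p + q) ` ({p. f p \<noteq> 0} \<times> {q. g q \<noteq> 0})"
      by (rule imageI)
    then show "r \<in> (\<lambda>(p, q). p + q) ` ({p. f p \<noteq> 0} \<times> {q. g q \<noteq> 0})" by simp
  qed
  then have "finite {r. tb f g r \<noteq> 0}"
    by (rule finite_subset) (use f g in \<open>simp add: total_def\<close>)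
  moreover have "tb f g r \<in> C r" for r
    unfolding total_bracket_def
  proof (rule subspace_sum[OF subspace_C])
    fix p
    have "br p (r - p) (f p) (g (r - p)) \<in> C (p + (r - p))"
      by (rule br_closed) (use f g in \<open>auto simp: total_def\<close>)
    then show "br p (r - p) (f p) (g (r - p)) \<in> C r" by simp
  qed
  ultimately show ?thesis by (simp add: total_def)
qed

lemma total_induct [consumes 1, case_names zero step]:
  assumes "f \<in> total" and "P 0"
    and "\<And>a p x g. x \<in> C p \<Longrightarrow> g \<in> total \<Longrightarrow> P g \<Longrightarrow> P (fun_scale scale a (homogeneous p x) + g)"
  shows "P f"
proof -
  have "f \<in> F.span (\<Union>p. total_gr p)" using assms(1) graded_carrier_total by (simp add: graded_carrier_def)
  then have "f \<in> total \<and> P f"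
  proof (rule F.span_induct_alt[where h = "\<lambda>f. f \<in> total \<and> P f"])
    show "0 \<in> total \<and> P 0" using assms(2) F.subspace_0[OF subspace_total] by blast
    fix a y g assume y: "y \<in> (\<Union>p. total_gr p)" and g: "g \<in> total \<and> P g"
    obtain p x where x: "y = homogeneous p x" "x \<in> C p" using y by blast
    have "fun_scale scale a y \<in> total"
      unfolding x(1) by (rule F.subspace_scale[OF subspace_total homogeneous_total[OF x(2)]])
    then show "fun_scale scale a y + g \<in> total \<and> P (fun_scale scale a y + g)"
      using g assms(3)[OF x(2)] F.subspace_add[OF subspace_total] unfolding x(1) by blast
  qed
  then show ?thesis by simp
qed

lemmas total_closed = F.subspace_0[OF subspace_total] F.subspace_add[OF subspace_total]
  F.subspace_scale[OF subspace_total] homogeneous_total total_bracket_closed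

lemmas total_bilinear = total_bracket_add_left total_bracket_add_right
  total_bracket_scale_left total_bracket_scale_right

lemma total_bracket_zero: "f \<in> total \<Longrightarrow> tb f 0 = 0" "f \<in> total \<Longrightarrow> tb 0 f = 0"
  using total_bracket_scale_right[of f 0 0] total_bracket_scale_left[of 0 f 0] total_closed(1) by simp_all

lemma total_bracket_skew:
  assumes "f \<in> total" "g \<in> total"
  shows "tb f g = - tb g f"
proof (rule total_induct[where P = "\<lambda>f. tb f g = - tb g f", OF assms(1)])
  show "tb 0 g = - tb g 0" using assms(2) by (simp add: total_bracket_zero)
  fix a p x f assume x: "x \<in> C p" and f: "f \<in> total" "tb f g = - tb g f"
  have "tb (homogeneous p x) g = - tb g (homogeneous p x)"
  proof (rule total_induct[where P = "\<lambda>g. tb (homogeneous p x) g = - tb g (homogeneous p x)", OF assms(2)])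
    show "tb (homogeneous p x) 0 = - tb 0 (homogeneous p x)"
      using x by (simp add: total_bracket_zero homogeneous_total)
    fix b q y g assume y: "y \<in> C q" and g: "g \<in> total" "tb (homogeneous p x) g = - tb g (homogeneous p x)"
    have "tb (homogeneous p x) (homogeneous q y) = - tb (homogeneous q y) (homogeneous p x)"
      using x y br_skew[of x p y q]
      by (simp add: total_bracket_homogeneous add.commute) (simp add: homogeneous_def fun_eq_iff)
    then show "tb (homogeneous p x) (fun_scale scale b (homogeneous q y) + g)
        = - tb (fun_scale scale b (homogeneous q y) + g) (homogeneous p x)"
      using x y g by (simp add: total_bilinear total_closed)
  qed
  then show "tb (fun_scale scale a (homogeneous p x) + f) g = - tb g (fun_scale scale a (homogeneous p x) + f)"
    using x f assms(2) by (simp add: total_bilinear total_closed)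
qed

definition jacobiator :: "(int \<Rightarrow> 'a) \<Rightarrow> (int \<Rightarrow> 'a) \<Rightarrow> (int \<Rightarrow> 'a) \<Rightarrow> int \<Rightarrow> 'a" where
  "jacobiator f g h = tb f (tb g h) + tb g (tb h f) + tb h (tb f g)"

lemma jacobiator_cyclic: "jacobiator f g h = jacobiator g h f"
  by (simp only: jacobiator_def add_ac)

text \<open>Together with cyclic invariance, this linearity in one slot reduces the Jacobi identity to
  homogeneous elements in all three slots.\<close>

lemma jacobiator_zero_if_homogeneous:
  assumes "f \<in> total" "g \<in> total" "h \<in> total"
    and hom: "\<And>p x. x \<in> C p \<Longrightarrow> jacobiator (homogeneous p x) g h = 0"
  shows "jacobiator f g h = 0"
proof (rule total_induct[where P = "\<lambda>f. jacobiator f g h = 0", OF assms(1)])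
  show "jacobiator 0 g h = 0" using assms by (simp add: jacobiator_def total_bracket_zero total_closed)
  fix a p x f assume x: "x \<in> C p" and f: "f \<in> total" "jacobiator f g h = 0"
  have "jacobiator (fun_scale scale a (homogeneous p x) + f) g h
      = fun_scale scale a (jacobiator (homogeneous p x) g h) + jacobiator f g h"
    unfolding jacobiator_def using assms(2,3) x f
    by (simp only: total_bilinear total_closed F.scale_right_distrib add_ac)
  then show "jacobiator (fun_scale scale a (homogeneous p x) + f) g h = 0"
    using f(2) hom[OF x] by simp
qed

lemma total_bracket_jacobi:
  assumes "f \<in> total" "g \<in> total" "h \<in> total"
  shows "tb f (tb g h) + tb g (tb h f) + tb h (tb f g) = 0"
proof -
  have 1: "jacobiator (homogeneous p x) (homogeneous q y) (homogeneous r z) = 0"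
    if "x \<in> C p" "y \<in> C q" "z \<in> C r" for p q r x y z
    proof -
    have "jacobiator (homogeneous p x) (homogeneous q y) (homogeneous r z)
        = homogeneous (p + (q + r)) (br p (q + r) x (br q r y z) + br q (r + p) y (br r p z x) + br r (p + q) z (br p q x y))"
      using that by (simp add: jacobiator_def total_bracket_homogeneous br_closed)
        (simp add: homogeneous_def fun_eq_iff add_ac)
    then show ?thesis using br_jacobi[OF that] by (simp add: homogeneous_def)
  qed
  have 2: "jacobiator f (homogeneous q y) (homogeneous r z) = 0" if "y \<in> C q" "z \<in> C r" for q r y z
    by (rule jacobiator_zero_if_homogeneous[OF assms(1)]) (fact homogeneous_total[OF that(1)],
        fact homogeneous_total[OF that(2)], fact 1[OF _ that])
  have 3: "jacobiator g (homogeneous r z) f = 0" if z: "z \<in> C r" for r z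
  proof (rule jacobiator_zero_if_homogeneous[OF assms(2) homogeneous_total[OF z] assms(1)])
    show "jacobiator (homogeneous q y) (homogeneous r z) f = 0" if "y \<in> C q" for q y
      using 2[OF that z] jacobiator_cyclic[of f "homogeneous q y" "homogeneous r z"] by simp
  qed
  have "jacobiator h f g = 0"
  proof (rule jacobiator_zero_if_homogeneous[OF assms(3,1,2)])
    show "jacobiator (homogeneous r z) f g = 0" if "z \<in> C r" for r z
      using 3[OF that] jacobiator_cyclic[of g "homogeneous r z" f] by simp
  qed
  then show ?thesis using jacobiator_cyclic[of h f g] by (simp add: jacobiator_def)
qed

lemma total_graded_lie_algebra: "graded_lie_algebra (fun_scale scale) total_gr tb"
proof (unfold graded_lie_algebra_def lie_algebra_def lie_algebra_axioms_def graded_lie_algebra_axioms_def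
    graded_carrier_total, intro conjI allI impI)
  show "vector_space (fun_scale scale :: 'k \<Rightarrow> (int \<Rightarrow> 'a) \<Rightarrow> int \<Rightarrow> 'a)" by (rule F.vector_space_axioms)
  show "F.subspace total" by (rule subspace_total)
  fix f g h :: "int \<Rightarrow> 'a" assume fgh: "f \<in> total" "g \<in> total"
  show "tb f g \<in> total" using fgh by (rule total_bracket_closed)
  show "tb (fun_scale scale c f) g = fun_scale scale c (tb f g)" for c
    using fgh by (rule total_bracket_scale_left)
  show "tb f (fun_scale scale c g) = fun_scale scale c (tb f g)" for c
    using fgh by (rule total_bracket_scale_right)
  assume h: "h \<in> total"
  show "tb (f + g) h = tb f h + tb g h" using fgh h by (rule total_bracket_add_left)
  show "tb f (g + h) = tb f g + tb f h" using fgh h by (rule total_bracket_add_right)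
  show "tb f (tb g h) + tb g (tb h f) + tb h (tb f g) = 0" using fgh h by (rule total_bracket_jacobi)
next
  fix f assume f: "f \<in> total"
  have "tb f f r = 0" for r
  proof -
    have "tb f f r + tb f f r = 0" using total_bracket_skew[OF f f] by (simp add: fun_eq_iff eq_neg_iff_add_eq_0)
    then have "scale 2 (tb f f r) = 0" using scale_left_distrib[of 1 1 "tb f f r"] by (simp add: one_add_one)
    then show ?thesis using two_nonzero by simp
  qed
  then show "tb f f = 0" by (simp add: fun_eq_iff)
next
  show "F.subspace (total_gr p)" for p
    unfolding F.subspace_def
  proof (intro conjI ballI allI)
    show "0 \<in> total_gr p" by (rule image_eqI[of _ _ 0]) (simp_all add: homogeneous_def fun_eq_iff zero_C)
    fix f g assume "f \<in> total_gr p" "g \<in> total_gr p"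
    then obtain x y where "f = homogeneous p x" "g = homogeneous p y" "x \<in> C p" "y \<in> C p" by blast
    then show "f + g \<in> total_gr p"
      by (intro image_eqI[of _ _ "x + y"]) (simp_all add: homogeneous_def fun_eq_iff subspace_add[OF subspace_C])
  next
    fix a f assume "f \<in> total_gr p"
    then obtain x where "f = homogeneous p x" "x \<in> C p" by blast
    then show "fun_scale scale a f \<in> total_gr p"
      by (intro image_eqI[of _ _ "scale a x"]) (simp_all add: homogeneous_def fun_eq_iff subspace_scale[OF subspace_C])
  qed
next
  fix P f p assume P: "finite P" "\<forall>p. p \<in> P \<longrightarrow> f p \<in> total_gr p" "(\<Sum>p\<in>P. f p) = 0" "p \<in> P"
  have f: "f q r = 0" if "q \<in> P" "q \<noteq> r" for q r using P(2) that by (auto simp: homogeneous_def)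
  have "(\<Sum>q\<in>P. f q p) = (\<Sum>q\<in>P. if q = p then f q p else 0)"
    by (rule sum.cong) (use f in auto)
  also have "\<dots> = f p p" using P by simp
  finally have "f p p = 0" using arg_cong[OF P(3), of "\<lambda>F. F p"] by (simp add: sum_fun_apply)
  then have "f p r = 0" for r using f[OF P(4), of r] by (cases "r = p") simp_all
  then show "f p = 0" by (simp add: fun_eq_iff)
next
  fix f g p q assume "f \<in> total_gr p" "g \<in> total_gr q"
  then show "tb f g \<in> total_gr (p + q)" using br_closed by (auto simp: total_bracket_homogeneous)
qed

end

section \<open>Jets: the full prolongation of a two-step algebra\<close>

text \<open>An element of degree \<open>p\<close> of a transitive prolongation is determined by the values in \<open>V + W\<close> of its
  iterated brackets with elements of \<open>V\<close> and \<open>W\<close>. So it can be recorded as a function on words, the value at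
  \<open>[x\<^sub>1, ..., x\<^sub>k]\<close> being the part of \<open>[...[F, x\<^sub>1], ..., x\<^sub>k]\<close> in \<open>V + W\<close>. All components of the full
  prolongation thereby live on one type, and \<open>shift F x\<close> represents \<open>[F, x]\<close>.\<close>

type_synonym ('v, 'w) jet = "('v + 'w) list \<Rightarrow> 'v \<times> 'w"

definition shift :: "('v, 'w) jet \<Rightarrow> 'v + 'w \<Rightarrow> ('v, 'w) jet" where
  "shift F x = (\<lambda>l. F (x # l))"

definition deg :: "'v + 'w \<Rightarrow> int" where
  "deg x = (case x of Inl v \<Rightarrow> 2 | Inr s \<Rightarrow> 1)"

lemma deg_simps [simp]: "deg (Inl v) = 2" "deg (Inr s) = 1"
  by (simp_all add: deg_def)

lemma deg_pos: "deg x > 0"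
  by (cases x) simp_all

lemma jet_eqI: "F [] = H [] \<Longrightarrow> (\<And>x. shift F x = shift H x) \<Longrightarrow> F = H"
proof
  fix l assume "F [] = H []" "\<And>x. shift F x = shift H x"
  then show "F l = H l" by (cases l) (auto simp: shift_def dest: fun_cong)
qed

lemma shift_add [simp]: "shift (F + H) x = shift F x + shift H x"
  and shift_diff [simp]: "shift (F - H) x = shift F x - shift H x"
  and shift_minus [simp]: "shift (- F) x = - shift F x"
  and shift_zero [simp]: "shift 0 x = 0"
  and shift_scale [simp]: "shift (fun_scale sc a F) x = fun_scale sc a (shift F x)"
  for F H :: "('v::ab_group_add, 'w::ab_group_add) jet"
  by (simp_all add: shift_def fun_eq_iff)

text \<open>The bracket \<open>[F, H]\<close> for \<open>H\<close> of negative degree \<open>q\<close>: then \<open>H\<close> is a single vector or spinor, found at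
  the empty word.\<close>

definition bracket_negative :: "int \<Rightarrow> ('v::zero, 'w::zero) jet \<Rightarrow> ('v, 'w) jet \<Rightarrow> ('v, 'w) jet" where
  "bracket_negative q H F =
     (if q = - 2 then shift F (Inl (fst (H []))) else if q = - 1 then shift F (Inr (snd (H []))) else (\<lambda>_. 0))"

text \<open>In nonnegative degrees the recursion on words is the Leibniz rule \<open>[[F, H], x] = [[F, x], H] + [F, [H, x]]\<close>;
  the Jacobi identity with one argument in \<open>V + W\<close> is thus built into the definition.\<close>

fun jet_bracket :: "int \<Rightarrow> int \<Rightarrow> ('v::ab_group_add, 'w::ab_group_add) jet \<Rightarrow> ('v, 'w) jet \<Rightarrow> ('v, 'w) jet" where
  "jet_bracket p q F H [] =
     (if q < 0 then bracket_negative q H F [] else if p < 0 then - bracket_negative p F H [] else 0)"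
| "jet_bracket p q F H (x # l) =
     (if q < 0 then bracket_negative q H F (x # l) else if p < 0 then - bracket_negative p F H (x # l)
      else jet_bracket (p - deg x) q (shift F x) H l + jet_bracket p (q - deg x) F (shift H x) l)"

lemma jet_bracket_negative:
  "q < 0 \<Longrightarrow> jet_bracket p q F H = bracket_negative q H F"
  "p < 0 \<Longrightarrow> q \<ge> 0 \<Longrightarrow> jet_bracket p q F H = - bracket_negative p F H"
proof -
  show "q < 0 \<Longrightarrow> jet_bracket p q F H = bracket_negative q H F"
  proof
    fix l show "q < 0 \<Longrightarrow> jet_bracket p q F H l = bracket_negative q H F l" by (cases l) simp_all
  qed
  show "p < 0 \<Longrightarrow> q \<ge> 0 \<Longrightarrow> jet_bracket p q F H = - bracket_negative p F H"
  proof
    fix l show "p < 0 \<Longrightarrow> q \<ge> 0 \<Longrightarrow> jet_bracket p q F H l = (- bracket_negative p F H) l" by (cases l) simp_all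
  qed
qed

lemma jet_bracket_nonneg:
  assumes "p \<ge> 0" "q \<ge> 0"
  shows "jet_bracket p q F H [] = 0"
    and "shift (jet_bracket p q F H) x =
      jet_bracket (p - deg x) q (shift F x) H + jet_bracket p (q - deg x) F (shift H x)"
  using assms by (simp_all add: shift_def fun_eq_iff)

text \<open>A two-step nilpotent graded Lie algebra \<open>V + W\<close> that is generated by \<open>W\<close>.\<close>

locale two_step = V: vector_space scaleV + W: vector_space scaleW
  for scaleV :: "'k::field \<Rightarrow> 'v::ab_group_add \<Rightarrow> 'v"
    and scaleW :: "'k \<Rightarrow> 'w::ab_group_add \<Rightarrow> 'w" +
  fixes \<omega> :: "'w \<Rightarrow> 'w \<Rightarrow> 'v"
  assumes two_nonzero: "(2::'k) \<noteq> 0"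
    and omega_add: "\<omega> (s + t) r = \<omega> s r + \<omega> t r"
    and omega_scale: "\<omega> (scaleW a s) r = scaleV a (\<omega> s r)"
    and omega_skew: "\<omega> s t = - \<omega> t s"
    and span_omega: "V.span {\<omega> s t | s t. True} = UNIV"
    and finite_V: "finite_dim scaleV UNIV" and finite_W: "finite_dim scaleW UNIV"
begin

lemma omega_add_right: "\<omega> r (s + t) = \<omega> r s + \<omega> r t"
  by (simp add: omega_skew[of r] omega_add)

lemma omega_scale_right: "\<omega> r (scaleW a s) = scaleV a (\<omega> r s)"
  by (simp add: omega_skew[of r] omega_scale)

abbreviation sc :: "'k \<Rightarrow> ('v, 'w) jet \<Rightarrow> ('v, 'w) jet" where
  "sc \<equiv> fun_scale (translation_scale scaleV scaleW)"

lemma vector_space_translation: "vector_space (translation_scale scaleV scaleW)"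
  by unfold_locales (auto simp: translation_scale_def prod_eq_iff algebra_simps
        W.scale_right_distrib W.scale_left_distrib)

sublocale J: vector_space sc
  by (rule vector_space_fun_scale[OF vector_space_translation])

definition embV :: "'v \<Rightarrow> ('v, 'w) jet" where
  "embV v = (\<lambda>l. if l = [] then (v, 0) else 0)"

definition embW :: "'w \<Rightarrow> ('v, 'w) jet" where
  "embW s = (\<lambda>l. case l of [] \<Rightarrow> (0, s) | x # l' \<Rightarrow> (case x of Inl v \<Rightarrow> 0 | Inr t \<Rightarrow> embV (\<omega> s t) l'))"

lemma emb_Nil [simp]: "embV v [] = (v, 0)" "embW s [] = (0, s)"
  by (simp_all add: embV_def embW_def)

lemma shift_emb [simp]: "shift (embV v) x = 0" "shift (embW s) (Inr t) = embV (\<omega> s t)" "shift (embW s) (Inl v) = 0"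
  by (simp_all add: shift_def embV_def embW_def fun_eq_iff)

lemma emb_linear:
  "embV (u + v) = embV u + embV v" "embV (scaleV a u) = sc a (embV u)"
  "embW (s + t) = embW s + embW t" "embW (scaleW a s) = sc a (embW s)"
proof -
  show V: "embV (u + v) = embV u + embV v" "embV (scaleV a u) = sc a (embV u)" for u v a
    by (simp_all add: embV_def fun_eq_iff translation_scale_def zero_prod_def)
  show "embW (s + t) = embW s + embW t"
  proof (rule jet_eqI)
    show "shift (embW (s + t)) x = shift (embW s + embW t) x" for x
      by (cases x) (simp_all add: omega_add V)
  qed simp
  show "embW (scaleW a s) = sc a (embW s)"
  proof (rule jet_eqI)
    show "shift (embW (scaleW a s)) x = shift (sc a (embW s)) x" for x
      by (cases x) (simp_all add: omega_scale V)
  qed (simp add: translation_scale_def)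
qed

lemma emb_zero [simp]: "embV 0 = 0" "embW 0 = 0"
  using emb_linear(2)[of 0 0] emb_linear(4)[of 0 0] by simp_all

lemma embV_minus: "embV (- v) = - embV v"
  using emb_linear(2)[of "-1" v] by simp

lemma emb_inj: "embV v = 0 \<Longrightarrow> v = 0" "embW s = 0 \<Longrightarrow> s = 0"
  using emb_Nil(1)[of v] emb_Nil(2)[of s] by (auto simp: zero_prod_def)

definition head_linear :: "('v, 'w) jet \<Rightarrow> bool" where
  "head_linear F \<longleftrightarrow>
     (\<forall>s t. shift F (Inr (s + t)) = shift F (Inr s) + shift F (Inr t)) \<and>
     (\<forall>a s. shift F (Inr (scaleW a s)) = sc a (shift F (Inr s))) \<and>
     (\<forall>u v. shift F (Inl (u + v)) = shift F (Inl u) + shift F (Inl v)) \<and>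
     (\<forall>a v. shift F (Inl (scaleV a v)) = sc a (shift F (Inl v)))"

text \<open>\<open>F\<close> acts as a derivation with respect to the brackets \<open>[s, t] = \<omega> s t\<close> and \<open>[x, v] = 0\<close>.\<close>

definition head_derivation :: "('v, 'w) jet \<Rightarrow> bool" where
  "head_derivation F \<longleftrightarrow>
     (\<forall>s t. shift F (Inl (\<omega> s t)) = shift (shift F (Inr s)) (Inr t) - shift (shift F (Inr t)) (Inr s)) \<and>
     (\<forall>x v. shift (shift F x) (Inl v) = shift (shift F (Inl v)) x)"

text \<open>The conditions are imposed on the first letters only; they hold at all later letters by recursion,
  which is well-founded because each letter lowers the degree.\<close>

inductive jet_of_degree :: "int \<Rightarrow> ('v, 'w) jet \<Rightarrow> bool" where
  low: "p < - 2 \<Longrightarrow> jet_of_degree p 0"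
| minus_two: "jet_of_degree (- 2) (embV v)"
| minus_one: "jet_of_degree (- 1) (embW s)"
| nonneg: "\<lbrakk>p \<ge> 0; F [] = 0; \<And>x. jet_of_degree (p - deg x) (shift F x);
    head_linear F; head_derivation F\<rbrakk> \<Longrightarrow> jet_of_degree p F"

lemma jet_low: "jet_of_degree p F \<Longrightarrow> p < - 2 \<Longrightarrow> F = 0"
  by (erule jet_of_degree.cases) simp_all

lemma jet_minus_two: "jet_of_degree (- 2) F \<Longrightarrow> \<exists>v. F = embV v"
  by (erule jet_of_degree.cases) auto

lemma jet_minus_one: "jet_of_degree (- 1) F \<Longrightarrow> \<exists>s. F = embW s"
  by (erule jet_of_degree.cases) auto

lemma jet_Nil: "jet_of_degree p F \<Longrightarrow> p \<ge> 0 \<Longrightarrow> F [] = 0"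
  by (erule jet_of_degree.cases) auto

lemma head_properties:
  assumes "jet_of_degree p F"
  shows jet_linear: "head_linear F" and jet_derivation: "head_derivation F"
    and jet_shift: "jet_of_degree (p - deg x) (shift F x)"
proof -
  have "head_linear F \<and> head_derivation F \<and> jet_of_degree (p - deg x) (shift F x)"
    using assms
  proof (cases rule: jet_of_degree.cases)
    case low
    then show ?thesis using deg_pos[of x]
      by (auto simp: head_linear_def head_derivation_def intro: jet_of_degree.low)
  next
    case (minus_two v)
    then show ?thesis using deg_pos[of x]
      by (auto simp: head_linear_def head_derivation_def intro: jet_of_degree.low)
  next
    case (minus_one s)
    have "jet_of_degree (p - deg x) (shift F x)"
      using minus_one jet_of_degree.minus_two jet_of_degree.low[of "-3"] by (cases x) simp_all
    moreover have "shift (shift (embW s) x) (Inl v) = shift (shift (embW s) (Inl v)) x" for x v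
      by (cases x) simp_all
    ultimately show ?thesis using minus_one
      by (simp add: head_linear_def head_derivation_def omega_add_right omega_scale_right emb_linear)
  next
    case nonneg
    then show ?thesis by blast
  qed
  then show "head_linear F" "head_derivation F" "jet_of_degree (p - deg x) (shift F x)" by blast+
qed

lemma jet_combination:
  assumes "jet_of_degree p F" "jet_of_degree p H"
  shows "jet_of_degree p (F + sc a H)"
  using assms
proof (induction arbitrary: H rule: jet_of_degree.induct)
  case (low p)
  then have "jet_of_degree p (0 + sc a H)" using jet_low[of p H] jet_of_degree.low[of p] by simp
  then show ?case .
next
  case (minus_two v)
  then obtain u where "H = embV u" using jet_minus_two by blast
  then have "jet_of_degree (- 2) (embV v + sc a H)"
    using jet_of_degree.minus_two[of "v + scaleV a u"] by (simp add: emb_linear)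
  then show ?case .
next
  case (minus_one s)
  then obtain t where "H = embW t" using jet_minus_one by blast
  then have "jet_of_degree (- 1) (embW s + sc a H)"
    using jet_of_degree.minus_one[of "s + scaleW a t"] by (simp add: emb_linear)
  then show ?case .
next
  case (nonneg p F)
  show ?case
  proof (rule jet_of_degree.nonneg[OF nonneg(1)])
    show "(F + sc a H) [] = 0"
      using nonneg(2) jet_Nil[OF nonneg.prems nonneg(1)] by (simp add: translation_scale_def zero_prod_def)
    show "jet_of_degree (p - deg x) (shift (F + sc a H) x)" for x
      unfolding shift_add shift_scale by (rule nonneg.IH[OF jet_shift[OF nonneg.prems]])
    show "head_linear (F + sc a H)"
      using nonneg.hyps(4) jet_linear[OF nonneg.prems]
      by (simp add: head_linear_def J.scale_right_distrib algebra_simps)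
    show "head_derivation (F + sc a H)"
      using nonneg.hyps(5) jet_derivation[OF nonneg.prems]
      by (simp add: head_derivation_def J.scale_right_diff_distrib add_diff_add)
  qed
qed

lemma jet_zero: "jet_of_degree p 0"
proof -
  have neg: "jet_of_degree p 0" if "p < 0" for p
  proof -
    have "p < - 2 \<or> p = - 2 \<or> p = - 1" using that by arith
    then show ?thesis
      using jet_of_degree.low[of p] jet_of_degree.minus_two[of 0] jet_of_degree.minus_one[of 0] by (elim disjE) simp_all
  qed
  have "p < int n \<longrightarrow> jet_of_degree p 0" for p n
  proof (induct n arbitrary: p)
    case 0
    show ?case using neg by simp
  next
    case (Suc n)
    show ?case
    proof
      assume p: "p < int (Suc n)"
      have IH: "jet_of_degree (p - deg x) 0" for x
        using Suc[of "p - deg x"] p deg_pos[of x] by simp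
      show "jet_of_degree p 0"
      proof (cases "p < 0")
        case False
        show ?thesis
        proof (rule jet_of_degree.nonneg)
          show "jet_of_degree (p - deg x) (shift 0 x)" for x using IH by simp
        qed (use False in \<open>simp_all add: head_linear_def head_derivation_def\<close>)
      qed (rule neg)
    qed
  qed
  from this[of p "nat (p + 1)"] show ?thesis using neg[of p] by (cases "p < 0") simp_all
qed

lemma subspace_jet: "J.subspace {F. jet_of_degree p F}"
  unfolding J.subspace_def
proof (intro conjI ballI allI)
  show "0 \<in> {F. jet_of_degree p F}" using jet_zero by blast
  fix F H assume "F \<in> {F. jet_of_degree p F}" "H \<in> {F. jet_of_degree p F}"
  then have "jet_of_degree p (F + sc 1 H)" by (intro jet_combination) simp_all
  then show "F + H \<in> {F. jet_of_degree p F}" by simp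
next
  fix a F assume "F \<in> {F. jet_of_degree p F}"
  then have "jet_of_degree p (0 + sc a F)" by (intro jet_combination jet_zero) simp
  then show "sc a F \<in> {F. jet_of_degree p F}" by simp
qed

lemma jet_add: "jet_of_degree p F \<Longrightarrow> jet_of_degree p H \<Longrightarrow> jet_of_degree p (F + H)"
  using J.subspace_add[OF subspace_jet, of F p H] by simp

lemma jet_scale: "jet_of_degree p F \<Longrightarrow> jet_of_degree p (sc a F)"
  using J.subspace_scale[OF subspace_jet, of F p a] by simp

lemma jet_minus: "jet_of_degree p F \<Longrightarrow> jet_of_degree p (- F)"
  using J.subspace_neg[OF subspace_jet, of F p] by simp

lemma shift_linear:
  assumes "jet_of_degree p F"
  shows "shift F (Inr (s + t)) = shift F (Inr s) + shift F (Inr t)"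
    "shift F (Inr (scaleW a s)) = sc a (shift F (Inr s))"
    "shift F (Inl (u + v)) = shift F (Inl u) + shift F (Inl v)"
    "shift F (Inl (scaleV a v)) = sc a (shift F (Inl v))"
  using jet_linear[OF assms] by (simp_all add: head_linear_def)

lemma shift_zero_letter:
  assumes "jet_of_degree p F"
  shows "shift F (Inr 0) = 0" "shift F (Inl 0) = 0"
  using shift_linear(2)[OF assms, of 0 0] shift_linear(4)[OF assms, of 0 0] by simp_all

lemma bracket_negative_skew:
  assumes "jet_of_degree p F" "jet_of_degree q H" "p < 0" "q < 0"
  shows "bracket_negative q H F = - bracket_negative p F H"
proof -
  have cases: "F = 0 \<or> (p = - 2 \<and> (\<exists>v. F = embV v)) \<or> (p = - 1 \<and> (\<exists>s. F = embW s))"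
    if "jet_of_degree p F" "p < 0" for p F
  proof -
    have "p < - 2 \<or> p = - 2 \<or> p = - 1" using that by arith
    then show ?thesis using jet_low[OF that(1)] jet_minus_two[of F] jet_minus_one[of F] that by (elim disjE) simp_all
  qed
  have z: "bracket_negative p 0 F = 0" if "jet_of_degree q F" for p q F
    using shift_zero_letter[OF that] by (simp add: bracket_negative_def)
  have z': "bracket_negative p F 0 = 0" for p and F :: "('v, 'w) jet" by (simp add: bracket_negative_def)
  have zero: ?thesis if "F = 0 \<or> H = 0"
    using that z[OF assms(1)] z[OF assms(2)] z' by auto
  have WW: ?thesis if F: "p = - 1" "F = embW s" and H: "q = - 1" "H = embW t" for s t
    using F H embV_minus[of "\<omega> t s"] omega_skew[of s t] by (simp add: bracket_negative_def)
  have V: ?thesis if "p = - 2" "F = embV v" "q = - 2 \<and> H = embV u \<or> q = - 1 \<and> H = embW t" for v u t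
    using that by (auto simp: bracket_negative_def)
  have V': ?thesis if "q = - 2" "H = embV v" "p = - 2 \<and> F = embV u \<or> p = - 1 \<and> F = embW t" for v u t
    using that by (auto simp: bracket_negative_def)
  show ?thesis
    using cases[OF assms(1,3)] cases[OF assms(2,4)] zero WW V V' by blast
qed

end

section \<open>The Lie bracket of jets\<close>

context two_step
begin

lemma jet_bracket_negative_left:
  assumes "jet_of_degree p F" "jet_of_degree q H" "p < 0"
  shows "jet_bracket p q F H = - bracket_negative p F H"
proof (cases "q < 0")
  case True
  then show ?thesis
    using jet_bracket_negative(1)[OF True, of p F H] bracket_negative_skew[OF assms True] by simp
next
  case False
  then show ?thesis using jet_bracket_negative(2)[OF assms(3), of q F H] by simp
qed

lemma jet_bracket_skew:
  assumes "jet_of_degree p F" "jet_of_degree q H"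
  shows "jet_bracket p q F H = - jet_bracket q p H F"
proof
  fix l
  show "jet_bracket p q F H l = (- jet_bracket q p H F) l"
    using assms
  proof (induct l arbitrary: p q F H)
    case (Nil p q F H)
    show ?case
    proof (cases "p < 0 \<or> q < 0")
      case True
      then show ?thesis
        using Nil jet_bracket_negative_left[OF Nil] jet_bracket_negative_left[OF Nil(2,1)]
          jet_bracket_negative(1)[of q p F H] jet_bracket_negative(1)[of p q H F] by fastforce
    qed simp
  next
    case (Cons x l p q F H)
    show ?case
    proof (cases "p < 0 \<or> q < 0")
      case True
      then show ?thesis
        using Cons.prems jet_bracket_negative_left[OF Cons.prems] jet_bracket_negative_left[OF Cons.prems(2,1)]
          jet_bracket_negative(1)[of q p F H] jet_bracket_negative(1)[of p q H F] by fastforce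
    next
      case False
      then show ?thesis
        using Cons.hyps[OF jet_shift[OF Cons.prems(1), of x] Cons.prems(2)]
          Cons.hyps[OF Cons.prems(1) jet_shift[OF Cons.prems(2), of x]] by simp
    qed
  qed
qed

lemma jet_bracket_combination:
  assumes "jet_of_degree p F" "jet_of_degree p F'" "jet_of_degree q H"
  shows "jet_bracket p q (F + sc a F') H = jet_bracket p q F H + sc a (jet_bracket p q F' H)"
proof
  interpret T: vector_space "translation_scale scaleV scaleW" by (rule vector_space_translation)
  fix l
  show "jet_bracket p q (F + sc a F') H l = (jet_bracket p q F H + sc a (jet_bracket p q F' H)) l"
  proof (cases "q < 0")
    case True
    then show ?thesis
      by (simp add: jet_bracket_negative(1) bracket_negative_def translation_scale_def zero_prod_def)
  next
    case q: False
    show ?thesis using assms q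
    proof (induct l arbitrary: p q F F' H)
      case (Nil p q F F' H)
      show ?case
        using Nil shift_linear[OF Nil(3)]
        by (simp add: bracket_negative_def translation_scale_def zero_prod_def)
    next
      case (Cons x l p q F F' H)
      show ?case
      proof (cases "p < 0")
        case True
        then show ?thesis
          using Cons.prems(4) shift_linear[OF Cons.prems(3)]
          by (simp add: bracket_negative_def translation_scale_def zero_prod_def)
      next
        case False
        have sh: "jet_of_degree (p - deg x) (shift F x)" "jet_of_degree (p - deg x) (shift F' x)"
          "jet_of_degree (q - deg x) (shift H x)"
          using Cons.prems jet_shift by blast+
        have 1: "jet_bracket (p - deg x) q (shift F x + sc a (shift F' x)) H l =
            (jet_bracket (p - deg x) q (shift F x) H + sc a (jet_bracket (p - deg x) q (shift F' x) H)) l"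
          by (rule Cons.hyps[OF sh(1,2) Cons.prems(3,4)])
        have 2: "jet_bracket p (q - deg x) (F + sc a F') (shift H x) l =
            (jet_bracket p (q - deg x) F (shift H x) + sc a (jet_bracket p (q - deg x) F' (shift H x))) l"
        proof (cases "q - deg x < 0")
          case True
          then show ?thesis
            by (simp add: jet_bracket_negative(1) bracket_negative_def translation_scale_def zero_prod_def)
        next
          case False
          show ?thesis by (rule Cons.hyps[OF Cons.prems(1,2) sh(3) False])
        qed
        have "jet_bracket p q (F + sc a F') H (x # l) = (jet_bracket p q F H + sc a (jet_bracket p q F' H)) (x # l)"
          using False Cons.prems(4) 1 2 by (simp add: T.scale_right_distrib add_ac)
        then show ?thesis .
      qed
    qed
  qed
qed

lemma jet_bracket_add: 
  "\<lbrakk>jet_of_degree p F; jet_of_degree p F'; jet_of_degree q H\<rbrakk> \<Longrightarrow>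
    jet_bracket p q (F + F') H = jet_bracket p q F H + jet_bracket p q F' H"
  using jet_bracket_combination[of p F F' q H 1] by simp

lemma jet_bracket_zero [simp]: "jet_of_degree q H \<Longrightarrow> jet_bracket p q 0 H = 0"
  using jet_bracket_combination[OF jet_zero jet_zero, of q H p 1] by simp

lemma jet_bracket_scale:
  "\<lbrakk>jet_of_degree p F; jet_of_degree q H\<rbrakk> \<Longrightarrow> jet_bracket p q (sc a F) H = sc a (jet_bracket p q F H)"
  using jet_bracket_combination[OF jet_zero, of p F q H a] by simp

lemma jet_bracket_diff:
  "\<lbrakk>jet_of_degree p F; jet_of_degree p F'; jet_of_degree q H\<rbrakk> \<Longrightarrow>
    jet_bracket p q (F - F') H = jet_bracket p q F H - jet_bracket p q F' H"
  using jet_bracket_combination[of p F F' q H "-1"] by simp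

lemma jet_bracket_add_right:
  "\<lbrakk>jet_of_degree p F; jet_of_degree q H; jet_of_degree q H'\<rbrakk> \<Longrightarrow>
    jet_bracket p q F (H + H') = jet_bracket p q F H + jet_bracket p q F H'"
  by (simp add: jet_bracket_skew[of p F q] jet_add jet_bracket_add)

lemma jet_bracket_scale_right:
  "\<lbrakk>jet_of_degree p F; jet_of_degree q H\<rbrakk> \<Longrightarrow> jet_bracket p q F (sc a H) = sc a (jet_bracket p q F H)"
  by (simp add: jet_bracket_skew[of p F q] jet_scale jet_bracket_scale)

lemma jet_bracket_zero_right [simp]: "jet_of_degree p F \<Longrightarrow> jet_bracket p q F 0 = 0"
  using jet_bracket_skew[OF _ jet_zero, of p F q] by simp

lemma jet_diff: "jet_of_degree p F \<Longrightarrow> jet_of_degree p H \<Longrightarrow> jet_of_degree p (F - H)"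
  using jet_combination[of p F H "-1"] by simp

lemma jet_bracket_diff_right:
  "\<lbrakk>jet_of_degree p F; jet_of_degree q H; jet_of_degree q H'\<rbrakk> \<Longrightarrow>
    jet_bracket p q F (H - H') = jet_bracket p q F H - jet_bracket p q F H'"
  by (simp add: jet_bracket_skew[of p F q] jet_diff jet_bracket_diff)

lemma shift_derivation:
  assumes "jet_of_degree p F"
  shows "shift F (Inl (\<omega> s t)) = shift (shift F (Inr s)) (Inr t) - shift (shift F (Inr t)) (Inr s)"
    "shift (shift F x) (Inl v) = shift (shift F (Inl v)) x"
  using jet_derivation[OF assms] by (simp_all add: head_derivation_def)

text \<open>In nonnegative degrees this is the definition. If one of the degrees is negative, the identity is the
  derivation property of the other argument.\<close>

lemma jet_bracket_shift:
  assumes F: "jet_of_degree p F" and H: "jet_of_degree q H"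
  shows "shift (jet_bracket p q F H) x =
    jet_bracket (p - deg x) q (shift F x) H + jet_bracket p (q - deg x) F (shift H x)"
proof -
  have neg: "shift (jet_bracket p q F H) x =
    jet_bracket (p - deg x) q (shift F x) H + jet_bracket p (q - deg x) F (shift H x)"
    if F: "jet_of_degree p F" and H: "jet_of_degree q H" and q: "q < 0" for p q F H
  proof -
    have q': "q - deg x < 0" using q deg_pos[of x] by simp
    have "q < - 2 \<or> q = - 2 \<or> q = - 1" using q by arith
    then show ?thesis
    proof (elim disjE)
      assume "q < - 2"
      then have "H = 0" using jet_low[OF H] by simp
      then show ?thesis using F jet_shift[OF F] by simp
    next
      assume q2: "q = - 2"
      then obtain v where v: "H = embV v" using jet_minus_two[of H] H q2 by blast
      show ?thesis using q2 v shift_derivation(2)[OF F, of x v] deg_pos[of x] F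
        by (simp add: jet_bracket_negative(1) bracket_negative_def)
    next
      assume q1: "q = - 1"
      then obtain s where s: "H = embW s" using jet_minus_one[of H] H q1 by blast
      show ?thesis
      proof (cases x)
        case (Inl v)
        then show ?thesis using q1 s shift_derivation(2)[OF F, of "Inr s" v] F
          by (simp add: jet_bracket_negative(1) bracket_negative_def)
      next
        case (Inr t)
        then show ?thesis using q1 s shift_derivation(1)[OF F, of s t] F
          by (simp add: jet_bracket_negative(1) bracket_negative_def)
      qed
    qed
  qed
  show ?thesis
  proof (cases "q < 0")
    case True
    then show ?thesis by (rule neg[OF F H])
  next
    case q: False
    show ?thesis
    proof (cases "p < 0")
      case True
      have "shift (jet_bracket p q F H) x = - shift (jet_bracket q p H F) x"
        using jet_bracket_skew[OF F H] by simp
      also have "\<dots> = - jet_bracket (q - deg x) p (shift H x) F - jet_bracket q (p - deg x) H (shift F x)"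
        using neg[OF H F True] by simp
      also have "\<dots> = jet_bracket (p - deg x) q (shift F x) H + jet_bracket p (q - deg x) F (shift H x)"
        using jet_bracket_skew[OF F jet_shift[OF H]] jet_bracket_skew[OF jet_shift[OF F] H] by simp
      finally show ?thesis .
    next
      case False
      then show ?thesis using q by (intro jet_bracket_nonneg(2)) simp_all
    qed
  qed
qed

lemma jet_bracket_Nil: "p \<ge> 0 \<Longrightarrow> q \<ge> 0 \<Longrightarrow> jet_bracket p q F H [] = 0"
  by (rule jet_bracket_nonneg(1))

lemma jet_bracket_closed_negative:
  assumes "jet_of_degree p F" "jet_of_degree q H" "q < 0"
  shows "jet_of_degree (p + q) (jet_bracket p q F H)"
  using jet_shift[OF assms(1), of "Inl (fst (H []))"] jet_shift[OF assms(1), of "Inr (snd (H []))"] assms(3) jet_zero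
  by (simp add: jet_bracket_negative(1) bracket_negative_def)

text \<open>The derivation property of \<open>[F, H]\<close> with respect to two letters follows by applying the Leibniz rule
  twice; the mixed terms cancel.\<close>

lemma jet_bracket_closed:
  assumes "jet_of_degree p F" "jet_of_degree q H"
  shows "jet_of_degree (p + q) (jet_bracket p q F H)"
proof -
  have neg: "jet_of_degree (p + q) (jet_bracket p q F H)"
    if "jet_of_degree p F" "jet_of_degree q H" "p < 0 \<or> q < 0" for p q F H
  proof (cases "q < 0")
    case True
    then show ?thesis using jet_bracket_closed_negative that by blast
  next
    case False
    then show ?thesis
      using jet_minus[OF jet_bracket_closed_negative[OF that(2,1)]] jet_bracket_skew[OF that(1,2)] that(3)
      by (simp add: add.commute)
  qed
  have "p + q < int n \<longrightarrow> jet_of_degree p F \<longrightarrow> jet_of_degree q H \<longrightarrow> jet_of_degree (p + q) (jet_bracket p q F H)" for n p q F H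
  proof (induct n arbitrary: p q F H)
    case 0
    then show ?case using neg by force
  next
    case (Suc n)
    show ?case
    proof (intro impI)
      assume n: "p + q < int (Suc n)" and F: "jet_of_degree p F" and H: "jet_of_degree q H"
      show "jet_of_degree (p + q) (jet_bracket p q F H)"
      proof (cases "p < 0 \<or> q < 0")
        case True
        then show ?thesis by (rule neg[OF F H])
      next
        case False
        let ?Z = "jet_bracket p q F H"
        have IH1: "jet_of_degree (p + q - deg x) (jet_bracket (p - deg x) q (shift F x) H)" for x
          using Suc[of "p - deg x" q "shift F x" H] jet_shift[OF F, of x] H n deg_pos[of x]
          by (simp add: algebra_simps)
        have IH2: "jet_of_degree (p + q - deg x) (jet_bracket p (q - deg x) F (shift H x))" for x
          using Suc[of p "q - deg x" F "shift H x"] jet_shift[OF H, of x] F n deg_pos[of x]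
          by (simp add: algebra_simps)
        note sh = jet_bracket_shift
        note Fs = F jet_shift[OF F] jet_shift[OF jet_shift[OF F]]
        note Hs = H jet_shift[OF H] jet_shift[OF jet_shift[OF H]]
        show ?thesis
        proof (rule jet_of_degree.nonneg)
          show "0 \<le> p + q" using False by simp
          show "?Z [] = 0" using False by (intro jet_bracket_Nil) simp_all
          show "jet_of_degree (p + q - deg x) (shift ?Z x)" for x
            unfolding sh[OF F H] by (rule jet_add[OF IH1 IH2])
          show "head_linear ?Z"
            unfolding head_linear_def sh[OF F H]
            using Fs(2)[of "Inr _"] Fs(2)[of "Inl _"] Hs(2)[of "Inr _"] Hs(2)[of "Inl _"]
            by (simp add: shift_linear[OF F] shift_linear[OF H] jet_bracket_add jet_bracket_add_right
                jet_bracket_scale jet_bracket_scale_right F H J.scale_right_distrib add_ac)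
          have two: "shift (shift ?Z x) y =
              jet_bracket (p - deg x - deg y) q (shift (shift F x) y) H
              + jet_bracket (p - deg x) (q - deg y) (shift F x) (shift H y)
              + (jet_bracket (p - deg y) (q - deg x) (shift F y) (shift H x)
              + jet_bracket p (q - deg x - deg y) F (shift (shift H x) y))" for x y
            by (simp add: sh Fs Hs)
          show "head_derivation ?Z"
            unfolding head_derivation_def
          proof (intro conjI allI)
            fix s t
            have "jet_of_degree (p - 2) (shift (shift F (Inr s)) (Inr t))" "jet_of_degree (q - 2) (shift (shift H (Inr s)) (Inr t))" for s t
              using Fs(3)[of "Inr s" "Inr t"] Hs(3)[of "Inr s" "Inr t"] by simp_all
            then show "shift ?Z (Inl (\<omega> s t)) = shift (shift ?Z (Inr s)) (Inr t) - shift (shift ?Z (Inr t)) (Inr s)"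
              unfolding two unfolding sh[OF F H] shift_derivation(1)[OF F] shift_derivation(1)[OF H]
              by (simp add: jet_bracket_diff jet_bracket_diff_right F H)
          next
            fix x v
            show "shift (shift ?Z x) (Inl v) = shift (shift ?Z (Inl v)) x"
              unfolding two shift_derivation(2)[OF F, of x v] shift_derivation(2)[OF H, of x v]
              by (simp add: algebra_simps)
          qed
        qed
      qed
    qed
  qed
  from this[of p q "nat (p + q + 1)" F H] show ?thesis
    using assms neg[OF assms] by (cases "p + q < 0") auto
qed

text \<open>If an argument has negative degree, it can be regarded as a letter, and the identity is the Leibniz
  rule. Otherwise the Jacobi expression vanishes at the empty word, and its bracket with a letter is a
  sum of Jacobi expressions of lower degree.\<close>

lemma jet_bracket_jacobi:
  assumes "jet_of_degree p F" "jet_of_degree q H" "jet_of_degree r K"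
  shows "jet_bracket p (q + r) F (jet_bracket q r H K) + jet_bracket q (r + p) H (jet_bracket r p K F)
    + jet_bracket r (p + q) K (jet_bracket p q F H) = 0"
proof -
  define j where "j p q r (F :: ('v, 'w) jet) H K = jet_bracket p (q + r) F (jet_bracket q r H K) + jet_bracket q (r + p) H (jet_bracket r p K F)
    + jet_bracket r (p + q) K (jet_bracket p q F H)" for p q r F H K
  have cyc: "j p q r F H K = j q r p H K F" for p q r F H K by (simp add: j_def add_ac)
  have br_letter: "jet_bracket p r F K = shift F x" if "r = - deg x" "K = (case x of Inl v \<Rightarrow> embV v | Inr s \<Rightarrow> embW s)" for p r F K x
    using that by (cases x) (simp_all add: jet_bracket_negative(1) bracket_negative_def)
  have neg: "j p q r F H K = 0"
    if F: "jet_of_degree p F" and H: "jet_of_degree q H" and K: "jet_of_degree r K" and r: "r < 0" for p q r F H K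
  proof (cases "r < - 2")
    case True
    then have "K = 0" using jet_low[OF K] by simp
    then show ?thesis using F H jet_bracket_closed[OF F H] by (simp add: j_def)
  next
    case False
    then have "\<exists>x. r = - deg x \<and> K = (case x of Inl v \<Rightarrow> embV v | Inr s \<Rightarrow> embW s)"
    proof -
      have "r = - 2 \<or> r = - 1" using r False by arith
      then show ?thesis
      proof
        assume "r = - 2"
        then obtain v where "K = embV v" using jet_minus_two[of K] K \<open>r = - 2\<close> by blast
        then show ?thesis using \<open>r = - 2\<close> by (intro exI[of _ "Inl v"]) simp
      next
        assume "r = - 1"
        then obtain s where "K = embW s" using jet_minus_one[of K] K \<open>r = - 1\<close> by blast
        then show ?thesis using \<open>r = - 1\<close> by (intro exI[of _ "Inr s"]) simp
      qed
    qed
    then obtain x where x: "r = - deg x" "K = (case x of Inl v \<Rightarrow> embV v | Inr s \<Rightarrow> embW s)" by blast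
    note b = br_letter[OF x]
    have FH: "jet_of_degree (p + q) (jet_bracket p q F H)" by (rule jet_bracket_closed[OF F H])
    have t1: "jet_bracket p (q + r) F (jet_bracket q r H K) = jet_bracket p (q - deg x) F (shift H x)"
      unfolding b by (simp add: x(1))
    have "jet_bracket r p K F = - shift F x" using jet_bracket_skew[OF K F] b[of p F] by simp
    moreover have "jet_bracket q (r + p) H (- shift F x) = jet_bracket (r + p) q (shift F x) H"
      using jet_bracket_skew[OF H, of "r + p" "- shift F x"] jet_bracket_scale[of "r + p" "shift F x" q H "-1"]
        jet_shift[OF F, of x] H jet_minus[of "r + p" "shift F x"] x(1) by simp
    ultimately have t2: "jet_bracket q (r + p) H (jet_bracket r p K F) = jet_bracket (p - deg x) q (shift F x) H"
      by (simp add: x(1))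
    have t3: "jet_bracket r (p + q) K (jet_bracket p q F H) = - shift (jet_bracket p q F H) x"
      using jet_bracket_skew[OF K FH] b[of "p + q" "jet_bracket p q F H"] by simp
    show ?thesis
      unfolding j_def t1 t2 t3 jet_bracket_shift[OF F H] by simp
  qed
  have "j p q r F H K l = 0" if "jet_of_degree p F" "jet_of_degree q H" "jet_of_degree r K" for p q r F H K l
    using that
  proof (induct l arbitrary: p q r F H K)
    case (Nil p q r F H K)
    show ?case
    proof (cases "p < 0 \<or> q < 0 \<or> r < 0")
      case True
      then have "j p q r F H K = 0"
        using neg[OF Nil] neg[OF Nil(2,3,1)] neg[OF Nil(3,1,2)] cyc by metis
      then show ?thesis by simp
    next
      case False
      then show ?thesis by (simp add: j_def)
    qed
  next
    case (Cons x l p q r F H K)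
    note P = Cons.prems
    show ?case
    proof (cases "p < 0 \<or> q < 0 \<or> r < 0")
      case True
      then have "j p q r F H K = 0"
        using neg[OF P] neg[OF P(2,3,1)] neg[OF P(3,1,2)] cyc by metis
      then show ?thesis by simp
    next
      case False
      let ?d = "deg x"
      note S = jet_shift[OF P(1), of x] jet_shift[OF P(2), of x] jet_shift[OF P(3), of x]
      have tri: "shift (jet_bracket p (q + r) F (jet_bracket q r H K)) x
          = jet_bracket (p - ?d) (q + r) (shift F x) (jet_bracket q r H K)
          + (jet_bracket p (q + r - ?d) F (jet_bracket (q - ?d) r (shift H x) K)
          + jet_bracket p (q + r - ?d) F (jet_bracket q (r - ?d) H (shift K x)))"
        if "jet_of_degree p F" "jet_of_degree q H" "jet_of_degree r K" for p q r F H K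
      proof -
        note T = jet_shift[OF that(2), of x] jet_shift[OF that(3), of x]
        have "jet_of_degree (q + r - ?d) (jet_bracket (q - ?d) r (shift H x) K)"
          "jet_of_degree (q + r - ?d) (jet_bracket q (r - ?d) H (shift K x))"
          using jet_bracket_closed[OF T(1) that(3)] jet_bracket_closed[OF that(2) T(2)] by (simp_all add: algebra_simps)
        then show ?thesis
          using that by (simp add: jet_bracket_shift jet_bracket_closed jet_bracket_add_right)
      qed
      have "shift (j p q r F H K) x = j (p - ?d) q r (shift F x) H K + j p (q - ?d) r F (shift H x) K + j p q (r - ?d) F H (shift K x)"
        unfolding j_def shift_add tri[OF P] tri[OF P(2,3,1)] tri[OF P(3,1,2)] by (simp add: algebra_simps)
      then have "j p q r F H K (x # l) = (j (p - ?d) q r (shift F x) H K + j p (q - ?d) r F (shift H x) K + j p q (r - ?d) F H (shift K x)) l"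
        by (simp add: shift_def fun_eq_iff)
      then show ?thesis
        using Cons.hyps[OF S(1) P(2,3)] Cons.hyps[OF P(1) S(2) P(3)] Cons.hyps[OF P(1,2) S(3)] by simp
    qed
  qed
  then have "j p q r F H K = 0" using assms by (simp add: fun_eq_iff)
  then show ?thesis by (simp add: j_def)
qed

sublocale L: lie_components sc "\<lambda>p. {F. jet_of_degree p F}" jet_bracket
proof unfold_locales
  show "(2::'k) \<noteq> 0" by (rule two_nonzero)
  show "J.subspace {F. jet_of_degree p F}" for p by (rule subspace_jet)
qed (simp_all add: jet_bracket_closed jet_bracket_add jet_bracket_scale jet_bracket_jacobi, blast intro: jet_bracket_skew)

lemma jet_transitive:
  assumes F: "jet_of_degree p F" and p: "p \<ge> 0" and z: "\<And>s. shift F (Inr s) = 0"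
  shows "F = 0"
proof (rule jet_eqI)
  show "F [] = 0 []" using jet_Nil[OF F p] by simp
  have span: "shift F (Inl v) = 0" if "v \<in> V.span {\<omega> s t | s t. True}" for v
    using that
  proof (induct rule: V.span_induct_alt)
    case base
    show ?case by (rule shift_zero_letter(2)[OF F])
  next
    case (step a v u)
    then obtain s t where "v = \<omega> s t" by blast
    then have "shift F (Inl v) = 0" by (simp add: shift_derivation(1)[OF F] z)
    then have "shift F (Inl (scaleV a v + u)) = 0" using step(2) by (simp add: shift_linear[OF F])
    then show ?case .
  qed
  have "shift F (Inl v) = 0" for v by (rule span) (subst span_omega, simp)
  then show "shift F x = shift 0 x" for x using z by (cases x) simp_all
qed

end

section \<open>Finite-dimensional subspaces\<close>

context vector_space
begin

lemma finite_dim_mono: "finite_dim scale T \<Longrightarrow> S \<subseteq> T \<Longrightarrow> finite_dim scale S"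
  unfolding finite_dim_def by blast

lemma finite_dim_image_and_kernel:
  assumes S: "subspace S" and L: "Vector_Spaces.linear scale scale L"
    and im: "finite_dim scale (L ` S)" and ker: "finite_dim scale {x\<in>S. L x = 0}"
  shows "finite_dim scale S"
proof -
  interpret L: Vector_Spaces.linear scale scale L by fact
  obtain C where C: "finite C" "L ` S \<subseteq> span C" using im unfolding finite_dim_def by blast
  obtain B where B: "B \<subseteq> L ` S" "independent B" "L ` S \<subseteq> span B"
    by (rule maximal_independent_subset)
  have finB: "finite B" using independent_span_bound[OF C(1) B(2)] B(1) C(2) by blast
  have "\<forall>b\<in>B. \<exists>x. x \<in> S \<and> L x = b" using B(1) by blast
  then obtain g where g: "\<And>b. b \<in> B \<Longrightarrow> g b \<in> S" "\<And>b. b \<in> B \<Longrightarrow> L (g b) = b" by metis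
  obtain K where K: "finite K" "{x\<in>S. L x = 0} \<subseteq> span K" using ker unfolding finite_dim_def by blast
  have "x \<in> span (K \<union> g ` B)" if x: "x \<in> S" for x
  proof -
    have "L x \<in> span B" using x B(3) by blast
    then obtain u where u: "L x = (\<Sum>b\<in>B. scale (u b) b)" unfolding span_finite[OF finB] by blast
    define y where "y = (\<Sum>b\<in>B. scale (u b) (g b))"
    have y: "y \<in> S" unfolding y_def using g S by (intro subspace_sum subspace_scale) simp_all
    have "L y = L x" using g by (simp add: y_def u L.sum L.scale)
    then have "x - y \<in> {x\<in>S. L x = 0}" using x y S by (simp add: subspace_diff L.diff)
    then have "x - y \<in> span K" using K(2) by blast
    then have "x - y \<in> span (K \<union> g ` B)" using span_mono[of K "K \<union> g ` B"] by blast
    moreover have "y \<in> span (K \<union> g ` B)" unfolding y_def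
      by (intro span_sum span_scale span_base) blast
    ultimately have "x - y + y \<in> span (K \<union> g ` B)" by (rule span_add)
    then show ?thesis by simp
  qed
  then show ?thesis unfolding finite_dim_def using K(1) finB by (intro exI[of _ "K \<union> g ` B"]) auto
qed

lemma finite_dim_linear_image:
  assumes L: "Vector_Spaces.linear scale' scale L" and S: "finite_dim scale' S"
  shows "finite_dim scale (L ` S)"
proof -
  interpret L: Vector_Spaces.linear scale' scale L by fact
  obtain B where B: "finite B" "S \<subseteq> L.vs1.span B" using S unfolding finite_dim_def by blast
  have "L ` S \<subseteq> span (L ` B)" unfolding L.span_image using B(2) by blast
  then show ?thesis using B(1) unfolding finite_dim_def by blast
qed

text \<open>A space is finite-dimensional if finitely many operators with finite-dimensional images on it
  separate its points.\<close>

lemma finite_dim_joint_kernel: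
  assumes "finite Ls" "subspace S" "\<And>L. L \<in> Ls \<Longrightarrow> Vector_Spaces.linear scale scale L"
    and "\<And>L. L \<in> Ls \<Longrightarrow> finite_dim scale (L ` S)"
    and "\<And>x. x \<in> S \<Longrightarrow> (\<And>L. L \<in> Ls \<Longrightarrow> L x = 0) \<Longrightarrow> x = 0"
  shows "finite_dim scale S"
  using assms
proof (induct Ls arbitrary: S rule: finite_induct)
  case empty
  then have "S \<subseteq> span {}" by auto
  then show ?case unfolding finite_dim_def by blast
next
  case (insert L Ls)
  interpret L: Vector_Spaces.linear scale scale L using insert.prems(2) by simp
  let ?K = "{x\<in>S. L x = 0}"
  have "finite_dim scale ?K"
  proof (rule insert.hyps(3))
    show "subspace ?K"
      using insert.prems(1) by (auto simp: subspace_def L.add L.scale L.zero)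
    show "Vector_Spaces.linear scale scale M" if "M \<in> Ls" for M using insert.prems(2) that by simp
    show "finite_dim scale (M ` ?K)" if "M \<in> Ls" for M
      by (rule finite_dim_mono[OF insert.prems(3)[of M]]) (use that in auto)
    show "x = 0" if "x \<in> ?K" "\<And>M. M \<in> Ls \<Longrightarrow> M x = 0" for x
      by (rule insert.prems(4)) (use that in auto)
  qed
  then show ?case
    using finite_dim_image_and_kernel[OF insert.prems(1) L.linear_axioms] insert.prems(3) by simp
qed

end

section \<open>Jets as a transitive prolongation\<close>

definition (in two_step) twist :: "('v \<Rightarrow> 'v) \<Rightarrow> ('w \<Rightarrow> 'w) \<Rightarrow> ('v \<Rightarrow> 'v) \<Rightarrow> ('w \<Rightarrow> 'w) \<Rightarrow> ('v, 'w) jet \<Rightarrow> ('v, 'w) jet" where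
  "twist aV aW bV bW F = (\<lambda>l. (aV (fst (F (map (map_sum bV bW) l))), aW (snd (F (map (map_sum bV bW) l)))))"

context two_step
begin

lemma linear_shift: "Vector_Spaces.linear sc sc (\<lambda>F. shift F x)"
  unfolding Vector_Spaces.linear_iff by (simp add: J.vector_space_axioms)

text \<open>A jet of nonnegative degree is determined by its brackets with a finite basis of \<open>V + W\<close>, and these
  have lower degree.\<close>

lemma finite_dim_jets: "finite_dim sc {F. jet_of_degree p F}"
proof -
  obtain BV where BV: "finite BV" "UNIV \<subseteq> V.span BV" using finite_V unfolding finite_dim_def by blast
  obtain BW where BW: "finite BW" "UNIV \<subseteq> W.span BW" using finite_W unfolding finite_dim_def by blast
  have zero: "finite_dim sc {0}" unfolding finite_dim_def by (rule exI[of _ "{}"]) simp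
  have V: "finite_dim sc (range embV)" and W: "finite_dim sc (range embW)"
    by (rule J.finite_dim_linear_image[OF _ finite_V] J.finite_dim_linear_image[OF _ finite_W],
        simp add: Vector_Spaces.linear_iff emb_linear V.vector_space_axioms W.vector_space_axioms J.vector_space_axioms)+
  have neg: "finite_dim sc {F. jet_of_degree p F}" if p: "p < 0" for p
  proof -
    have "p < - 2 \<or> p = - 2 \<or> p = - 1" using p by arith
    then show ?thesis
    proof (elim disjE)
      assume "p < - 2"
      then have "{F. jet_of_degree p F} \<subseteq> {0}" using jet_low[of p] by auto
      then show ?thesis by (rule J.finite_dim_mono[OF zero])
    next
      assume "p = - 2"
      then have "{F. jet_of_degree p F} \<subseteq> range embV" using jet_minus_two by auto
      then show ?thesis by (rule J.finite_dim_mono[OF V])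
    next
      assume "p = - 1"
      then have "{F. jet_of_degree p F} \<subseteq> range embW" using jet_minus_one by auto
      then show ?thesis by (rule J.finite_dim_mono[OF W])
    qed
  qed
  let ?Ls = "(\<lambda>x F. shift F x) ` (Inl ` BV \<union> Inr ` BW)"
  define fin where "fin p \<longleftrightarrow> finite_dim sc {F. jet_of_degree p F}" for p
  have "p < int n \<longrightarrow> fin p" for n p
  proof (induct n arbitrary: p)
    case 0
    show ?case unfolding fin_def using neg by simp
  next
    case (Suc n)
    show ?case
    proof
      assume p: "p < int (Suc n)"
      show "fin p"
      proof (cases "p < 0")
        case True
        then show ?thesis unfolding fin_def by (rule neg)
      next
        case False
        show ?thesis
          unfolding fin_def
        proof (rule J.finite_dim_joint_kernel[where Ls = ?Ls])
          show "finite ?Ls" using BV(1) BW(1) by simp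
          show "J.subspace {F. jet_of_degree p F}" by (rule subspace_jet)
          fix M assume "M \<in> ?Ls"
          then obtain x where M: "M = (\<lambda>F. shift F x)" by blast
          show "Vector_Spaces.linear sc sc M" unfolding M by (rule linear_shift)
          have "fin (p - deg x)"
            using Suc[of "p - deg x"] p deg_pos[of x] by simp
          then show "finite_dim sc (M ` {F. jet_of_degree p F})"
            unfolding fin_def by (rule J.finite_dim_mono) (auto simp: M jet_shift)
        next
          fix F assume "F \<in> {F. jet_of_degree p F}" and z: "\<And>M. M \<in> ?Ls \<Longrightarrow> M F = 0"
          then have F: "jet_of_degree p F" by simp
          have zV: "shift F (Inl v) = 0" if "v \<in> BV" for v using z[of "\<lambda>F. shift F (Inl v)"] that by blast
          have zW: "shift F (Inr s) = 0" if "s \<in> BW" for s using z[of "\<lambda>F. shift F (Inr s)"] that by blast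
          have sV: "shift F (Inl v) = 0" if "v \<in> V.span BV" for v
            using that
          proof (rule V.span_induct_alt)
            show "shift F (Inl 0) = 0" by (rule shift_zero_letter(2)[OF F])
            show "shift F (Inl (scaleV a u + w)) = 0" if "u \<in> BV" "shift F (Inl w) = 0" for a u w
              using that zV by (simp add: shift_linear[OF F])
          qed
          have sW: "shift F (Inr s) = 0" if "s \<in> W.span BW" for s
            using that
          proof (rule W.span_induct_alt)
            show "shift F (Inr 0) = 0" by (rule shift_zero_letter(1)[OF F])
            show "shift F (Inr (scaleW a u + w)) = 0" if "u \<in> BW" "shift F (Inr w) = 0" for a u w
              using that zW by (simp add: shift_linear[OF F])
          qed
          show "F = 0"
          proof (rule jet_eqI)
            show "F [] = 0 []" using jet_Nil[OF F] False by simp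
            have "shift F (Inl v) = 0" "shift F (Inr s) = 0" for v s
              using sV[of v] sW[of s] BV(2) BW(2) by blast+
            then show "shift F x = shift 0 x" for x by (cases x) simp_all
          qed
        qed
      qed
    qed
  qed
  from this[of p "nat (p + 1)"] show ?thesis unfolding fin_def using neg[of p] by (cases "p < 0") auto
qed

definition total_embedding :: "'v \<times> 'w \<Rightarrow> int \<Rightarrow> ('v, 'w) jet" where
  "total_embedding x = homogeneous (- 2) (embV (fst x)) + homogeneous (- 1) (embW (snd x))"

lemma homogeneous_zero [simp]: "homogeneous p 0 = 0"
  by (simp add: homogeneous_def fun_eq_iff)

lemma homogeneous_add: "homogeneous p (x + y) = homogeneous p x + homogeneous p (y :: 'z::ab_group_add)"
  by (simp add: homogeneous_def fun_eq_iff)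

lemma homogeneous_scale: "homogeneous p (sc a F) = fun_scale sc a (homogeneous p F)"
  by (simp add: homogeneous_def fun_eq_iff translation_scale_def zero_prod_def)

lemma homogeneous_eq_0: "homogeneous p x = 0 \<Longrightarrow> x = 0"
  by (drule fun_cong[of _ _ p]) (simp add: homogeneous_def)

lemma jets_transitive_prolongation:
  assumes B: "\<And>x y. br0 x y = (\<omega> (snd x) (snd y), 0)"
  shows "transitive_prolongation (translation_scale scaleV scaleW) translation_gr br0
    (fun_scale sc) L.total_gr (total_bracket jet_bracket)"
  unfolding transitive_prolongation_def
proof (intro conjI allI impI ballI)
  interpret F: vector_space "fun_scale sc :: 'k \<Rightarrow> (int \<Rightarrow> ('v, 'w) jet) \<Rightarrow> int \<Rightarrow> ('v, 'w) jet"
    by (rule vector_space_fun_scale[OF J.vector_space_axioms])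
  show "graded_lie_algebra (fun_scale sc) L.total_gr (total_bracket jet_bracket)"
    by (rule L.total_graded_lie_algebra)
  show "finite_dim (fun_scale sc) (L.total_gr p)" for p
  proof -
    have "Vector_Spaces.linear sc (fun_scale sc) (homogeneous p)"
      by (simp add: Vector_Spaces.linear_iff homogeneous_add homogeneous_scale J.vector_space_axioms F.vector_space_axioms)
    then show ?thesis by (rule F.finite_dim_linear_image[OF _ finite_dim_jets])
  qed
  have jV: "embV v \<in> {F. jet_of_degree (- 2) F}" and jW: "embW s \<in> {F. jet_of_degree (- 1) F}" for v s
    by (simp_all add: jet_of_degree.minus_two jet_of_degree.minus_one)
  have tot: "homogeneous (- 2) (embV v) \<in> L.total" "homogeneous (- 1) (embW s) \<in> L.total" for v s
    using L.homogeneous_total[OF jV] L.homogeneous_total[OF jW] by blast+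
  note tbh = L.total_bracket_homogeneous
  have br: "total_bracket jet_bracket (total_embedding x) (total_embedding y) = total_embedding (br0 x y)" for x y
    unfolding total_embedding_def using tot
    by (simp add: B L.total_bracket_add_left L.total_bracket_add_right L.total_closed tbh[OF jV jV] tbh[OF jV jW] tbh[OF jW jV] tbh[OF jW jW]
        jet_bracket_negative(1) bracket_negative_def)
  have hom: "graded_lie_hom (translation_scale scaleV scaleW) translation_gr br0 (fun_scale sc) L.total_gr
      (total_bracket jet_bracket) total_embedding"
    unfolding graded_lie_hom_def
  proof (intro conjI ballI allI)
    show "total_embedding (x + y) = total_embedding x + total_embedding y" for x y
      by (simp add: total_embedding_def emb_linear homogeneous_add algebra_simps)
    show "total_embedding (translation_scale scaleV scaleW a x) = fun_scale sc a (total_embedding x)" for a x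
      by (simp add: total_embedding_def translation_scale_def emb_linear homogeneous_scale F.scale_right_distrib)
    show "total_embedding (br0 x y) = total_bracket jet_bracket (total_embedding x) (total_embedding y)" for x y
      by (rule br[symmetric])
    show "total_embedding ` translation_gr p \<subseteq> L.total_gr p" for p
      using jV jW jet_zero[of p] by (auto simp: translation_gr_def total_embedding_def intro!: image_eqI[of 0 _ 0])
  qed
  have inj: "inj total_embedding"
  proof (rule injI)
    fix x y assume eq: "total_embedding x = total_embedding y"
    have "embV (fst x) = embV (fst y)" using fun_cong[OF eq, of "- 2"] by (simp add: total_embedding_def homogeneous_def)
    then have "fst x = fst y" using emb_Nil(1) by (metis fst_conv)
    moreover have "embW (snd x) = embW (snd y)" using fun_cong[OF eq, of "- 1"] by (simp add: total_embedding_def homogeneous_def)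
    then have "snd x = snd y" using emb_Nil(2) by (metis snd_conv)
    ultimately show "x = y" by (simp add: prod_eq_iff)
  qed
  have im: "total_embedding ` translation_gr p = L.total_gr p" if p: "p < 0" for p
  proof
    show "total_embedding ` translation_gr p \<subseteq> L.total_gr p" using hom unfolding graded_lie_hom_def by blast
    show "L.total_gr p \<subseteq> total_embedding ` translation_gr p"
    proof
      fix G assume "G \<in> L.total_gr p"
      then obtain F where F: "G = homogeneous p F" "jet_of_degree p F" by blast
      have "p < - 2 \<or> p = - 2 \<or> p = - 1" using p by arith
      then show "G \<in> total_embedding ` translation_gr p"
      proof (elim disjE)
        assume "p < - 2"
        then show ?thesis using jet_low[OF F(2)] F(1)
          by (intro image_eqI[of _ _ 0]) (simp_all add: total_embedding_def translation_gr_def)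
      next
        assume p: "p = - 2"
        then obtain v where "F = embV v" using jet_minus_two F(2) by blast
        then show ?thesis using F(1) p
          by (intro image_eqI[of _ _ "(v, 0)"]) (simp_all add: total_embedding_def translation_gr_def)
      next
        assume p: "p = - 1"
        then obtain s where "F = embW s" using jet_minus_one F(2) by blast
        then show ?thesis using F(1) p
          by (intro image_eqI[of _ _ "(0, s)"]) (simp_all add: total_embedding_def translation_gr_def)
      qed
    qed
  qed
  show "\<exists>j. graded_lie_hom (translation_scale scaleV scaleW) translation_gr br0 (fun_scale sc) L.total_gr
      (total_bracket jet_bracket) j \<and> inj_on j (graded_carrier (translation_scale scaleV scaleW) translation_gr) \<and>
      (\<forall>p<0. j ` translation_gr p = L.total_gr p)"
    using hom inj im inj_on_subset[OF inj subset_UNIV] by blast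
  fix p :: int and x assume p: "0 \<le> p" and x: "x \<in> L.total_gr p"
    and z: "\<forall>y\<in>L.total_gr (- 1). total_bracket jet_bracket x y = 0"
  obtain F where F: "x = homogeneous p F" "jet_of_degree p F" using x by blast
  have "shift F (Inr s) = 0" for s
  proof -
    have "total_bracket jet_bracket x (homogeneous (- 1) (embW s)) = 0" using z jW by blast
    then have "homogeneous (p + - 1) (jet_bracket p (- 1) F (embW s)) = 0"
      using tbh[of F p "embW s" "- 1"] F jW by simp
    then have "jet_bracket p (- 1) F (embW s) = 0" by (rule homogeneous_eq_0)
    then show ?thesis by (simp add: jet_bracket_negative(1) bracket_negative_def)
  qed
  then have "F = 0" by (rule jet_transitive[OF F(2) p])
  then show "x = 0" using F(1) by simp
qed

text \<open>An automorphism \<open>a\<close> of \<open>V + W\<close> acts on the full prolongation: transport the letters back with its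
  inverse \<open>b\<close> and the values forward with \<open>a\<close>.\<close>

lemma twist_jet:
  assumes aV: "\<And>u v. aV (u + v) = aV u + aV v" "\<And>a v. aV (scaleV a v) = scaleV a (aV v)"
    and aW: "\<And>s t. aW (s + t) = aW s + aW t" "\<And>a s. aW (scaleW a s) = scaleW a (aW s)"
    and bV: "\<And>u v. bV (u + v) = bV u + bV v" "\<And>a v. bV (scaleV a v) = scaleV a (bV v)"
    and bW: "\<And>s t. bW (s + t) = bW s + bW t" "\<And>a s. bW (scaleW a s) = scaleW a (bW s)"
    and a_omega: "\<And>s t. aV (\<omega> s t) = \<omega> (aW s) (aW t)" and b_omega: "\<And>s t. bV (\<omega> s t) = \<omega> (bW s) (bW t)"
    and inverse: "\<And>s. aW (bW s) = s"
    and F: "jet_of_degree p F"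
  shows "jet_of_degree p (twist aV aW bV bW F)"
proof -
  let ?t = "twist aV aW bV bW"
  have a0: "aV 0 = 0" "aW 0 = 0" using aV(2)[of 0 0] aW(2)[of 0 0] by simp_all
  have am: "aV (u - v) = aV u - aV v" "aW (s - t) = aW s - aW t" for u v s t
    using aV(1)[of "u - v" v] aW(1)[of "s - t" t] by (simp_all add: eq_diff_eq)
  have shift_t: "shift (?t F) x = ?t (shift F (map_sum bV bW x))" for F x
    by (simp add: shift_def twist_def)
  have t_lin: "?t (F + H) = ?t F + ?t H" "?t (F - H) = ?t F - ?t H" "?t (sc a F) = sc a (?t F)" "?t 0 = 0" for F H a
    by (simp_all add: twist_def fun_eq_iff aV aW am a0 translation_scale_def zero_prod_def)
  have tV: "?t (embV v) = embV (aV v)" for v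
    by (rule jet_eqI) (simp_all add: shift_t t_lin, simp add: twist_def a0)
  have tW: "?t (embW s) = embW (aW s)" for s
  proof (rule jet_eqI)
    show "shift (?t (embW s)) x = shift (embW (aW s)) x" for x
      by (cases x) (simp_all add: shift_t t_lin tV a_omega inverse)
  qed (simp add: twist_def a0)
  show ?thesis using F
  proof (induct rule: jet_of_degree.induct)
    case (low p)
    have "jet_of_degree p (?t 0)" unfolding t_lin by (rule jet_zero)
    then show ?case .
  next
    case (minus_two v)
    have "jet_of_degree (- 2) (?t (embV v))" unfolding tV by (rule jet_of_degree.minus_two)
    then show ?case .
  next
    case (minus_one s)
    have "jet_of_degree (- 1) (?t (embW s))" unfolding tW by (rule jet_of_degree.minus_one)
    then show ?case .
  next
    case (nonneg p F)
    have deg: "deg (map_sum bV bW x) = deg x" for x by (cases x) simp_all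
    have "jet_of_degree p (?t F)"
    proof (rule jet_of_degree.nonneg[OF nonneg(1)])
      show "?t F [] = 0" using nonneg(2) by (simp add: twist_def a0 zero_prod_def)
      show "jet_of_degree (p - deg x) (shift (?t F) x)" for x
        using nonneg(4)[of "map_sum bV bW x"] by (simp add: shift_t deg)
      show "head_linear (?t F)"
        using nonneg(5) by (simp add: head_linear_def shift_t t_lin[symmetric] bV bW)
      have "shift (shift F x) (Inl v) = shift (shift F (Inl v)) x" for x v
        using nonneg(6) by (simp add: head_derivation_def)
      then show "head_derivation (?t F)"
        using nonneg(6) by (simp add: head_derivation_def shift_t t_lin[symmetric] b_omega)
    qed
    then show ?case .
  qed
qed

end

section \<open>Maximal prolongations\<close>

text \<open>Maximality enters only as the existence of an embedding of the full prolongation.\<close>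

locale maximal_translation_prolongation =
  translation_prolongation scaleV scaleW form c \<beta> \<epsilon> \<omega> scale gr bracket jV jW + T: two_step scaleV scaleW \<omega>
  for scaleV :: "'k::field \<Rightarrow> 'v::ab_group_add \<Rightarrow> 'v" and scaleW :: "'k \<Rightarrow> 'w::ab_group_add \<Rightarrow> 'w"
    and form c \<beta> \<epsilon> \<omega>
    and scale :: "'k \<Rightarrow> 'g::ab_group_add \<Rightarrow> 'g" and gr bracket jV jW +
  assumes jets_embed: "\<exists>f. graded_lie_hom (fun_scale T.sc) T.L.total_gr (total_bracket jet_bracket) scale gr bracket f \<and>
      inj_on f (graded_carrier (fun_scale T.sc) T.L.total_gr)"
    and irreducible: "\<lbrakk>W.subspace U; \<And>v s. s \<in> U \<Longrightarrow> c v s \<in> U\<rbrakk> \<Longrightarrow> U = {0} \<or> U = UNIV"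
begin

definition letter_element :: "'v + 'w \<Rightarrow> 'g" where
  "letter_element x = (case x of Inl v \<Rightarrow> jV v | Inr s \<Rightarrow> jW s)"

lemma letter_element_simps [simp]: "letter_element (Inl v) = jV v" "letter_element (Inr s) = jW s"
  by (simp_all add: letter_element_def)

lemma letter_element_gr: "letter_element x \<in> gr (- deg x)"
  by (cases x) (simp_all add: jV_gr jW_gr)

lemma letter_element_L [simp]: "letter_element x \<in> L"
  using letter_element_gr by (rule G.gr_in_carrier)

fun jet_of :: "int \<Rightarrow> 'g \<Rightarrow> ('v, 'w) jet" where
  "jet_of p x [] = (if p = - 2 then (inv_into UNIV jV x, 0) else if p = - 1 then (0, inv_into UNIV jW x) else 0)"
| "jet_of p x (y # l) = jet_of (p - deg y) (bracket x (letter_element y)) l"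

lemma shift_jet_of: "shift (jet_of p x) y = jet_of (p - deg y) (bracket x (letter_element y))"
  by (simp add: shift_def fun_eq_iff)

lemma inv_jV [simp]: "inv_into UNIV jV (jV v) = v" and inv_jW [simp]: "inv_into UNIV jW (jW s) = s"
  by (auto intro!: inv_f_f injI)

lemma bracket_letter_gr:
  assumes "x \<in> gr p"
  shows "bracket x (letter_element y) \<in> gr (p - deg y)"
  using G.bracket_gr[OF assms letter_element_gr, of y] by simp

lemma jet_of_combination:
  assumes "x \<in> gr p" "y \<in> gr p"
  shows "jet_of p (x + scale a y) = jet_of p x + T.sc a (jet_of p y)"
proof
  fix l
  show "jet_of p (x + scale a y) l = (jet_of p x + T.sc a (jet_of p y)) l"
    using assms
  proof (induct l arbitrary: p x y)
    case (Nil p x y)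
    consider "p = - 2" | "p = - 1" | "p \<noteq> - 2" "p \<noteq> - 1" by blast
    then have "jet_of p (x + scale a y) [] = (jet_of p x + T.sc a (jet_of p y)) []"
    proof cases
      case 1
      then obtain u v where "x = jV u" "y = jV v" using Nil gr_V by blast
      then have "x + scale a y = jV (u + scaleV a v)" "x = jV u" "y = jV v" by (simp_all add: jV_add jV_scale)
      then show ?thesis using 1 by (simp add: translation_scale_def)
    next
      case 2
      then obtain u v where "x = jW u" "y = jW v" using Nil gr_W by blast
      then have "x + scale a y = jW (u + scaleW a v)" "x = jW u" "y = jW v" by (simp_all add: jW_add jW_scale)
      then show ?thesis using 2 by (simp add: translation_scale_def)
    next
      case 3
      then show ?thesis by (simp add: translation_scale_def zero_prod_def)
    qed
    then show ?case .
  next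
    case (Cons z l p x y)
    have L: "x \<in> L" "y \<in> L" using Cons.prems G.gr_in_carrier by blast+
    have "bracket (x + scale a y) (letter_element z)
        = bracket x (letter_element z) + scale a (bracket y (letter_element z))"
      using L by (simp add: G.bracket_add_left G.bracket_scale_left G.subspace_scale[OF G.subspace_L])
    then have "jet_of p (x + scale a y) (z # l) = (jet_of p x + T.sc a (jet_of p y)) (z # l)"
      using Cons.hyps[OF bracket_letter_gr[OF Cons.prems(1), of z] bracket_letter_gr[OF Cons.prems(2), of z]] by simp
    then show ?case .
  qed
qed

lemma jet_of_zero [simp]: "jet_of p 0 = 0"
  using jet_of_combination[of 0 p 0 "-1"] by (simp add: G.subspace_0 G.subspace_gr)

lemma jet_of_add: "x \<in> gr p \<Longrightarrow> y \<in> gr p \<Longrightarrow> jet_of p (x + y) = jet_of p x + jet_of p y"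
  using jet_of_combination[of x p y 1] by simp

lemma jet_of_diff: "x \<in> gr p \<Longrightarrow> y \<in> gr p \<Longrightarrow> jet_of p (x - y) = jet_of p x - jet_of p y"
  using jet_of_combination[of x p y "-1"] by simp

lemma jet_of_scale: "x \<in> gr p \<Longrightarrow> jet_of p (scale a x) = T.sc a (jet_of p x)"
  using jet_of_combination[of 0 p x a] by (simp add: G.subspace_0 G.subspace_gr)

lemmas jet_of_linear = jet_of_add jet_of_diff jet_of_scale

lemma jet_of_jV: "jet_of (- 2) (jV v) = T.embV v"
  by (rule jet_eqI) (simp, simp only: shift_jet_of T.shift_emb, metis bracket_jV(1,2) jet_of_zero letter_element_simps sum.exhaust)

lemma jet_of_jW: "jet_of (- 1) (jW s) = T.embW s"
proof (rule jet_eqI)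
  show "shift (jet_of (- 1) (jW s)) x = shift (T.embW s) x" for x
    by (cases x) (simp_all add: shift_jet_of bracket_jW jet_of_jV)
qed simp

lemma jet_of_degree_jet_of:
  assumes "x \<in> gr p"
  shows "T.jet_of_degree p (jet_of p x)"
proof -
  have neg: "T.jet_of_degree p (jet_of p x)" if x: "x \<in> gr p" and p: "p < 0" for x p
  proof -
    have "p < - 2 \<or> p = - 2 \<or> p = - 1" using p by arith
    then show ?thesis
    proof (elim disjE)
      assume "p < - 2"
      then show ?thesis using x gr_low[of p] T.jet_zero by simp
    next
      assume p: "p = - 2"
      then obtain v where "x = jV v" using x gr_V by blast
      then show ?thesis using p T.jet_of_degree.minus_two by (simp add: jet_of_jV)
    next
      assume p: "p = - 1"
      then obtain v where "x = jW v" using x gr_W by blast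
      then show ?thesis using p T.jet_of_degree.minus_one by (simp add: jet_of_jW)
    qed
  qed
  have "p < int n \<longrightarrow> x \<in> gr p \<longrightarrow> T.jet_of_degree p (jet_of p x)" for n p x
  proof (induct n arbitrary: p x)
    case 0
    show ?case using neg by simp
  next
    case (Suc n)
    show ?case
    proof (intro impI)
      assume p: "p < int (Suc n)" and x: "x \<in> gr p"
      show "T.jet_of_degree p (jet_of p x)"
      proof (cases "p < 0")
        case True
        then show ?thesis by (rule neg[OF x])
      next
        case False
        have xL: "x \<in> L" using x by (rule G.gr_in_carrier)
        have xW: "bracket x (jW s) \<in> gr (p - 1)" and xV: "bracket x (jV v) \<in> gr (p - 2)" for s v
          using bracket_letter_gr[OF x, of "Inr s"] bracket_letter_gr[OF x, of "Inl v"] by simp_all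
        have xWW: "bracket (bracket x (jW s)) (jW t) \<in> gr (p - 2)" for s t
          using bracket_letter_gr[OF xW, of s "Inr t"] by simp
        show ?thesis
        proof (rule T.jet_of_degree.nonneg)
          show "0 \<le> p" "jet_of p x [] = 0" using False by simp_all
          show "T.jet_of_degree (p - deg y) (shift (jet_of p x) y)" for y
            unfolding shift_jet_of
            using Suc[of "p - deg y"] bracket_letter_gr[OF x, of y] p deg_pos[of y] by simp
          show "T.head_linear (jet_of p x)"
            unfolding T.head_linear_def shift_jet_of
            using xW xV xL by (simp add: jV_add jW_add jV_scale jW_scale G.bracket_add_right G.bracket_scale_right jet_of_linear)
          show "T.head_derivation (jet_of p x)"
            unfolding T.head_derivation_def shift_jet_of
          proof (intro conjI allI)
            show "jet_of (p - deg (Inl (\<omega> s t))) (bracket x (letter_element (Inl (\<omega> s t)))) =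
                jet_of (p - deg (Inr s) - deg (Inr t)) (bracket (bracket x (letter_element (Inr s))) (letter_element (Inr t))) -
                jet_of (p - deg (Inr t) - deg (Inr s)) (bracket (bracket x (letter_element (Inr t))) (letter_element (Inr s)))" for s t
              using xWW by (simp add: bracket_omega[OF xL] jet_of_linear)
            show "jet_of (p - deg y - deg (Inl v)) (bracket (bracket x (letter_element y)) (letter_element (Inl v))) =
                jet_of (p - deg (Inl v) - deg y) (bracket (bracket x (letter_element (Inl v))) (letter_element y))" for y v
              by (cases y) (simp_all add: bracket_bracket_jV_commute[OF xL])
          qed
        qed
      qed
    qed
  qed
  from this[of p "nat (p + 1)" x] show ?thesis using neg[OF assms] assms by (cases "p < 0") auto
qed

text \<open>This is transitivity.\<close>

lemma jet_of_injective:
  assumes "x \<in> gr (int n - 2)" "jet_of (int n - 2) x = 0"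
  shows "x = 0"
  using assms
proof (induct n arbitrary: x)
  case 0
  then obtain v where v: "x = jV v" using gr_V by auto
  have "T.embV v = 0" using 0 by (simp add: v jet_of_jV)
  then have "v = 0" by (rule T.emb_inj(1))
  then show ?case using v by simp
next
  case (Suc n)
  show ?case
  proof (cases n)
    case 0
    then obtain s where s: "x = jW s" using Suc.prems gr_W by auto
    have "T.embW s = 0" using Suc.prems 0 by (simp add: s jet_of_jW)
    then have "s = 0" by (rule T.emb_inj(2))
    then show ?thesis using s by simp
  next
    case (Suc m)
    have "bracket x (jW s) = 0" for s
    proof (rule Suc.hyps)
      show "bracket x (jW s) \<in> gr (int n - 2)" using bracket_letter_gr[OF Suc.prems(1), of "Inr s"] by simp
      have "shift (jet_of (int (Suc n) - 2) x) (Inr s) = 0" using Suc.prems(2) by simp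
      then show "jet_of (int n - 2) (bracket x (jW s)) = 0" by (simp add: shift_jet_of)
    qed
    then show ?thesis using transitive[OF _ Suc.prems(1)] \<open>n = Suc m\<close> by simp
  qed
qed

text \<open>The embedding of the full prolongation into \<open>g\<close> need not be compatible with the identification of the
  negative parts. But composing it with \<open>jet_of\<close> gives an injective endomorphism of the
  finite-dimensional space of jets of degree \<open>p\<close>, so \<open>jet_of\<close> is onto.\<close>

lemma jet_of_surjective:
  assumes F: "T.jet_of_degree p F" and p: "p \<ge> - 2"
  shows "\<exists>x\<in>gr p. jet_of p x = F"
proof -
  interpret TF: vector_space "fun_scale T.sc :: 'k \<Rightarrow> (int \<Rightarrow> ('v, 'w) jet) \<Rightarrow> int \<Rightarrow> ('v, 'w) jet"
    by (rule vector_space_fun_scale[OF T.J.vector_space_axioms])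
  obtain f where f: "graded_lie_hom (fun_scale T.sc) T.L.total_gr (total_bracket jet_bracket) scale gr bracket f"
    and inj: "inj_on f (graded_carrier (fun_scale T.sc) T.L.total_gr)" using jets_embed by blast
  note tot = T.L.graded_carrier_total
  have f_add: "f (x + y) = f x + f y" if "x \<in> T.L.total" "y \<in> T.L.total" for x y
    using f that unfolding graded_lie_hom_def tot by blast
  have f_scale: "f (fun_scale T.sc a x) = scale a (f x)" if "x \<in> T.L.total" for x a
    using f that unfolding graded_lie_hom_def tot by blast
  let ?S = "{F. T.jet_of_degree p F}"
  have hom: "homogeneous p F \<in> T.L.total" if "F \<in> ?S" for F using that by (rule T.L.homogeneous_total)
  have fgr: "f (homogeneous p F) \<in> gr p" if "F \<in> ?S" for F
    using f that unfolding graded_lie_hom_def by blast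
  define h where "h F = jet_of p (f (homogeneous p F))" for F
  obtain C where C: "finite C" "?S \<subseteq> T.J.span C" using T.finite_dim_jets unfolding finite_dim_def by blast
  obtain B where B: "B \<subseteq> ?S" "T.J.independent B" "?S \<subseteq> T.J.span B"
    by (rule T.J.maximal_independent_subset)
  have finB: "finite B" using T.J.independent_span_bound[OF C(1) B(2)] B(1) C(2) by blast
  have spB: "T.J.span B = ?S" using B T.subspace_jet by (intro T.J.span_subspace)
  have endo: "endo_on T.sc (T.J.span B) h"
    unfolding endo_on_def spB
  proof (intro conjI ballI allI)
    show "h (F + H) = h F + h H" if "F \<in> ?S" "H \<in> ?S" for F H
      using that fgr[OF that(1)] fgr[OF that(2)] hom
      by (simp add: h_def T.homogeneous_add f_add jet_of_linear)
    show "h (T.sc a F) = T.sc a (h F)" if "F \<in> ?S" for F a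
      using that fgr[OF that] hom by (simp add: h_def T.homogeneous_scale f_scale jet_of_linear)
    show "h ` ?S \<subseteq> ?S" using fgr jet_of_degree_jet_of by (auto simp: h_def)
  qed
  have ker: "F = 0" if F: "F \<in> T.J.span B" "h F = 0" for F
  proof -
    have FS: "F \<in> ?S" using F(1) spB by simp
    obtain n where n: "p = int n - 2" by (rule that[of "nat (p + 2)"]) (use p in simp)
    have "f (homogeneous p F) = 0"
      by (rule jet_of_injective[of _ n]) (use fgr[OF FS] F(2) in \<open>simp_all add: n[symmetric] h_def\<close>)
    moreover have "f 0 = 0" using f_scale[of 0 0] hom[of 0] T.jet_zero by simp
    ultimately have "homogeneous p F = 0"
      using inj_onD[OF inj, of "homogeneous p F" 0] hom[OF FS] TF.subspace_0[OF T.L.subspace_total] unfolding tot by simp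
    then show "F = 0" by (rule T.homogeneous_eq_0)
  qed
  have "F \<in> h ` ?S"
    using T.J.endo_on_injective_surjective[OF B(2) finB endo ker] F unfolding spB by simp
  then show ?thesis using fgr unfolding h_def by blast
qed

text \<open>For non-null \<open>e\<close> with \<open>q = (e, e)\<close>, the map \<open>s \<mapsto> e s\<close> on \<open>W\<close> together with \<open>\<epsilon> q\<close> times the reflection in
  \<open>e\<close> on \<open>V\<close> is an automorphism of \<open>V + W\<close>. It acts on the full prolongation, which by maximality is \<open>g\<close>, and
  it carries the element of degree 1 with spinor \<open>s\<close> to the one with spinor \<open>- (\<epsilon> / q) e s\<close>.\<close>

lemma spinors_closed:
  assumes s: "s \<in> spinors" and e: "form e e \<noteq> 0"
  shows "c e s \<in> spinors"
proof -
  define q where "q = form e e"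
  have q: "q \<noteq> 0" using e by (simp add: q_def)
  have ce: "c e (c e t) = scaleW (- q) t" for t by (simp add: c_c q_def)
  obtain x where x: "x \<in> gr 1" "\<And>v. bracket x (jV v) = jW (c v s)" using s unfolding spinors_def by blast
  \<comment> \<open>Because of \<open>e e = - q\<close>, the inverses \<open>bV\<close> and \<open>bW\<close> are multiples of \<open>aV\<close> and \<open>aW\<close>.\<close>
  define aV where "aV v = scaleV \<epsilon> (scaleV q v - scaleV (2 * form e v) e)" for v
  define aW where "aW t = c e t" for t
  define bV where "bV v = scaleV (1 / q ^ 2) (aV v)" for v
  define bW where "bW t = scaleW (- 1 / q) (c e t)" for t
  have aV: "aV (u + v) = aV u + aV v" "aV (scaleV a v) = scaleV a (aV v)" for u v a
    by (simp_all add: aV_def form_add_right form_scale_right algebra_simps V.scale_right_distrib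
        V.scale_left_distrib V.scale_right_diff_distrib)
  have a_omega: "aV (\<omega> r t) = \<omega> (aW r) (aW t)" for r t
  proof (rule form_eqI)
    fix w
    have "c e (c w (c e r)) + c e (c w (c e r)) = c (scaleV (2 * q) w - scaleV (2 * form e w) e - scaleV (2 * form e w) e) r"
      using c_three[of e w e r] by (simp add: q_def)
    then have "\<beta> (c e (c w (c e r)) + c e (c w (c e r))) t = 2 * (q * \<beta> (c w r) t - 2 * form e w * \<beta> (c e r) t)"
      by (simp only: c_diff c_scale_left beta_diff beta_scale) (simp add: algebra_simps)
    then have "2 * \<beta> (c e (c w (c e r))) t = 2 * (q * \<beta> (c w r) t - 2 * form e w * \<beta> (c e r) t)"
      by (simp only: beta_add mult_2)
    then have 1: "\<beta> (c e (c w (c e r))) t = q * \<beta> (c w r) t - 2 * form e w * \<beta> (c e r) t"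
      using two_nonzero by (simp only: mult_cancel_left) simp
    have 2: "form (\<omega> (aW r) (aW t)) w = \<epsilon> * \<beta> (c e (c w (c e r))) t"
      by (simp add: form_omega aW_def beta_c[of e] mult.assoc[symmetric] epsilon_sq)
    show "form (aV (\<omega> r t)) w = form (\<omega> (aW r) (aW t)) w"
      unfolding 2 1
      by (simp add: aV_def form_scale form_diff form_omega form_sym[of e "\<omega> r t"] algebra_simps)
  qed
  have b_omega: "bV (\<omega> r t) = \<omega> (bW r) (bW t)" for r t
  proof -
    have "\<omega> (bW r) (bW t) = scaleV (1 / q ^ 2) (\<omega> (aW r) (aW t))"
      unfolding bW_def aW_def omega_scale by (simp add: power2_eq_square)
    then show ?thesis by (simp add: bV_def a_omega)
  qed
  define F where "F = T.twist aV aW bV bW (jet_of 1 x)"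
  have "T.jet_of_degree 1 F"
    unfolding F_def
  proof (rule T.twist_jet)
    show "aV (u + v) = aV u + aV v" "aV (scaleV a v) = scaleV a (aV v)" for u v a by (rule aV)+
    show "aW (r + t) = aW r + aW t" "aW (scaleW a t) = scaleW a (aW t)" for r t a
      by (simp_all add: aW_def c_add c_scale)
    show "bV (u + v) = bV u + bV v" "bV (scaleV a v) = scaleV a (bV v)" for u v a
      by (simp_all add: bV_def aV V.scale_right_distrib)
    show "bW (r + t) = bW r + bW t" "bW (scaleW a t) = scaleW a (bW t)" for r t a
      by (simp_all add: bW_def c_add c_scale W.scale_right_distrib)
    show "aV (\<omega> r t) = \<omega> (aW r) (aW t)" "bV (\<omega> r t) = \<omega> (bW r) (bW t)" for r t
      by (rule a_omega, rule b_omega)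
    show "aW (bW t) = t" for t using q by (simp add: aW_def bW_def c_scale c_minus ce)
    show "T.jet_of_degree 1 (jet_of 1 x)" by (rule jet_of_degree_jet_of[OF x(1)])
  qed
  then obtain y where y: "y \<in> gr 1" "jet_of 1 y = F" using jet_of_surjective[of 1 F] by auto
  have "bracket y (jV v) = jW (c v (scaleW (- \<epsilon> / q) (c e s)))" for v
  proof -
    have "bracket y (jV v) \<in> gr (- 1)" using bracket_letter_gr[OF y(1), of "Inl v"] by simp
    then obtain t where t: "bracket y (jV v) = jW t" using gr_W by blast
    have "t = snd (jet_of 1 y [Inl v])" by (simp add: t)
    also have "\<dots> = c e (c (bV v) s)" by (simp add: y(2) F_def T.twist_def x(2) aW_def)
    also have "\<dots> = scaleW (\<epsilon> / q) (c e (c v s) + scaleW (2 * form e v) s)"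
      using q by (simp add: bV_def aV_def c_scale_left c_diff c_scale ce W.scale_right_diff_distrib W.scale_right_distrib
          power2_eq_square mult_ac)
    also have "c e (c v s) + scaleW (2 * form e v) s = - c v (c e s)"
      using c_swap[of e v s] by simp
    finally show ?thesis by (simp add: t c_scale c_minus)
  qed
  then have "scaleW (- \<epsilon> / q) (c e s) \<in> spinors" using y(1) unfolding spinors_def by blast
  then have "scaleW (- \<epsilon> * q) (scaleW (- \<epsilon> / q) (c e s)) \<in> spinors" by (rule W.subspace_scale[OF subspace_spinors])
  then show ?thesis using q epsilon_sq by simp
qed

text \<open>Null vectors \<open>v\<close> are covered as well, because \<open>v + e\<close> or \<open>v - e\<close> is non-null for a non-null \<open>e\<close>. So the
  spinors form a Clifford submodule.\<close>

lemma simple_if_positive_part: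
  assumes p: "p \<ge> 1" "gr p \<noteq> {0}"
  shows "simple_lie_algebra scale L bracket"
proof -
  have "c v s \<in> spinors" if s: "s \<in> spinors" for v s
  proof (cases "form v v = 0")
    case False
    then show ?thesis by (rule spinors_closed[OF s])
  next
    case True
    obtain e where e: "form e e \<noteq> 0" using orthogonal_triple by blast
    have "form (v + e) (v + e) \<noteq> 0 \<or> form (v - e) (v - e) \<noteq> 0"
    proof (rule ccontr)
      assume "\<not> ?thesis"
      then have "form (v + e) (v + e) + form (v - e) (v - e) = 0" by simp
      then have "2 * form e e = 0"
        using True by (simp add: form_add form_add_right form_diff algebra_simps)
      then show False using e two_nonzero by simp
    qed
    then have "c (v + e) s \<in> spinors \<or> c (v - e) s \<in> spinors" using spinors_closed[OF s] by blast
    moreover have "c v s = c (v + e) s - c e s" "c v s = c (v - e) s + c e s"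
      by (simp_all add: c_add_left c_diff)
    ultimately show ?thesis
      using spinors_closed[OF s e] W.subspace_diff[OF subspace_spinors] W.subspace_add[OF subspace_spinors] by metis
  qed
  then have "spinors = {0} \<or> spinors = UNIV" by (intro irreducible subspace_spinors)
  then interpret full_translation_prolongation scaleV scaleW form c \<beta> \<epsilon> \<omega> scale gr bracket jV jW
    by unfold_locales (use spinors_nonzero[OF p] in blast)
  show ?thesis by (rule simple)
qed

end

section \<open>Extended translation algebras\<close>

lemma isomorphic_to_char_0:
  assumes iso: "(ring_of_type_algebra :: 'k::field ring) \<simeq> (ring_of_type_algebra :: 'r::field_char_0 ring)"
    and n: "n > 0"
  shows "of_nat n \<noteq> (0::'k)"
proof
  obtain h where h: "h \<in> ring_hom (ring_of_type_algebra :: 'k ring) (ring_of_type_algebra :: 'r ring)"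
    using iso unfolding is_ring_iso_def ring_iso_def by blast
  have add: "h (a + b) = h a + h b" and one: "h 1 = 1" for a b
    using ring_hom_add[OF h] ring_hom_one[OF h] by (simp_all add: ring_of_type_algebra_def)
  have zero: "h 0 = 0" using add[of 0 0] by simp
  have "h (of_nat m) = of_nat m" for m by (induct m) (simp_all add: add one zero)
  then have "h (of_nat n) = of_nat n" .
  moreover assume "of_nat n = (0::'k)"
  ultimately have "of_nat n = (0::'r)" using zero by simp
  then show False using n by simp
qed

lemma real_or_complex_char_0:
  assumes "real_or_complex TYPE('k::field)" and n: "n > 0"
  shows "of_nat n \<noteq> (0::'k)"
  using assms(1) isomorphic_to_char_0[OF _ n, where 'k = 'k and 'r = real]
    isomorphic_to_char_0[OF _ n, where 'k = 'k and 'r = complex]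
  unfolding real_or_complex_def by blast

lemma clifford_class_carrier: "clifford_class scaleV form x \<in> carrier (clifford_algebra scaleV form)"
  using ring_hom_closed[OF clifford_class_hom[of scaleV form], of x] by (simp add: ring_of_type_algebra_def)

lemma clifford_carrier_class:
  assumes "a \<in> carrier (clifford_algebra scaleV form)"
  obtains x where "a = clifford_class scaleV form x"
  using assms unfolding clifford_algebra_def clifford_class_def FactRing_def A_RCOSETS_def' by auto

lemma clifford_class_add: "clifford_class scaleV form (x + y) =
    clifford_class scaleV form x \<oplus>\<^bsub>clifford_algebra scaleV form\<^esub> clifford_class scaleV form y"
  and clifford_class_mult: "clifford_class scaleV form (x * y) =
    clifford_class scaleV form x \<otimes>\<^bsub>clifford_algebra scaleV form\<^esub> clifford_class scaleV form y"
  using ring_hom_add[OF clifford_class_hom[of scaleV form], of x y] ring_hom_mult[OF clifford_class_hom[of scaleV form], of x y]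
  by (simp_all add: ring_of_type_algebra_def)

context clifford_module
begin

definition vact :: "'v \<Rightarrow> 'w \<Rightarrow> 'w" where
  "vact v s = act (clifford_vector scaleV form v) s"

lemma vact_simps:
  "vact (u + v) s = vact u s + vact v s"
  "vact (scaleV a v) s = scaleW a (vact v s)"
  "vact v (s + t) = vact v s + vact v t"
  "vact v (scaleW a s) = scaleW a (vact v s)"
  "vact v (vact u s) + vact u (vact v s) = scaleW (- 2 * form v u) s"
proof -
  note c = clifford_class_carrier[of scaleV form]
  note d = clifford_vector_def clifford_scalar_def
  have gen: "x \<in> clifford_ideal scaleV form"
    if "x \<in> {letter (v + u) - letter v - letter u | v u. True} \<union>
      {letter (scaleV c v) - const c * letter v | c v. True} \<union>
      {letter v * letter u + letter u * letter v - const (- 2 * form v u) | v u. True}" for x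
    unfolding clifford_ideal_def
    by (rule subsetD[OF ring.genideal_self[OF ring_of_type_algebra_ring] that]) (simp add: ring_of_type_algebra_def)
  have "letter (u + v) - letter u - letter v \<in> clifford_ideal scaleV form"
    by (rule gen) blast
  then have "letter (u + v) - (letter u + letter v) \<in> clifford_ideal scaleV form"
    by (simp only: diff_diff_eq)
  from clifford_class_eq[OF this] show "vact (u + v) s = vact u s + vact v s"
    by (simp add: vact_def d clifford_class_add act_add c)
  have "letter (scaleV a v) - const a * letter v \<in> clifford_ideal scaleV form"
    by (rule gen) blast
  from clifford_class_eq[OF this] show "vact (scaleV a v) s = scaleW a (vact v s)"
    using act_scalar by (simp add: vact_def d clifford_class_mult act_mult c)
  show "vact v (s + t) = vact v s + vact v t"
    by (simp add: vact_def d act_add_right c)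
  have "letter v * const a = const a * letter v"
    unfolding letter_def const_def mult_single by simp
  from arg_cong[OF this, of "\<lambda>x. act (clifford_class scaleV form x) s"]
  show "vact v (scaleW a s) = scaleW a (vact v s)"
    using act_scalar by (simp add: vact_def d clifford_class_mult act_mult c)
  have "act (clifford_vector scaleV form v \<otimes>\<^bsub>clifford_algebra scaleV form\<^esub> clifford_vector scaleV form u
     \<oplus>\<^bsub>clifford_algebra scaleV form\<^esub>
     clifford_vector scaleV form u \<otimes>\<^bsub>clifford_algebra scaleV form\<^esub> clifford_vector scaleV form v) s
     = act (clifford_scalar scaleV form (- 2 * form v u)) s"
    by (simp only: clifford_relation)
  then show "vact v (vact u s) + vact u (vact v s) = scaleW (- 2 * form v u) s"
    using c[of "letter v * letter u"] c[of "letter u * letter v"]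
    by (simp add: vact_def d act_scalar[unfolded d] act_add act_mult c clifford_class_mult)
qed

text \<open>The Clifford algebra is spanned by products of vectors, so invariance under vectors suffices.\<close>

lemma clifford_submodule:
  assumes U: "W.subspace U" and v: "\<And>v s. s \<in> U \<Longrightarrow> vact v s \<in> U"
    and a: "a \<in> carrier (clifford_algebra scaleV form)" and s: "s \<in> U"
  shows "act a s \<in> U"
proof -
  note c = clifford_class_carrier[of scaleV form]
  let ?cl = "clifford_class scaleV form"
  have word: "act (?cl (Poly_Mapping.single (Word vs) k)) s \<in> U" for vs k
  proof (induct vs)
    case Nil
    have "(Poly_Mapping.single (Word []) k :: ('v, 'k) free_algebra) = const k" by (simp add: const_def zero_free_word_def)
    then show ?case using act_scalar[of k s] W.subspace_scale[OF U s] by (simp add: clifford_scalar_def)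
  next
    case (Cons v vs)
    have "Poly_Mapping.single (Word (v # vs)) k = letter v * Poly_Mapping.single (Word vs) k"
      by (simp add: letter_def mult_single)
    then show ?case using assms(2)[OF Cons, of v] by (simp add: clifford_class_mult act_mult c vact_def clifford_vector_def)
  qed
  obtain x where x: "a = ?cl x" using clifford_carrier_class[OF a] by blast
  have sum: "act (?cl (\<Sum>k\<in>K. Poly_Mapping.single k (Poly_Mapping.lookup x k))) s \<in> U" if "finite K" for K
    using that
  proof (induct K rule: finite_induct)
    case empty
    have "(0 :: ('v, 'k) free_algebra) = const 0" by (simp add: const_def)
    then show ?case using act_scalar[of 0 s] W.subspace_0[OF U] by (simp add: clifford_scalar_def)
  next
    case (insert w K)
    then show ?case using word[of "case w of Word vs \<Rightarrow> vs" "Poly_Mapping.lookup x w"] W.subspace_add[OF U]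
      by (cases w) (simp add: clifford_class_add act_add c)
  qed
  have "x = (\<Sum>k\<in>Poly_Mapping.keys x. Poly_Mapping.single k (Poly_Mapping.lookup x k))"
  proof (rule poly_mapping_eqI)
    fix w
    show "Poly_Mapping.lookup x w = Poly_Mapping.lookup (\<Sum>k\<in>Poly_Mapping.keys x. Poly_Mapping.single k (Poly_Mapping.lookup x k)) w"
      by (simp add: lookup_sum lookup_single when_def in_keys_iff)
  qed
  then show ?thesis using sum[of "Poly_Mapping.keys x"] x by simp
qed

end

text \<open>Given fewer than three orthogonal non-null vectors \<open>B\<close>, if their orthogonal complement \<open>P\<close> consisted of null
  vectors, the form would vanish on \<open>P\<close> by polarization. But \<open>V = span B + P\<close>, so \<open>P = 0\<close> by nondegeneracy and
  \<open>V = span B\<close> has dimension at most 2.\<close>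

lemma (in quadratic_space) orthogonal_triple_exists:
  assumes two: "(2::'k) \<noteq> 0" and dim: "dim (UNIV :: 'v set) \<ge> 3"
  shows "\<exists>e1 e2 e3. form e1 e1 \<noteq> 0 \<and> form e2 e2 \<noteq> 0 \<and> form e3 e3 \<noteq> 0 \<and>
      form e1 e2 = 0 \<and> form e1 e3 = 0 \<and> form e2 e3 = 0"
proof -
  have add: "form (u + v) w = form u w + form v w" "form w (u + v) = form w u + form w v" for u v w
    using bilinear_form by (simp_all add: bilinear_form_def Vector_Spaces.linear_iff)
  have sc: "form (scaleV a u) w = a * form u w" "form w (scaleV a u) = a * form w u" for a u w
    using bilinear_form by (simp_all add: bilinear_form_def Vector_Spaces.linear_iff)
  have di: "form (u - v) w = form u w - form v w" "form w (u - v) = form w u - form w v" for u v w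
    using add(1)[of "u - v" v w] add(2)[of w "u - v" v] by (simp_all add: eq_diff_eq)
  have sumf: "form (\<Sum>e\<in>B. scaleV (f e) e) w = (\<Sum>e\<in>B. f e * form e w)" if "finite B" for B f w
    using that
  proof (induct B rule: finite_induct)
    case empty
    show ?case using sc(1)[of 0 0 w] by simp
  qed (simp add: add sc)
  have extend: "\<exists>e. form e e \<noteq> 0 \<and> (\<forall>b\<in>B. form b e = 0)"
    if B: "finite B" "card B < 3" "\<forall>b\<in>B. form b b \<noteq> 0" "\<forall>b\<in>B. \<forall>b'\<in>B. b \<noteq> b' \<longrightarrow> form b b' = 0" for B
  proof (rule ccontr)
    assume no: "\<not> ?thesis"
    define P where "P = {v. \<forall>b\<in>B. form b v = 0}"
    have null: "form v v = 0" if "v \<in> P" for v using no that unfolding P_def by blast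
    have PP: "form u v = 0" if "u \<in> P" "v \<in> P" for u v
    proof -
      have "u + v \<in> P" using that by (simp add: P_def add)
      then have "2 * form u v = 0"
        using null[of "u + v"] null[OF that(1)] null[OF that(2)] symmetric_form[of v u] by (simp add: add)
      then show ?thesis using two by simp
    qed
    define pr where "pr v = (\<Sum>b\<in>B. scaleV (form b v / form b b) b)" for v
    have prP: "v - pr v \<in> P" for v
    proof -
      have "form b (pr v) = form b v" if b: "b \<in> B" for b
      proof -
        have "form b (pr v) = (\<Sum>e\<in>B. form e v / form e e * form e b)"
          using sumf[OF B(1), of "\<lambda>e. form e v / form e e" b] symmetric_form[of b "pr v"] by (simp add: pr_def)
        also have "\<dots> = (\<Sum>e\<in>B. if e = b then form b v else 0)"
          by (rule sum.cong[OF refl]) (use B(3,4) b in auto)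
        also have "\<dots> = form b v" using B(1) b by simp
        finally show ?thesis .
      qed
      then show ?thesis by (simp add: P_def di)
    qed
    have P0: "u = 0" if u: "u \<in> P" for u
    proof -
      have "form u v = 0" for v
      proof -
        have "form u (pr v) = (\<Sum>e\<in>B. form e v / form e e * form e u)"
          using sumf[OF B(1), of "\<lambda>e. form e v / form e e" u] symmetric_form[of u "pr v"] by (simp add: pr_def)
        also have "\<dots> = 0" using u by (simp add: P_def)
        finally have "form u (pr v) = 0" .
        moreover have "form u (v - pr v) = 0" by (rule PP[OF u prP])
        ultimately show ?thesis by (simp add: di)
      qed
      then show ?thesis using nondegenerate_form unfolding nondegenerate_def by blast
    qed
    have "v \<in> span B" for v
    proof -
      have "v = pr v" using P0[OF prP[of v]] by simp
      also have "\<dots> \<in> span B" unfolding pr_def by (intro span_sum span_scale span_base)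
      finally show ?thesis .
    qed
    then have "UNIV \<subseteq> span B" by blast
    then have "dim (UNIV :: 'v set) \<le> card B" using B(1) by (rule dim_le_card)
    then show False using dim B(2) by simp
  qed
  obtain e1 where e1: "form e1 e1 \<noteq> 0" using extend[of "{}"] by auto
  obtain e2 where e2: "form e2 e2 \<noteq> 0" "form e1 e2 = 0" using extend[of "{e1}"] e1 by auto
  have ne: "e1 \<noteq> e2" using e1 e2 by auto
  obtain e3 where e3: "form e3 e3 \<noteq> 0" "form e1 e3 = 0" "form e2 e3 = 0"
    using extend[of "{e1, e2}"] e1 e2 ne symmetric_form[of e2 e1] by auto
  show ?thesis using e1 e2 e3 by blast
qed

context extended_translation_algebra
begin

definition \<omega> :: "'w \<Rightarrow> 'w \<Rightarrow> 'v" where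
  "\<omega> s t = fst (translation_bracket scaleV form act \<beta> (0, s) (0, t))"

lemma translation_bracket_\<omega>: "translation_bracket scaleV form act \<beta> x y = (\<omega> (snd x) (snd y), 0)"
  by (simp add: \<omega>_def translation_bracket_def)

lemma spinor_pairing:
  assumes char0: "\<And>n::nat. n > 0 \<Longrightarrow> of_nat n \<noteq> (0::'k)" and dim: "dim (UNIV :: 'v set) \<ge> 3"
  shows "spinor_pairing scaleV scaleW form vact \<beta> \<epsilon> \<omega>"
proof
  have two: "(2::'k) \<noteq> 0" using char0[of 2] by simp
  show "of_nat n \<noteq> (0::'k)" if "n > 0" for n using that by (rule char0)
  show "form (u + v) w = form u w + form v w" "form (scaleV a u) w = a * form u w" for u v w a
    using bilinear_form by (simp_all add: bilinear_form_def Vector_Spaces.linear_iff)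
  show "form u v = form v u" for u v by (rule symmetric_form)
  show "u = 0" if "\<And>v. form u v = 0" for u using nondegenerate_form that unfolding nondegenerate_def by blast
  show "\<exists>b. \<forall>v. form b v = f v" if "\<And>u v. f (u + v) = f u + f v" "\<And>a u. f (scaleV a u) = a * f u" for f
  proof -
    have "vector_space ((*) :: 'k \<Rightarrow> 'k \<Rightarrow> 'k)" by unfold_locales (simp_all add: algebra_simps)
    then have "Vector_Spaces.linear scaleV (*) f"
      unfolding Vector_Spaces.linear_iff using that vector_space_axioms by simp
    then show ?thesis using represent_functional by blast
  qed
  show "vact (u + v) s = vact u s + vact v s" "vact (scaleV a u) s = scaleW a (vact u s)"
    "vact u (s + t) = vact u s + vact u t" "vact u (scaleW a s) = scaleW a (vact u s)"
    "vact v (vact u s) + vact u (vact v s) = scaleW (- 2 * form v u) s" for u v s t a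
    by (rule vact_simps)+
  show "\<beta> (s + t) r = \<beta> s r + \<beta> t r" "\<beta> (scaleW a s) r = a * \<beta> s r" for s t r a
    using bilinear_beta by (simp_all add: bilinear_form_def Vector_Spaces.linear_iff)
  show "s = 0" if "\<And>t. \<beta> s t = 0" for s using nondegenerate_beta that unfolding nondegenerate_def by blast
  show "\<beta> t s = - \<epsilon> * \<beta> s t" for s t using beta_symmetry by (metis minus_minus mult_1 mult_minus_left)
  show "\<epsilon> * \<epsilon> = 1" using beta_symmetry by auto
  show "\<beta> (vact v s) t = \<epsilon> * \<beta> s (vact v t)" for v s t unfolding vact_def by (rule beta_clifford)
  show "form (\<omega> s t) v = \<beta> (vact v s) t" for s t v
    using translation_bracket_form[of "(0, s)" "(0, t)" v] by (simp add: \<omega>_def vact_def)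
  show "\<exists>s::'w. s \<noteq> 0" by (rule nonzero_W)
  show "\<exists>e1 e2 e3. form e1 e1 \<noteq> 0 \<and> form e2 e2 \<noteq> 0 \<and> form e3 e3 \<noteq> 0 \<and>
      form e1 e2 = 0 \<and> form e1 e3 = 0 \<and> form e2 e3 = 0"
    by (rule orthogonal_triple_exists[OF two dim])
qed

end

text \<open>Without positive degrees \<open>g\<^sub>-\<^sub>2 + g\<^sub>-\<^sub>1\<close> is an ideal. If it is everything, then \<open>g\<^sub>-\<^sub>2\<close> is a proper
  nonzero ideal.\<close>

lemma (in graded_lie_algebra) not_simple_if_nonpositive:
  assumes low: "\<And>p. p < - 2 \<Longrightarrow> gr p = {0}" and pos: "\<And>p. p \<ge> 1 \<Longrightarrow> gr p = {0}"
    and V: "v \<in> gr (- 2)" "v \<noteq> 0" and W: "s \<in> gr (- 1)" "s \<noteq> 0"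
  shows "\<not> simple_lie_algebra scale (graded_carrier scale gr) bracket"
proof
  let ?L = "graded_carrier scale gr"
  assume simple: "simple_lie_algebra scale ?L bracket"
  have zero: "0 \<in> gr p" for p by (rule subspace_0[OF subspace_gr])
  define I where "I = {x + y | x y. x \<in> gr (- 2) \<and> y \<in> gr (- 1)}"
  have gI: "gr p \<subseteq> I" if "p < 0" for p
  proof -
    have "p < - 2 \<or> p = - 2 \<or> p = - 1" using that by arith
    then show ?thesis unfolding I_def using low[of p] zero[of "- 1"] zero[of "- 2"] by force
  qed
  have subI: "subspace I" unfolding I_def by (rule subspace_sums[OF subspace_gr subspace_gr])
  have ideal_from_gr: "lie_ideal scale ?L bracket K"
    if K: "subspace K" "K \<subseteq> ?L" and br: "\<And>p x y. x \<in> gr p \<Longrightarrow> y \<in> K \<Longrightarrow> bracket x y \<in> K" for K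
    unfolding lie_ideal_def
  proof (intro conjI ballI K)
    fix x y assume x: "x \<in> ?L" and y: "y \<in> K"
    have yL: "y \<in> ?L" using y K(2) by blast
    have "x \<in> {x\<in>?L. bracket x y \<in> K}"
    proof -
      have "span (\<Union>p. gr p) \<subseteq> {x\<in>?L. bracket x y \<in> K}"
      proof (rule span_minimal)
        show "(\<Union>p. gr p) \<subseteq> {x\<in>?L. bracket x y \<in> K}" using br y gr_in_carrier by blast
        show "subspace {x\<in>?L. bracket x y \<in> K}"
          unfolding subspace_def using yL K(1) subspace_L
          by (auto simp: subspace_0 subspace_add subspace_scale bracket_add_left bracket_scale_left)
      qed
      then show ?thesis using x by (auto simp: graded_carrier_def)
    qed
    then show "bracket x y \<in> K" by simp
  qed
  have "lie_ideal scale ?L bracket I"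
  proof (rule ideal_from_gr[OF subI])
    show "I \<subseteq> ?L" unfolding I_def using gr_in_carrier subspace_add[OF subspace_L] by blast
    fix p x z assume x: "x \<in> gr p" and "z \<in> I"
    then obtain u w where z: "z = u + w" "u \<in> gr (- 2)" "w \<in> gr (- 1)" unfolding I_def by blast
    have L: "x \<in> ?L" "u \<in> ?L" "w \<in> ?L" using x z gr_in_carrier by blast+
    show "bracket x z \<in> I"
    proof (cases "p \<ge> 1")
      case True
      then have "x = 0" using x pos by blast
      then have "bracket x z = 0" using L z(1) by (simp add: subspace_add[OF subspace_L])
      then show ?thesis using subspace_0[OF subI] by simp
    next
      case False
      then have "bracket x u \<in> I" "bracket x w \<in> I"
        using bracket_gr[OF x z(2)] bracket_gr[OF x z(3)] gI[of "p + - 2"] gI[of "p + - 1"] by auto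
      then show ?thesis using L by (simp add: z(1) bracket_add_right subspace_add[OF subI])
    qed
  qed
  moreover have "I \<noteq> {0}" using gI[of "- 2"] V by auto
  ultimately have IL: "I = ?L" using simple unfolding simple_lie_algebra_def by blast
  have "lie_ideal scale ?L bracket (gr (- 2))"
  proof (rule ideal_from_gr[OF subspace_gr])
    show "gr (- 2) \<subseteq> ?L" using gr_in_carrier by blast
    fix p x z assume x: "x \<in> gr p" and z: "z \<in> gr (- 2)"
    have "x \<in> I" using gr_in_carrier[OF x] IL by simp
    then obtain u w where xw: "x = u + w" "u \<in> gr (- 2)" "w \<in> gr (- 1)" unfolding I_def by blast
    have "bracket u z = 0" "bracket w z = 0"
      using bracket_gr[OF xw(2) z] bracket_gr[OF xw(3) z] low[of "- 4"] low[of "- 3"] by simp_all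
    then have "bracket x z = 0" using xw z gr_in_carrier by (simp add: bracket_add_left)
    then show "bracket x z \<in> gr (- 2)" using zero by simp
  qed
  then have "gr (- 2) = {0} \<or> gr (- 2) = ?L" using simple unfolding simple_lie_algebra_def by blast
  then have "s \<in> gr (- 2)" using V gr_in_carrier[OF W(1)] by blast
  then show False using gr_disjoint[of s "- 2" "- 1"] W by simp
qed

theorem theorem2p7:
  fixes scaleV :: "'k::field \<Rightarrow> 'v::ab_group_add \<Rightarrow> 'v"
    and form :: "'v \<Rightarrow> 'v \<Rightarrow> 'k"
    and scaleW :: "'k \<Rightarrow> 'w::ab_group_add \<Rightarrow> 'w"
    and act :: "('v, 'k) free_algebra set \<Rightarrow> 'w \<Rightarrow> 'w"
    and spin :: "('v \<Rightarrow> 'v) \<Rightarrow> 'w \<Rightarrow> 'w"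
    and \<beta> :: "'w \<Rightarrow> 'w \<Rightarrow> 'k"
    and \<epsilon> :: 'k
    and scale :: "'k \<Rightarrow> 'g::ab_group_add \<Rightarrow> 'g"
    and gr :: "int \<Rightarrow> 'g set"
    and bracket :: "'g \<Rightarrow> 'g \<Rightarrow> 'g"
  assumes "real_or_complex TYPE('k)"
    and "extended_translation_algebra scaleV form scaleW act spin \<beta> \<epsilon>"
    and "vector_space.dim scaleV (UNIV :: 'v set) \<ge> 3"
    and "maximal_transitive_prolongation
           (translation_scale scaleV scaleW) translation_gr (translation_bracket scaleV form act \<beta>) scale gr bracket"
    and "irreducible_clifford_module scaleV form scaleW act"
  shows "((\<forall>p\<ge>1. gr p = {0}) \<or> simple_lie_algebra scale (graded_carrier scale gr) bracket) \<and>
    \<not> ((\<forall>p\<ge>1. gr p = {0}) \<and> simple_lie_algebra scale (graded_carrier scale gr) bracket)"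
proof -
  interpret E: extended_translation_algebra scaleV form scaleW act spin \<beta> \<epsilon> by fact
  have char0: "\<And>n::nat. n > 0 \<Longrightarrow> of_nat n \<noteq> (0::'k)" by (rule real_or_complex_char_0[OF assms(1)])
  interpret S: spinor_pairing scaleV scaleW form E.vact \<beta> \<epsilon> E.\<omega>
    by (rule E.spinor_pairing[OF char0 assms(3)])
  let ?br0 = "translation_bracket scaleV form act \<beta>"
  have tp: "transitive_prolongation (translation_scale scaleV scaleW) translation_gr ?br0 scale gr bracket"
    by (rule assms(4)[unfolded maximal_transitive_prolongation_def, THEN conjunct1])
  note tp' = tp[unfolded transitive_prolongation_def]
  have fin: "finite_dim scale (gr p)" for p using tp' by simp
  have trans: "x = 0" if "p \<ge> 0" "x \<in> gr p" "\<forall>y\<in>gr (- 1). bracket x y = 0" for p x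
    using tp that by (simp add: transitive_prolongation_def)
  interpret G: graded_lie_algebra scale gr bracket
    by (rule tp'[THEN conjunct1])
  obtain j where j: "graded_lie_hom (translation_scale scaleV scaleW) translation_gr ?br0 scale gr bracket j"
    and j_inj: "inj_on j (graded_carrier (translation_scale scaleV scaleW) translation_gr)"
    and j_gr: "\<And>p. p < 0 \<Longrightarrow> j ` translation_gr p = gr p"
    using tp'[THEN conjunct2, THEN conjunct2, THEN conjunct1] by (elim exE conjE) simp
  have j_add: "j (x + y) = j x + j y" and j_scale: "j (translation_scale scaleV scaleW a x) = scale a (j x)"
    and j_br: "j (?br0 x y) = bracket (j x) (j y)" for x y a
    using j unfolding graded_lie_hom_def E.translation_carrier by (simp_all del: split_paired_All)
  have j0: "j 0 = 0" using j_add[of 0 0] by simp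
  have j_eq0: "x = 0" if "j x = 0" for x
    using inj_onD[OF j_inj, of x 0] that j0 unfolding E.translation_carrier by simp
  interpret P: translation_prolongation scaleV scaleW form E.vact \<beta> \<epsilon> E.\<omega> scale gr bracket
    "\<lambda>v. j (v, 0)" "\<lambda>s. j (0, s)"
  proof
    show "j (u + v, 0) = j (u, 0) + j (v, 0)" "j (scaleV a u, 0) = scale a (j (u, 0))" for u v a
      using j_add[of "(u, 0)" "(v, 0)"] j_scale[of a "(u, 0)"] by (simp_all add: translation_scale_def)
    show "j (0, s + t) = j (0, s) + j (0, t)" "j (0, scaleW a s) = scale a (j (0, s))" for s t a
      using j_add[of "(0, s)" "(0, t)"] j_scale[of a "(0, s)"] by (simp_all add: translation_scale_def)
    show "u = 0" if "j (u, 0) = 0" for u using j_eq0[OF that] by (simp add: zero_prod_def)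
    show "s = 0" if "j (0, s) = 0" for s using j_eq0[OF that] by (simp add: zero_prod_def)
    show "gr (- 2) = range (\<lambda>v. j (v, 0))" using j_gr[of "- 2"] by (auto simp: translation_gr_def)
    show "gr (- 1) = range (\<lambda>s. j (0, s))" using j_gr[of "- 1"] by (auto simp: translation_gr_def)
    show "gr p = {0}" if "p < - 2" for p using j_gr[of p] that j0 by (auto simp: translation_gr_def)
    show "bracket (j (0, s)) (j (0, t)) = j (E.\<omega> s t, 0)" for s t
      using j_br[of "(0, s)" "(0, t)"] by (simp add: E.translation_bracket_\<omega>)
    show "x = 0" if "p \<ge> 0" "x \<in> gr p" "\<And>s. bracket x (j (0, s)) = 0" for p x
    proof -
      have "\<forall>y\<in>gr (- 1). bracket x y = 0"
      proof
        fix y assume "y \<in> gr (- 1)"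
        then have "y \<in> j ` translation_gr (- 1)" using j_gr[of "- 1"] by simp
        then obtain s where "y = j (0, s)" by (auto simp: translation_gr_def)
        then show "bracket x y = 0" using that(3) by simp
      qed
      then show ?thesis by (rule trans[OF that(1,2)])
    qed
    show "finite_dim scale (gr p)" for p by (rule fin)
  qed
  interpret T: two_step scaleV scaleW E.\<omega>
    by unfold_locales (fact S.two_nonzero S.omega_add S.omega_scale S.omega_skew S.span_omega E.finite_dim_V E.finite_dim_W)+
  have embed: "\<exists>f. graded_lie_hom (fun_scale T.sc) T.L.total_gr (total_bracket jet_bracket) scale gr bracket f \<and>
      inj_on f (graded_carrier (fun_scale T.sc) T.L.total_gr)"
    by (rule maximal_transitive_prolongation_any_type[OF assms(4) E.vector_space_translation_scale
          T.jets_transitive_prolongation[OF E.translation_bracket_\<omega>]])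
  have irred: "U = {0} \<or> U = UNIV" if "E.W.subspace U" "\<And>v s. s \<in> U \<Longrightarrow> E.vact v s \<in> U" for U
    using assms(5) E.clifford_submodule[OF that] that(1) unfolding irreducible_clifford_module_def by blast
  interpret M: maximal_translation_prolongation scaleV scaleW form E.vact \<beta> \<epsilon> E.\<omega> scale gr bracket
    "\<lambda>v. j (v, 0)" "\<lambda>s. j (0, s)"
    by unfold_locales (fact embed, fact irred)
  have "simple_lie_algebra scale (graded_carrier scale gr) bracket" if "\<not> (\<forall>p\<ge>1. gr p = {0})"
    using M.simple_if_positive_part that by blast
  moreover have "\<not> simple_lie_algebra scale (graded_carrier scale gr) bracket" if "\<forall>p\<ge>1. gr p = {0}"
  proof -
    obtain v :: 'v where v: "v \<noteq> 0" using E.nonzero_V by blast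
    obtain s :: 'w where s: "s \<noteq> 0" using E.nonzero_W by blast
    show ?thesis
      by (rule G.not_simple_if_nonpositive[OF P.gr_low _ P.jV_gr _ P.jW_gr])
        (use that v s P.jV_inj P.jW_inj in blast)+
  qed
  ultimately show ?thesis by blast
qed

end
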